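(* Suppose $V$ is a simple CFT-type vertex operator algebra and $G$ is a finite automorphism group of $V$. If the fixed-point subalgebra $V^G$ is strongly rational, then $V$ is also strongly rational.
   Context: A vertex operator algebra is strongly rational if it is simple, of CFT type (its $\mathbb Z$-grading is by non-negative integers with $V_{(0)}=\mathbb C\mathbf 1$), self-contragredient (isomorphic to its contragredient module $V'$), $C_2$-cofinite, and rational (every $\mathbb N$-gradable weak module is a direct sum of irreducible grading-restricted modules). $V^G$ is the subalgebra of $G$-fixed vectors. *)

theory Defs
  imports Complex_Main "HOL-Library.Groups_Big_Fun" "HOL-Library.Function_Algebras"
begin

text \<open>A vertex operator algebra is given by a complex vector space structure
  (scalar multiplication vscale on an ambient type, carrier set V), the modes
  u_n of the vertex operator Y(u,x) = sum_n u_n x^(-n-1), the vacuum vector and the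
  conformal vector omega (so that L(n) = omega_(n+1)).\<close>

record 'v voa =
  vscale :: "complex \<Rightarrow> 'v \<Rightarrow> 'v"
  vcarrier :: "'v set"
  vmode :: "'v \<Rightarrow> int \<Rightarrow> 'v \<Rightarrow> 'v"
  vac :: 'v
  omg :: 'v

text \<open>A (candidate) module for a VOA: scalar multiplication, carrier, and modes
  Y_W(u,x) = sum_n u_n x^(-n-1) for u in V.\<close>

record ('v, 'w) vmod =
  mscale :: "complex \<Rightarrow> 'w \<Rightarrow> 'w"
  mcarrier :: "'w set"
  mmode :: "'v \<Rightarrow> int \<Rightarrow> 'w \<Rightarrow> 'w"

definition lin_on :: "('a \<Rightarrow> 'b \<Rightarrow> 'b) \<Rightarrow> ('a \<Rightarrow> 'c \<Rightarrow> 'c) \<Rightarrow> 'b::plus set \<Rightarrow> ('b \<Rightarrow> 'c::plus) \<Rightarrow> bool"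
  where "lin_on s1 s2 A f \<longleftrightarrow> (\<forall>x\<in>A. \<forall>y\<in>A. \<forall>c. f (s1 c x + y) = s2 c (f x) + f y)"

definition fin_dim_sub :: "(complex \<Rightarrow> 'w \<Rightarrow> 'w) \<Rightarrow> 'w::ab_group_add set \<Rightarrow> bool"
  where "fin_dim_sub s S \<longleftrightarrow> (\<exists>B. finite B \<and> B \<subseteq> S \<and> module.span s B = S)"

definition internal_dsum :: "(complex \<Rightarrow> 'w \<Rightarrow> 'w) \<Rightarrow> 'w::ab_group_add set \<Rightarrow> ('i \<Rightarrow> 'w set) \<Rightarrow> 'i set \<Rightarrow> bool"
  where "internal_dsum s W F I \<longleftrightarrow>
     (\<forall>i\<in>I. module.subspace s (F i) \<and> F i \<subseteq> W) \<and>
     module.span s (\<Union>i\<in>I. F i) = W \<and>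
     (\<forall>i\<in>I. F i \<inter> module.span s (\<Union>j\<in>I - {i}. F j) = {0})"

definition Lop :: "'v voa \<Rightarrow> int \<Rightarrow> 'v \<Rightarrow> 'v"
  where "Lop V n = vmode V (omg V) (n + 1)"

definition wtsp :: "'v voa \<Rightarrow> int \<Rightarrow> 'v set"
  where "wtsp V k = {v \<in> vcarrier V. Lop V 0 v = vscale V (of_int k) v}"

text \<open>Weak module axioms: vector space, closure, linearity of Y_W in both arguments,
  truncation, vacuum property, and the Jacobi identity in its component
  (Borcherds) form.\<close>
definition weak_module :: "'v::ab_group_add voa \<Rightarrow> ('v, 'w::ab_group_add) vmod \<Rightarrow> bool"
  where "weak_module V M \<longleftrightarrow>
    (let s = mscale M; W = mcarrier M; Y = mmode M in
     vector_space s \<and> module.subspace s W \<and>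
     (\<forall>u\<in>vcarrier V. \<forall>n. \<forall>w\<in>W. Y u n w \<in> W) \<and>
     (\<forall>u\<in>vcarrier V. \<forall>n. lin_on s s W (Y u n)) \<and>
     (\<forall>w\<in>W. \<forall>n. lin_on (vscale V) s (vcarrier V) (\<lambda>u. Y u n w)) \<and>
     (\<forall>u\<in>vcarrier V. \<forall>w\<in>W. \<exists>N. \<forall>n\<ge>N. Y u n w = 0) \<and>
     (\<forall>w\<in>W. \<forall>n. Y (vac V) n w = (if n = -1 then w else 0)) \<and>
     (\<forall>u\<in>vcarrier V. \<forall>v\<in>vcarrier V. \<forall>w\<in>W. \<forall>l m n :: int.
        Sum_any (\<lambda>i::nat. s ((of_int m :: complex) gchoose i)
                             (Y (vmode V u (l + int i) v) (m + n - int i) w))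
      = Sum_any (\<lambda>i::nat. s ((-1) ^ i * ((of_int l :: complex) gchoose i))
                             (Y u (l + m - int i) (Y v (n + int i) w)
                              - s ((-1) powi l) (Y v (l + n - int i) (Y u (m + int i) w))))))"

definition adjoint :: "'v voa \<Rightarrow> ('v, 'v) vmod"
  where "adjoint V = \<lparr>mscale = vscale V, mcarrier = vcarrier V, mmode = vmode V\<rparr>"

definition voa :: "'v::ab_group_add voa \<Rightarrow> bool"
  where "voa V \<longleftrightarrow>
    (let s = vscale V; A = vcarrier V; Y = vmode V; L = Lop V in
     weak_module V (adjoint V) \<and> vac V \<in> A \<and> omg V \<in> A \<and>
     \<comment> \<open>creation property\<close>
     (\<forall>u\<in>A. (\<forall>n\<ge>0. Y u n (vac V) = 0) \<and> Y u (-1) (vac V) = u) \<and>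
     \<comment> \<open>Virasoro relations with some central charge c\<close>
     (\<exists>c::complex. \<forall>m n :: int. \<forall>w\<in>A.
        L m (L n w) - L n (L m w)
        = s (of_int (m - n)) (L (m + n) w)
          + s ((of_int (m ^ 3 - m) / 12) * (if m + n = 0 then 1 else 0) * c) w) \<and>
     \<comment> \<open>L(-1)-derivative property: Y(L(-1)u,x) = d/dx Y(u,x)\<close>
     (\<forall>u\<in>A. \<forall>n. \<forall>w\<in>A. Y (L (-1) u) n w = s (- of_int n) (Y u (n - 1) w)) \<and>
     \<comment> \<open>Z-grading by L(0)-eigenvalues, finite-dimensional, bounded below\<close>
     module.span s (\<Union>k. wtsp V k) = A \<and>
     (\<forall>k. fin_dim_sub s (wtsp V k)) \<and>
     (\<exists>N. \<forall>k<N. wtsp V k = {0}))"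

definition cft_type :: "'v::ab_group_add voa \<Rightarrow> bool"
  where "cft_type V \<longleftrightarrow> (\<forall>k<0. wtsp V k = {0}) \<and> wtsp V 0 = module.span (vscale V) {vac V}"

definition submodule :: "'v voa \<Rightarrow> ('v, 'w::ab_group_add) vmod \<Rightarrow> 'w set \<Rightarrow> bool"
  where "submodule V M S \<longleftrightarrow> module.subspace (mscale M) S \<and> S \<subseteq> mcarrier M \<and>
     (\<forall>u\<in>vcarrier V. \<forall>n. \<forall>w\<in>S. mmode M u n w \<in> S)"

definition irreducible :: "'v voa \<Rightarrow> ('v, 'w::ab_group_add) vmod \<Rightarrow> bool"
  where "irreducible V M \<longleftrightarrow> mcarrier M \<noteq> {0} \<and>
     (\<forall>S. submodule V M S \<longrightarrow> S = {0} \<or> S = mcarrier M)"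

definition simple :: "'v::ab_group_add voa \<Rightarrow> bool"
  where "simple V \<longleftrightarrow> irreducible V (adjoint V)"

definition N_gradable :: "'v voa \<Rightarrow> ('v, 'w::ab_group_add) vmod \<Rightarrow> bool"
  where "N_gradable V M \<longleftrightarrow> (\<exists>Wg :: nat \<Rightarrow> 'w set.
     internal_dsum (mscale M) (mcarrier M) Wg UNIV \<and>
     (\<forall>k. \<forall>u\<in>wtsp V k. \<forall>m. \<forall>j. \<forall>w\<in>Wg j.
        mmode M u m w \<in> (if k - m - 1 + int j \<ge> 0 then Wg (nat (k - m - 1 + int j)) else {0})))"

definition mwtsp :: "'v voa \<Rightarrow> ('v, 'w) vmod \<Rightarrow> complex \<Rightarrow> 'w set"
  where "mwtsp V M lam = {w \<in> mcarrier M. mmode M (omg V) 1 w = mscale M lam w}"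

definition grading_restricted :: "'v voa \<Rightarrow> ('v, 'w::ab_group_add) vmod \<Rightarrow> bool"
  where "grading_restricted V M \<longleftrightarrow>
     module.span (mscale M) (\<Union>lam. mwtsp V M lam) = mcarrier M \<and>
     (\<forall>lam. fin_dim_sub (mscale M) (mwtsp V M lam)) \<and>
     (\<forall>lam. \<exists>N. \<forall>n::int. n < N \<longrightarrow> mwtsp V M (lam + of_int n) = {0})"

text \<open>Rationality, relative to modules whose carriers live in the type 'w.\<close>
definition rational :: "'w::ab_group_add itself \<Rightarrow> 'v::ab_group_add voa \<Rightarrow> bool"
  where "rational (_ :: 'w itself) V \<longleftrightarrow>
    (\<forall>M :: ('v, 'w) vmod. weak_module V M \<and> N_gradable V M \<longrightarrow>
       (\<exists>S. internal_dsum (mscale M) (mcarrier M) id S \<and>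
            (\<forall>X\<in>S. submodule V M X \<and> irreducible V (M\<lparr>mcarrier := X\<rparr>)
                   \<and> grading_restricted V (M\<lparr>mcarrier := X\<rparr>))))"

definition C2_cofinite :: "'v::ab_group_add voa \<Rightarrow> bool"
  where "C2_cofinite V \<longleftrightarrow>
    (\<exists>B. finite B \<and> B \<subseteq> vcarrier V \<and>
       module.span (vscale V)
         (B \<union> {vmode V u (-2) v | u v. u \<in> vcarrier V \<and> v \<in> vcarrier V}) = vcarrier V)"

text \<open>Contragredient module V' = restricted dual (sum of the duals of the V_(k)),
  represented by functionals 'v => complex vanishing outside V. For homogeneous
  v of weight k, <Y'(v,x)f, w> = <f, Y(e^(xL(1)) (-x^(-2))^L(0) v, x^(-1)) w>, i.e.
  (v'_n f)(w) = (-1)^k sum_j 1/j! f((L(1)^j v)_(2k-j-n-2) w).\<close>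
definition contra_carrier :: "'v::ab_group_add voa \<Rightarrow> ('v \<Rightarrow> complex) set"
  where "contra_carrier V = {f. (\<forall>u. u \<notin> vcarrier V \<longrightarrow> f u = 0) \<and>
      lin_on (vscale V) (\<lambda>c z. c * z) (vcarrier V) f \<and>
      finite {k. \<exists>u\<in>wtsp V k. f u \<noteq> 0}}"

definition contra_scale :: "complex \<Rightarrow> ('v \<Rightarrow> complex) \<Rightarrow> ('v \<Rightarrow> complex)"
  where "contra_scale c f = (\<lambda>u. c * f u)"

definition contra_mode :: "'v voa \<Rightarrow> int \<Rightarrow> 'v \<Rightarrow> int \<Rightarrow> ('v \<Rightarrow> complex) \<Rightarrow> ('v \<Rightarrow> complex)"
  where "contra_mode V k v n f = (\<lambda>w. if w \<in> vcarrier V then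
      ((-1) powi k) * Sum_any (\<lambda>j::nat. (1 / fact j) *
         f (vmode V ((Lop V 1 ^^ j) v) (2 * k - int j - n - 2) w))
    else 0)"

definition self_contragredient :: "'v::ab_group_add voa \<Rightarrow> bool"
  where "self_contragredient V \<longleftrightarrow>
    (\<exists>\<phi> :: 'v \<Rightarrow> ('v \<Rightarrow> complex).
       bij_betw \<phi> (vcarrier V) (contra_carrier V) \<and>
       lin_on (vscale V) contra_scale (vcarrier V) \<phi> \<and>
       (\<forall>k. \<forall>u\<in>wtsp V k. \<forall>n. \<forall>w\<in>vcarrier V.
          \<phi> (vmode V u n w) = contra_mode V k u n (\<phi> w)))"

definition strongly_rational :: "'w::ab_group_add itself \<Rightarrow> 'v::ab_group_add voa \<Rightarrow> bool"
  where "strongly_rational T V \<longleftrightarrow>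
    voa V \<and> simple V \<and> cft_type V \<and> self_contragredient V \<and> C2_cofinite V \<and> rational T V"

definition voa_aut :: "'v::ab_group_add voa \<Rightarrow> ('v \<Rightarrow> 'v) \<Rightarrow> bool"
  where "voa_aut V g \<longleftrightarrow> bij_betw g (vcarrier V) (vcarrier V) \<and>
     lin_on (vscale V) (vscale V) (vcarrier V) g \<and>
     (\<forall>u\<in>vcarrier V. \<forall>n. \<forall>v\<in>vcarrier V. g (vmode V u n v) = vmode V (g u) n (g v)) \<and>
     g (vac V) = vac V \<and> g (omg V) = omg V \<and>
     (\<forall>u. u \<notin> vcarrier V \<longrightarrow> g u = u)"

definition finite_aut_group :: "'v::ab_group_add voa \<Rightarrow> ('v \<Rightarrow> 'v) set \<Rightarrow> bool"
  where "finite_aut_group V G \<longleftrightarrow> finite G \<and> id \<in> G \<and> (\<forall>g\<in>G. voa_aut V g) \<and>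
     (\<forall>g\<in>G. \<forall>h\<in>G. g \<circ> h \<in> G) \<and> (\<forall>g\<in>G. \<exists>h\<in>G. h \<circ> g = id)"

definition fixed_sub :: "'v voa \<Rightarrow> ('v \<Rightarrow> 'v) set \<Rightarrow> 'v voa"
  where "fixed_sub V G = V\<lparr>vcarrier := {v \<in> vcarrier V. \<forall>g\<in>G. g v = v}\<rparr>"

end

theory Submission
  imports Defs "HOL-Library.Multiset"
begin

text \<open>
  Let \<open>U = V\<^sup>G\<close>. As \<open>G\<close> does not act on a \<open>V\<close>-module \<open>M\<close>, one replaces \<open>M\<close> by the tuples
  \<open>(m\<^sub>g)\<close> indexed by \<open>G\<close>, on which \<open>V\<close> acts at the component \<open>g\<close> through \<open>g\<close>. An analogue of the
  Artin--Dedekind independence of automorphisms (using only that \<open>V\<close> is simple) shows that a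
  \<open>U\<close>-submodule \<open>C\<close> of \<open>M\<close> can be recovered from the tuples \<open>((ga)\<^sub>n c)\<^sub>g\<close> that it generates, by
  summing components, and that \<open>C = M\<close> yields all tuples. Hence a \<open>U\<close>-complement of a
  \<open>V\<close>-submodule produces a \<open>V\<close>-complement, and an irreducible \<open>V\<close>-module has \<open>U\<close>-length at most
  \<open>card G\<close>. This gives rationality, and that \<open>V\<close> is finitely generated over \<open>U\<close>.

  For \<open>C\<^sub>2\<close>-cofiniteness, products of modes of \<open>U\<close> applied to a generator are rewritten (following
  Miyamoto) modulo \<open>C\<^sub>2(V)\<close> until their modes are distinct and lie in a bounded range.

  Evaluating the isomorphism of \<open>U\<close> with its contragredient at the vacuum gives \<open>L(1)U\<^sub>1 = 0\<close>, and
  averaging over \<open>G\<close> gives \<open>L(1)V\<^sub>1 = 0\<close>. Then (Li) the vacuum coefficient is a vacuum-like vector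
  of the contragredient module of \<open>V\<close>, so \<open>w \<mapsto> w\<^sub>-\<^sub>1 vc\<close> is a homomorphism; it is
  bijective because \<open>V\<close> is simple with finite-dimensional weight spaces.
\<close>

section \<open>Eigenvectors and operator-invariant subspaces\<close>

text \<open>The model is Galois descent. For a Galois extension B of A with group G and a B-module
  M, the map b tensor m -> (g(b) m)_g identifies B tensor_A M with all tuples over M. No tensor
  product of modules is formed here: its image \<open>gen C\<close> among the tuples is enough.
  Rationality is relative to a carrier type. So rationality of \<open>U\<close> is applied only to
  \<open>M\<close> itself, and tuples are auxiliary vectors whose components lead back into
  \<open>M\<close>. Vertex operators have infinitely many modes, so associativity and commutation
  cannot be applied to a single product of modes. Each use becomes a descent on the inner mode:
  truncation settles the large modes, and a finite identity with leading coefficient 1 reduces every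
  other product to products with larger inner mode. Finite generation over \<open>U\<close> serves
  twice. It confines an irreducible \<open>V\<close>-module to finitely many
  \<open>U\<close>-summands, which controls its weight spaces, and it supplies the finitely many
  starting vectors of the rewriting for \<open>C2_cofinite\<close>.\<close>

context vector_space
begin

lemma lin_on_0:
  assumes "subspace A" "lin_on scale s2 A f" "vector_space s2"
  shows "f 0 = 0"
proof -
  interpret s2: vector_space s2 by fact
  have "f (scale 1 0 + 0) = s2 1 (f 0) + f 0"
    using assms(1,2) subspace_0 unfolding lin_on_def by blast
  then show ?thesis by simp
qed

lemma lin_on_add:
  assumes "subspace A" "lin_on scale s2 A f" "vector_space s2" "x \<in> A" "y \<in> A"
  shows "f (x + y) = f x + f y"
proof -
  interpret s2: vector_space s2 by fact
  have "f (scale 1 x + y) = s2 1 (f x) + f y"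
    using assms unfolding lin_on_def by blast
  then show ?thesis by simp
qed

lemma lin_on_scale:
  assumes "subspace A" "lin_on scale s2 A f" "vector_space s2" "x \<in> A"
  shows "f (scale c x) = s2 c (f x)"
proof -
  have "f (scale c x + 0) = s2 c (f x) + f 0"
    using assms subspace_0 unfolding lin_on_def by blast
  then show ?thesis using lin_on_0[OF assms(1-3)] by simp
qed

lemma lin_on_uminus:
  assumes "subspace A" "lin_on scale s2 A f" "vector_space s2" "x \<in> A"
  shows "f (- x) = - f x"
proof -
  interpret s2: vector_space s2 by fact
  show ?thesis using lin_on_scale[OF assms, of "-1"] by simp
qed

lemma lin_on_diff:
  assumes "subspace A" "lin_on scale s2 A f" "vector_space s2" "x \<in> A" "y \<in> A"
  shows "f (x - y) = f x - f y"
  using lin_on_add[OF assms(1-4), of "- y"] lin_on_uminus[OF assms(1-3,5)] subspace_neg[OF assms(1,5)]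
  by simp

lemma lin_on_sum:
  assumes "subspace A" "lin_on scale s2 A f" "vector_space s2" "\<And>i. i \<in> I \<Longrightarrow> x i \<in> A"
  shows "f (\<Sum>i\<in>I. x i) = (\<Sum>i\<in>I. f (x i))"
  using assms(4)
proof (induction I rule: infinite_finite_induct)
  case (insert i I)
  then show ?case
    by (simp add: lin_on_add[OF assms(1-3)] subspace_sum[OF assms(1)])
qed (auto simp: lin_on_0[OF assms(1-3)])

lemma span_UN_decomp:
  assumes "x \<in> span (\<Union>i\<in>I. E i)" and E: "\<And>i. i \<in> I \<Longrightarrow> subspace (E i)"
  shows "\<exists>J z. finite J \<and> J \<subseteq> I \<and> (\<forall>i\<in>J. z i \<in> E i) \<and> x = (\<Sum>i\<in>J. z i)"
  using assms(1)
proof (induction rule: span_induct_alt)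
  case base
  then show ?case by (intro exI[of _ "{}"]) auto
next
  case (step c x y)
  then obtain J z where J: "finite J" "J \<subseteq> I" "\<forall>i\<in>J. z i \<in> E i" "y = (\<Sum>i\<in>J. z i)" by blast
  obtain i where i: "i \<in> I" "x \<in> E i" using step by blast
  \<comment> \<open>\<open>z\<close> is arbitrary off \<open>J\<close>; resetting it to 0 there lets
    the new summand be added at \<open>i\<close> whether or not \<open>i\<close> is already in
    \<open>J\<close>.\<close>
  define z' where "z' = (\<lambda>j. if j \<in> J then z j else 0)"
  have "(\<Sum>j\<in>insert i J. (z'(i := z' i + scale c x)) j) = scale c x + y"
  proof (cases "i \<in> J")
    case True
    then have "(\<Sum>j\<in>insert i J. (z'(i := z' i + scale c x)) j)
        = (\<Sum>j\<in>J. z' j + (if j = i then scale c x else 0))"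
      by (intro sum.cong) (auto simp: insert_absorb)
    also have "\<dots> = scale c x + y"
      using True J by (simp add: sum.distrib z'_def)
    finally show ?thesis .
  next
    case False
    have "(\<Sum>j\<in>J. (z'(i := z' i + scale c x)) j) = (\<Sum>j\<in>J. z j)"
      using False by (intro sum.cong) (auto simp: z'_def)
    then show ?thesis using False J by (simp add: z'_def)
  qed
  moreover have "\<forall>j\<in>insert i J. (z'(i := z' i + scale c x)) j \<in> E j"
    using i J(2,3) E by (auto simp: z'_def subspace_0 intro!: subspace_add subspace_scale)
  ultimately show ?case
    using J i by (intro exI[of _ "insert i J"] exI[of _ "z'(i := z' i + scale c x)"]) auto
qed

text \<open>Applying \<open>T - ev j\<close> removes the component at \<open>j\<close>.\<close>
lemma eigen_components:
  assumes "subspace W" "lin_on scale scale W T" "subspace X" "X \<subseteq> W" "\<And>x. x \<in> X \<Longrightarrow> T x \<in> X"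
    and "finite J" "inj_on ev J" "\<And>i. i \<in> J \<Longrightarrow> z i \<in> W" "\<And>i. i \<in> J \<Longrightarrow> T (z i) = scale (ev i) (z i)"
    and "(\<Sum>i\<in>J. z i) \<in> X" "i \<in> J"
  shows "z i \<in> X"
  using assms(6-11)
proof (induction J arbitrary: z i rule: finite_induct)
  case (insert j J)
  have vs: "vector_space scale" by unfold_locales
  let ?x = "\<Sum>i\<in>insert j J. z i"
  have "T ?x = (\<Sum>i\<in>insert j J. scale (ev i) (z i))"
    using insert.prems by (subst lin_on_sum[OF assms(1,2) vs]) auto
  then have "T ?x - scale (ev j) ?x = (\<Sum>i\<in>insert j J. scale (ev i - ev j) (z i))"
    by (simp add: scale_sum_right sum_subtractf scale_left_diff_distrib del: sum.insert)
  also have "\<dots> = (\<Sum>i\<in>J. scale (ev i - ev j) (z i))"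
    using insert.hyps by simp
  finally have *: "(\<Sum>i\<in>J. scale (ev i - ev j) (z i)) \<in> X"
    using insert.prems(4) assms(3,5) by (metis subspace_diff subspace_scale)
  have J: "z i \<in> X" if i: "i \<in> J" for i
  proof -
    have "scale (ev i - ev j) (z i) \<in> X"
    proof (rule insert.IH[OF _ _ _ * i])
      show "inj_on ev J" using insert.prems(1) by auto
      show "scale (ev k - ev j) (z k) \<in> W" if "k \<in> J" for k
        using insert.prems(2) that assms(1) by (auto intro: subspace_scale)
      show "T (scale (ev k - ev j) (z k)) = scale (ev k) (scale (ev k - ev j) (z k))" if "k \<in> J" for k
        using insert.prems(2,3) that by (simp add: lin_on_scale[OF assms(1,2) vs] mult.commute)
    qed
    moreover have "ev i - ev j \<noteq> 0"
      using insert.prems(1) insert.hyps i by (auto simp: inj_on_def)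
    ultimately have "scale (inverse (ev i - ev j)) (scale (ev i - ev j) (z i)) \<in> X"
      using assms(3) subspace_scale by blast
    then show ?thesis using \<open>ev i - ev j \<noteq> 0\<close> by simp
  qed
  have "z j = ?x - (\<Sum>i\<in>J. z i)" using insert.hyps by simp
  then have "z j \<in> X"
    using insert.prems(4) J assms(3) by (metis subspace_diff subspace_sum)
  then show ?case using J insert.prems(5) by auto
qed simp

lemma subspace_eigenspace:
  assumes "subspace W" "lin_on scale scale W T"
  shows "subspace {w \<in> W. T w = scale c w}"
proof -
  have vs: "vector_space scale" by unfold_locales
  show ?thesis
    unfolding subspace_def using assms(1)
    by (auto simp: lin_on_0[OF assms vs] lin_on_add[OF assms vs] lin_on_scale[OF assms vs]
        subspace_0 subspace_add subspace_scale scale_right_distrib mult.commute)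
qed

text \<open>By \<open>eigen_components\<close> each component of \<open>x\<close> lies in the
  eigenspace for \<open>ev k\<close>, but it also has its own eigenvalue \<open>ev i\<close>. As
  \<open>ev\<close> is injective, only the component at \<open>k\<close> survives.\<close>

lemma eigenspace_of_span:
  assumes W: "subspace W" and T: "lin_on scale scale W T" and "inj_on ev I"
    and E: "\<And>i. i \<in> I \<Longrightarrow> subspace (E i)" "\<And>i. i \<in> I \<Longrightarrow> E i \<subseteq> {w \<in> W. T w = scale (ev i) w}"
    and x: "x \<in> span (\<Union>i\<in>I. E i)" "x \<in> W" "T x = scale (ev k) x" "k \<in> I"
  shows "x \<in> E k"
proof -
  have vs: "vector_space scale" by unfold_locales
  obtain J z where J: "finite J" "J \<subseteq> I" "\<forall>i\<in>J. z i \<in> E i" "x = (\<Sum>i\<in>J. z i)"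
    using span_UN_decomp[OF x(1) E(1)] by blast
  let ?X = "{w \<in> W. T w = scale (ev k) w}"
  have zX: "z i \<in> ?X" if "i \<in> J" for i
  proof (rule eigen_components[of W T ?X J ev z i])
    show "z j \<in> W" "T (z j) = scale (ev j) (z j)" if "j \<in> J" for j
      using that J E(2)[of j] by auto
    show "T w \<in> ?X" if "w \<in> ?X" for w
      using that W T lin_on_scale[OF W T vs] by (auto intro: subspace_scale)
  qed (use W T that J E assms(3) x subspace_eigenspace[OF W T] in
      \<open>auto intro: inj_on_subset\<close>)
  have "z i = 0" if "i \<in> J" "i \<noteq> k" for i
  proof -
    have "scale (ev i) (z i) = scale (ev k) (z i)"
    proof -
      have "z i \<in> E i" "i \<in> I" using J that by auto
      then have "T (z i) = scale (ev i) (z i)" using E(2) by blast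
      then show ?thesis using zX[OF that(1)] by simp
    qed
    moreover have "ev i \<noteq> ev k"
      using that J assms(3) x(4) by (metis inj_onD subsetD)
    ultimately show ?thesis by simp
  qed
  then have "x = (\<Sum>i\<in>J. if i = k then z i else 0)" unfolding J(4) by (intro sum.cong) auto
  then show ?thesis using J x(4) E(1)[OF x(4)] by (auto simp: sum.delta' subspace_0)
qed

lemma finite_subset_chain_member:
  assumes "finite F" "F \<subseteq> \<Union>C" "C \<noteq> {}" "subset.chain A C"
  shows "\<exists>X\<in>C. F \<subseteq> X"
  using finite_subset_Union_chain[OF assms] by blast

lemma subspace_Union_chain:
  assumes "C \<noteq> {}" "subset.chain A C" "\<And>X. X \<in> C \<Longrightarrow> subspace X"
  shows "subspace (\<Union>C)"
proof -
  have two: "\<exists>X\<in>C. x \<in> X \<and> y \<in> X" if "x \<in> \<Union>C" "y \<in> \<Union>C" for x y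
    using finite_subset_chain_member[of "{x, y}" C A] that assms by auto
  show ?thesis
    unfolding subspace_def
  proof (intro conjI ballI allI)
    show "0 \<in> \<Union>C" using assms(1,3) subspace_0 by blast
    show "x + y \<in> \<Union>C" if "x \<in> \<Union>C" "y \<in> \<Union>C" for x y
      using two[OF that] assms(3) subspace_add by blast
    show "scale c x \<in> \<Union>C" if "x \<in> \<Union>C" for c x
      using that assms(3) subspace_scale by blast
  qed
qed

end

lemma fin_dim_sub_subspace:
  fixes s :: "complex \<Rightarrow> 'w::ab_group_add \<Rightarrow> 'w"
  assumes "vector_space s" "finite B" "module.subspace s S" "S \<subseteq> module.span s B"
  shows "fin_dim_sub s S"
proof -
  interpret s: vector_space s by fact
  obtain B' where B': "B' \<subseteq> S" "s.independent B'" "S \<subseteq> s.span B'"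
    using s.maximal_independent_subset by metis
  have "finite B'"
    using s.independent_span_bound[of B B'] assms B' by blast
  moreover have "s.span B' = S"
    using B' assms(3) by (metis s.span_minimal subset_antisym)
  ultimately show ?thesis unfolding fin_dim_sub_def using B' by blast
qed

section \<open>Complete reducibility under a set of operators\<close>

locale operator_space = vector_space scale
  for scale :: "complex \<Rightarrow> 'w::ab_group_add \<Rightarrow> 'w" +
  fixes W :: "'w set" and Ops :: "('w \<Rightarrow> 'w) set"
  assumes W: "subspace W"
    and Ops_lin: "T \<in> Ops \<Longrightarrow> lin_on scale scale W T"
begin

definition invariant :: "'w set \<Rightarrow> bool"
  where "invariant S \<longleftrightarrow> subspace S \<and> S \<subseteq> W \<and> (\<forall>T\<in>Ops. \<forall>x\<in>S. T x \<in> S)"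

definition minimal :: "'w set \<Rightarrow> bool"
  where "minimal X \<longleftrightarrow> invariant X \<and> X \<noteq> {0} \<and>
    (\<forall>S. invariant S \<longrightarrow> S \<subseteq> X \<longrightarrow> S = {0} \<or> S = X)"

definition ssum :: "'w set \<Rightarrow> 'w set \<Rightarrow> 'w set"
  where "ssum A B = {x + y |x y. x \<in> A \<and> y \<in> B}"

definition complemented :: "'w set \<Rightarrow> bool"
  where "complemented N \<longleftrightarrow> (\<exists>C. invariant C \<and> N \<inter> C = {0} \<and> ssum N C = W)"

lemma invariant_0 [simp]: "invariant S \<Longrightarrow> 0 \<in> S"
  unfolding invariant_def by (auto simp: subspace_0)

lemma invariant_zero: "invariant {0}"
proof -
  have vs: "vector_space scale" by unfold_locales
  show ?thesis
    unfolding invariant_def using W lin_on_0[OF W Ops_lin vs] by (auto simp: subspace_0)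
qed

lemma invariant_Int: "invariant A \<Longrightarrow> invariant B \<Longrightarrow> invariant (A \<inter> B)"
  unfolding invariant_def by (auto simp: subspace_inter)

lemma invariant_ssum:
  assumes "invariant A" "invariant B"
  shows "invariant (ssum A B)"
proof -
  have vs: "vector_space scale" by unfold_locales
  have "subspace (ssum A B)"
    using assms unfolding ssum_def invariant_def by (intro subspace_sums) auto
  moreover have "ssum A B \<subseteq> W"
    using assms W unfolding ssum_def invariant_def by (auto intro: subspace_add)
  moreover have "T x \<in> ssum A B" if T: "T \<in> Ops" and x: "x \<in> ssum A B" for T x
  proof -
    obtain a b where ab: "x = a + b" "a \<in> A" "b \<in> B" using x unfolding ssum_def by blast
    then have "T x = T a + T b"
      using assms lin_on_add[OF W Ops_lin[OF T] vs] unfolding invariant_def by blast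
    then show ?thesis using ab assms T unfolding ssum_def invariant_def by blast
  qed
  ultimately show ?thesis unfolding invariant_def by blast
qed

lemma ssum_upper: "invariant A \<Longrightarrow> invariant B \<Longrightarrow> A \<subseteq> ssum A B \<and> B \<subseteq> ssum A B"
  unfolding ssum_def using invariant_0 by force

lemma invariant_Union_chain:
  assumes "C \<noteq> {}" "subset.chain A C" "\<And>X. X \<in> C \<Longrightarrow> invariant X"
  shows "invariant (\<Union>C)"
  using assms subspace_Union_chain[OF assms(1,2)] unfolding invariant_def by blast

lemma invariant_span:
  assumes "A \<subseteq> W" "\<And>T x. T \<in> Ops \<Longrightarrow> x \<in> A \<Longrightarrow> T x \<in> span A"
  shows "invariant (span A)"
proof -
  have vs: "vector_space scale" by unfold_locales
  have sub: "span A \<subseteq> W" using assms(1) W by (rule span_minimal)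
  have "T x \<in> span A" if T: "T \<in> Ops" and "x \<in> span A" for T x
  proof -
    have "subspace {x \<in> W. T x \<in> span A}"
      using W lin_on_0[OF W Ops_lin[OF T] vs] lin_on_add[OF W Ops_lin[OF T] vs]
        lin_on_scale[OF W Ops_lin[OF T] vs]
      unfolding subspace_def by (auto intro: span_zero span_add span_scale)
    then have "span A \<subseteq> {x \<in> W. T x \<in> span A}"
      using assms T by (intro span_minimal) auto
    then show ?thesis using that(2) by blast
  qed
  then show ?thesis using sub unfolding invariant_def by auto
qed

text \<open>Take \<open>C\<close> maximal among the invariant subspaces that meet \<open>N\<close>
  in 0. A minimal \<open>X\<close> outside \<open>ssum N C\<close> would meet it in 0, and
  \<open>ssum C X\<close> would then be a larger candidate.\<close>

lemma complemented_if_sum_of_minimals: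
  assumes gen: "span (\<Union>S) = W" and S: "\<And>X. X \<in> S \<Longrightarrow> minimal X" and N: "invariant N"
  shows "complemented N"
proof -
  let ?A = "{C. invariant C \<and> N \<inter> C = {0}}"
  have "\<exists>C\<in>?A. \<forall>X\<in>?A. C \<subseteq> X \<longrightarrow> X = C"
  proof (rule subset_Zorn_nonempty)
    show "?A \<noteq> {}" using N invariant_zero by (auto intro!: exI[of _ "{0}"])
    show "\<Union>\<C> \<in> ?A" if "\<C> \<noteq> {}" "subset.chain ?A \<C>" for \<C>
      using that invariant_Union_chain[OF that] unfolding subset.chain_def by blast
  qed
  then obtain C where CA: "C \<in> ?A" and max: "\<forall>X\<in>?A. C \<subseteq> X \<longrightarrow> X = C" ..
  then have C: "invariant C" "N \<inter> C = {0}" by auto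
  have inv: "invariant (ssum N C)" using N C by (intro invariant_ssum)
  have "X \<subseteq> ssum N C" if X: "X \<in> S" for X
  proof (rule ccontr)
    assume nsub: "\<not> X \<subseteq> ssum N C"
    have iX: "invariant X" using S[OF X] unfolding minimal_def by blast
    have 0: "X \<inter> ssum N C = {0}"
      using S[OF X] invariant_Int[OF iX inv] nsub unfolding minimal_def by blast
    have "N \<inter> ssum C X = {0}"
    proof -
      have "n = 0" if "n \<in> N" "n = c + x" "c \<in> C" "x \<in> X" for n c x
      proof -
        have "x = n + (- c)" using that by simp
        moreover have "- c \<in> C" using that C unfolding invariant_def by (simp add: subspace_neg)
        ultimately have "x \<in> ssum N C" using that unfolding ssum_def by blast
        then have "x = 0" using 0 that by blast
        then show ?thesis using that C by auto
      qed
      then show ?thesis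
        using invariant_0[OF N] invariant_0[OF invariant_ssum[OF C(1) iX]] unfolding ssum_def by blast
    qed
    then have "ssum C X = C"
      using max invariant_ssum[OF C(1) iX] ssum_upper[OF C(1) iX] by simp
    then have "X \<subseteq> C" using ssum_upper[OF C(1) iX] by blast
    then show False using nsub ssum_upper[OF N C(1)] by blast
  qed
  then have "span (\<Union>S) \<subseteq> ssum N C"
    using inv unfolding invariant_def by (intro span_minimal) auto
  then have "ssum N C = W" using gen inv unfolding invariant_def by blast
  then show ?thesis unfolding complemented_def using C by blast
qed

text \<open>Fix a nonzero \<open>p\<close> in \<open>P\<close> and let \<open>Q\<close> be maximal
  among the invariant subspaces of \<open>P\<close> avoiding \<open>p\<close>. A complement of
  \<open>Q\<close>, cut down to \<open>P\<close>, is minimal: two nonzero independent pieces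
  \<open>F\<close> and \<open>F2\<close> of it would each produce \<open>p\<close> when added to
  \<open>Q\<close>, and comparing the two expressions puts \<open>p\<close> into
  \<open>Q\<close>.\<close>

lemma minimal_exists:
  assumes comp: "\<And>N. invariant N \<Longrightarrow> complemented N" and P: "invariant P" "P \<noteq> {0}"
  shows "\<exists>X\<subseteq>P. minimal X"
proof -
  obtain p where p: "p \<in> P" "p \<noteq> 0" using P invariant_0 by blast
  let ?A = "{Q. invariant Q \<and> Q \<subseteq> P \<and> p \<notin> Q}"
  have "\<exists>C\<in>?A. \<forall>X\<in>?A. C \<subseteq> X \<longrightarrow> X = C"
  proof (rule subset_Zorn_nonempty)
    show "?A \<noteq> {}" using p P invariant_zero by (auto intro!: exI[of _ "{0}"])
    show "\<Union>\<C> \<in> ?A" if "\<C> \<noteq> {}" "subset.chain ?A \<C>" for \<C>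
      using that invariant_Union_chain[OF that] unfolding subset.chain_def by blast
  qed
  then obtain Q where QA: "Q \<in> ?A" and max0: "\<forall>X\<in>?A. Q \<subseteq> X \<longrightarrow> X = Q" ..
  then have Q: "invariant Q" "Q \<subseteq> P" "p \<notin> Q" by auto
  have max: "p \<in> X" if "invariant X" "X \<subseteq> P" "Q \<subseteq> X" "X \<noteq> Q" for X
    using max0 that by auto
  obtain D where D: "invariant D" "Q \<inter> D = {0}" "ssum Q D = W"
    using comp[OF Q(1)] unfolding complemented_def by blast
  define E where "E = D \<inter> P"
  have E: "invariant E" unfolding E_def using D P by (intro invariant_Int)
  have "E \<noteq> {0}"
  proof
    assume 0: "E = {0}"
    have "p \<in> ssum Q D" using p P D unfolding invariant_def by blast
    then obtain q d where qd: "p = q + d" "q \<in> Q" "d \<in> D" unfolding ssum_def by blast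
    then have "d = p - q" by simp
    then have "d \<in> P" using qd Q p P(1) unfolding invariant_def by (metis subspace_diff subsetD)
    then have "d \<in> E" using qd unfolding E_def by blast
    then show False using 0 qd Q(3) by auto
  qed
  have "F = {0} \<or> F = E" if F: "invariant F" "F \<subseteq> E" for F
  proof (rule ccontr)
    assume "\<not> (F = {0} \<or> F = E)"
    then have nF: "F \<noteq> {0}" "F \<noteq> E" by auto
    obtain F' where F': "invariant F'" "F \<inter> F' = {0}" "ssum F F' = W"
      using comp[OF F(1)] unfolding complemented_def by blast
    define F2 where "F2 = F' \<inter> E"
    have F2: "invariant F2" unfolding F2_def using F' E by (intro invariant_Int)
    have "F2 \<noteq> {0}"
    proof
      assume 0: "F2 = {0}"
      have "e \<in> F" if e: "e \<in> E" for e
      proof -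
        have "e \<in> ssum F F'" using e E F' unfolding invariant_def by blast
        then obtain f f' where ff: "e = f + f'" "f \<in> F" "f' \<in> F'" unfolding ssum_def by blast
        then have "f' = e - f" by simp
        then have "f' \<in> E" using e ff F E unfolding invariant_def by (metis subspace_diff subsetD)
        then have "f' \<in> F2" using ff unfolding F2_def by blast
        then show ?thesis using ff 0 by simp
      qed
      then show False using nF F by blast
    qed
    have big: "p \<in> ssum Q Y" if Y: "invariant Y" "Y \<subseteq> E" "Y \<noteq> {0}" for Y
    proof (rule max)
      show "invariant (ssum Q Y)" "Q \<subseteq> ssum Q Y"
        using invariant_ssum[OF Q(1) Y(1)] ssum_upper[OF Q(1) Y(1)] by auto
      show "ssum Q Y \<subseteq> P"
        using Q Y P(1) unfolding ssum_def E_def invariant_def by (auto intro: subspace_add)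
      obtain y where "y \<in> Y" "y \<noteq> 0" using Y invariant_0[OF Y(1)] by blast
      moreover have "y \<in> ssum Q Y" using \<open>y \<in> Y\<close> ssum_upper[OF Q(1) Y(1)] by blast
      ultimately show "ssum Q Y \<noteq> Q" using D Y unfolding E_def by blast
    qed
    obtain q1 f1 where 1: "p = q1 + f1" "q1 \<in> Q" "f1 \<in> F"
      using big[OF F nF(1)] unfolding ssum_def by blast
    obtain q2 f2 where 2: "p = q2 + f2" "q2 \<in> Q" "f2 \<in> F2"
      using big[OF F2 _ \<open>F2 \<noteq> {0}\<close>] unfolding ssum_def F2_def by blast
    have eq: "q1 - q2 = f2 - f1" using 1(1) 2(1) by (simp add: algebra_simps)
    have "q1 - q2 \<in> Q" using 1 2 Q unfolding invariant_def by (auto intro: subspace_diff)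
    moreover have "f2 - f1 \<in> D"
      using 1 2 F D unfolding F2_def E_def invariant_def by (auto intro!: subspace_diff)
    ultimately have "f2 - f1 \<in> Q \<inter> D" using eq by simp
    then have "f2 = f1" using D(2) by simp
    then have "f1 \<in> F \<inter> F'" using 1 2 unfolding F2_def by blast
    then have "f1 = 0" using F'(2) by simp
    then show False using 1 Q by auto
  qed
  then have "minimal E" unfolding minimal_def using E \<open>E \<noteq> {0}\<close> by blast
  then show ?thesis unfolding E_def by blast
qed

text \<open>A maximal independent family of minimal subspaces spans: otherwise a complement of its
  span contains a further minimal subspace, which could be adjoined. \<open>indep\<close> is the
  intersection clause of \<open>internal_dsum\<close> for a family indexed by itself.\<close>

lemma direct_sum_of_minimals:
  assumes comp: "\<And>N. invariant N \<Longrightarrow> complemented N"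
  shows "\<exists>S. internal_dsum scale W id S \<and> (\<forall>X\<in>S. minimal X)"
proof -
  define indep where "indep S \<longleftrightarrow> (\<forall>X\<in>S. X \<inter> span (\<Union>(S - {X})) = {0})" for S :: "'w set set"
  let ?A = "{S. (\<forall>X\<in>S. minimal X) \<and> indep S}"
  have "\<exists>C\<in>?A. \<forall>X\<in>?A. C \<subseteq> X \<longrightarrow> X = C"
  proof (rule subset_Zorn_nonempty)
    show "?A \<noteq> {}" by (auto simp: indep_def intro!: exI[of _ "{}"])
    fix \<C> assume ne: "\<C> \<noteq> {}" and ch: "subset.chain ?A \<C>"
    have mem: "S \<in> \<C> \<Longrightarrow> (\<forall>X\<in>S. minimal X) \<and> indep S" for S
      using ch unfolding subset.chain_def by auto
    have "x = 0" if X: "X \<in> \<Union>\<C>" "x \<in> X" and x: "x \<in> span (\<Union>(\<Union>\<C> - {X}))" for X x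
    proof -
      \<comment> \<open>A linear dependence involves finitely many members of the union, hence
        already occurs inside one family of the chain.\<close>
      obtain F r where F: "finite F" "F \<subseteq> \<Union>(\<Union>\<C> - {X})" "x = (\<Sum>a\<in>F. scale (r a) a)"
        using x unfolding span_explicit by blast
      have "\<forall>a\<in>F. \<exists>Y. Y \<in> \<Union>\<C> - {X} \<and> a \<in> Y" using F(2) by blast
      then obtain c where c: "\<And>a. a \<in> F \<Longrightarrow> c a \<in> \<Union>\<C> - {X} \<and> a \<in> c a"
        by (subst (asm) bchoice_iff) blast
      have "finite (insert X (c ` F))" "insert X (c ` F) \<subseteq> \<Union>\<C>" using F c X by auto
      then obtain S where S: "S \<in> \<C>" "insert X (c ` F) \<subseteq> S"
        using finite_subset_chain_member[OF _ _ ne ch] by blast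
      have "F \<subseteq> \<Union>(S - {X})" using c S by blast
      then have "x \<in> span (\<Union>(S - {X}))"
        unfolding F(3) by (intro span_sum span_scale span_base) auto
      then show ?thesis using mem[OF S(1)] S(2) X(2) unfolding indep_def by blast
    qed
    then have "indep (\<Union>\<C>)"
      using mem unfolding indep_def minimal_def by (auto simp: span_zero)
    then show "\<Union>\<C> \<in> ?A" using mem by auto
  qed
  then obtain S where SA: "S \<in> ?A" and max: "\<forall>X\<in>?A. S \<subseteq> X \<longrightarrow> X = S" ..
  then have S: "\<forall>X\<in>S. minimal X" "indep S" by auto
  have sub: "\<forall>X\<in>S. subspace X \<and> X \<subseteq> W" using S unfolding minimal_def invariant_def by blast
  have inv: "invariant (span (\<Union>S))"
  proof (rule invariant_span)
    show "T x \<in> span (\<Union>S)" if "T \<in> Ops" "x \<in> \<Union>S" for T x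
      using that S unfolding minimal_def invariant_def by (meson UnionE UnionI span_base)
  qed (use sub in blast)
  have "span (\<Union>S) = W"
  proof (rule ccontr)
    assume neq: "span (\<Union>S) \<noteq> W"
    obtain D where D: "invariant D" "span (\<Union>S) \<inter> D = {0}" "ssum (span (\<Union>S)) D = W"
      using comp[OF inv] unfolding complemented_def by blast
    have "D \<noteq> {0}"
      using D(3) neq unfolding ssum_def by auto
    then obtain X0 where X0: "X0 \<subseteq> D" "minimal X0"
      using minimal_exists[OF comp D(1)] by blast
    have X0s: "subspace X0" "X0 \<noteq> {0}" using X0 unfolding minimal_def invariant_def by blast+
    have "indep (insert X0 S)"
      unfolding indep_def
    proof
      fix X assume X: "X \<in> insert X0 S"
      have "x = 0" if x: "x \<in> X" "x \<in> span (\<Union>(insert X0 S - {X}))" for x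
      proof (cases "X = X0")
        case True
        then have "x \<in> span (\<Union>S)" using x span_mono[of "\<Union>(insert X0 S - {X})" "\<Union>S"] by blast
        then show ?thesis using D X0 x True by blast
      next
        case False
        then have XS: "X \<in> S" using X by blast
        have "x \<in> span (X0 \<union> \<Union>(S - {X}))"
          using x(2) by (rule rev_subsetD) (intro span_mono, blast)
        then obtain a b where ab: "x = a + b" "a \<in> X0" "b \<in> span (\<Union>(S - {X}))"
          unfolding span_Un using X0s(1) by (auto simp flip: span_eq_iff)
        have "b \<in> span (\<Union>S)" using ab(3) span_mono[of "\<Union>(S - {X})" "\<Union>S"] by blast
        moreover have "x \<in> span (\<Union>S)" using x XS by (auto intro: span_base)
        moreover have "a = x - b" using ab by simp
        ultimately have "a \<in> span (\<Union>S)" by (auto intro: span_diff)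
        then have "a = 0" using ab D X0 by blast
        then show ?thesis using ab S(2) XS x unfolding indep_def by auto
      qed
      moreover have "0 \<in> X" using X X0s sub by (auto simp: subspace_0)
      ultimately show "X \<inter> span (\<Union>(insert X0 S - {X})) = {0}" by (auto simp: span_zero)
    qed
    then have "X0 \<in> S" using max[rule_format, of "insert X0 S"] S X0 by auto
    then have "X0 \<subseteq> span (\<Union>S)" by (auto intro: span_base)
    then show False using D X0 X0s invariant_0 subspace_0 by blast
  qed
  then have "internal_dsum scale W id S"
    unfolding internal_dsum_def using sub S(2) unfolding indep_def by simp
  then show ?thesis using S by blast
qed

end

section \<open>Component identities in weak modules\<close>

text \<open>Truncation makes modes vanish for large indices, so statements about modes are proved
  from large indices downwards.\<close>

lemma int_descent:
  fixes P :: "int \<Rightarrow> bool"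
  assumes "\<And>n. n \<ge> n0 \<Longrightarrow> P n" "\<And>n. (\<And>n'. n' > n \<Longrightarrow> P n') \<Longrightarrow> P n"
  shows "P n"
proof (induction "nat (n0 - n)" arbitrary: n rule: less_induct)
  case less
  show ?case
  proof (cases "n \<ge> n0")
    case False
    show ?thesis
    proof (rule assms(2))
      fix n' assume "n' > n"
      then show "P n'" using False less[of n'] by auto
    qed
  qed (rule assms(1))
qed

text \<open>Meant for \<open>a m n\<close> a product of modes \<open>u_m v_n\<close> on a vector.
  The relations shift \<open>(m, n)\<close> to \<open>(m - i, n + i)\<close>, so the inner mode
  grows until truncation applies. Since \<open>m\<close> moves too, all \<open>m\<close> are treated
  at once.\<close>

lemma (in vector_space) descent_mem:
  fixes a :: "int \<Rightarrow> int \<Rightarrow> 'b"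
  assumes J: "subspace J" and big: "\<And>m n. n \<ge> n0 \<Longrightarrow> a m n \<in> J"
    and step: "\<And>m n. \<exists>K c. (\<Sum>i\<le>K. scale (c i) (a (m - int i) (n + int i))) \<in> J \<and> c 0 = 1"
  shows "a m n \<in> J"
proof -
  have "\<forall>m. a m n \<in> J"
  proof (induction rule: int_descent[of n0])
    case (2 n)
    show ?case
    proof
      fix m
      obtain K c where K: "(\<Sum>i\<le>K. scale (c i) (a (m - int i) (n + int i))) \<in> J" "c 0 = 1"
        using step by blast
      have "(\<Sum>i\<le>K. scale (c i) (a (m - int i) (n + int i)))
          = a m n + (\<Sum>i\<in>{..K} - {0}. scale (c i) (a (m - int i) (n + int i)))"
        using K(2) by (subst sum.remove[of _ 0]) auto
      moreover have "(\<Sum>i\<in>{..K} - {0}. scale (c i) (a (m - int i) (n + int i))) \<in> J"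
        using J 2 by (intro subspace_sum subspace_scale) auto
      ultimately show "a m n \<in> J"
        using subspace_diff[OF J K(1), of "\<Sum>i\<in>{..K} - {0}. scale (c i) (a (m - int i) (n + int i))"] by simp
    qed
  qed (use big in auto)
  then show ?thesis by blast
qed

lemma gchoose_nat_eq_0: "i > N \<Longrightarrow> (of_nat N :: complex) gchoose i = 0"
  by (metis binomial_eq_0 binomial_gbinomial of_nat_0)

lemma Sum_any_lessThan:
  fixes f :: "nat \<Rightarrow> 'a::comm_monoid_add"
  assumes "\<And>i. i \<ge> K \<Longrightarrow> f i = 0"
  shows "Sum_any f = sum f {..<K}"
proof (rule Sum_any.expand_superset)
  show "{i. f i \<noteq> 0} \<subseteq> {..<K}" using assms not_le by blast
qed simp

locale weak_voa_module =
  fixes V :: "'v::ab_group_add voa" and M :: "('v, 'w::ab_group_add) vmod"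
  assumes voa: "voa V" and weak: "weak_module V M"
begin

abbreviation "A \<equiv> vcarrier V"
abbreviation "W \<equiv> mcarrier M"
abbreviation "Y \<equiv> mmode M"

lemma weak_adjoint: "weak_module V (adjoint V)"
  using voa unfolding voa_def Let_def by blast

lemma vac_in [simp]: "vac V \<in> A" and omg_in [simp]: "omg V \<in> A"
  using voa unfolding voa_def Let_def by auto

end

sublocale weak_voa_module \<subseteq> VV: vector_space "vscale V"
  using weak_adjoint unfolding weak_module_def Let_def adjoint_def by simp

sublocale weak_voa_module \<subseteq> MM: vector_space "mscale M"
  using weak unfolding weak_module_def Let_def by simp

context weak_voa_module
begin

lemma A_subspace: "VV.subspace A"
  using weak_adjoint unfolding weak_module_def Let_def adjoint_def by simp

lemma W_subspace: "MM.subspace W"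
  using weak unfolding weak_module_def Let_def by simp

lemma A_closed [simp]: "u \<in> A \<Longrightarrow> v \<in> A \<Longrightarrow> vmode V u n v \<in> A"
  using weak_adjoint unfolding weak_module_def Let_def adjoint_def by simp

lemma W_closed [simp]: "u \<in> A \<Longrightarrow> w \<in> W \<Longrightarrow> Y u n w \<in> W"
  using weak unfolding weak_module_def Let_def by simp

lemma Y_lin_right: "u \<in> A \<Longrightarrow> lin_on (mscale M) (mscale M) W (Y u n)"
  using weak unfolding weak_module_def Let_def by simp

lemma Y_lin_left: "w \<in> W \<Longrightarrow> lin_on (vscale V) (mscale M) A (\<lambda>u. Y u n w)"
  using weak unfolding weak_module_def Let_def by simp

lemmas Y_right_0 = MM.lin_on_0[OF W_subspace Y_lin_right MM.vector_space_axioms]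
  and Y_right_add = MM.lin_on_add[OF W_subspace Y_lin_right MM.vector_space_axioms]
  and Y_right_scale = MM.lin_on_scale[OF W_subspace Y_lin_right MM.vector_space_axioms]
  and Y_right_sum = MM.lin_on_sum[OF W_subspace Y_lin_right MM.vector_space_axioms]
  and Y_left_0 = VV.lin_on_0[OF A_subspace Y_lin_left MM.vector_space_axioms]
  and Y_left_add = VV.lin_on_add[OF A_subspace Y_lin_left MM.vector_space_axioms]
  and Y_left_scale = VV.lin_on_scale[OF A_subspace Y_lin_left MM.vector_space_axioms]
  and Y_left_diff = VV.lin_on_diff[OF A_subspace Y_lin_left MM.vector_space_axioms]
  and Y_left_sum = VV.lin_on_sum[OF A_subspace Y_lin_left MM.vector_space_axioms]

lemma Y_trunc: "u \<in> A \<Longrightarrow> w \<in> W \<Longrightarrow> \<exists>N. \<forall>n\<ge>N. Y u n w = 0"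
  using weak unfolding weak_module_def Let_def by blast

lemma V_trunc: "u \<in> A \<Longrightarrow> v \<in> A \<Longrightarrow> \<exists>N. \<forall>n\<ge>N. vmode V u n v = 0"
  using weak_adjoint unfolding weak_module_def Let_def adjoint_def by simp

lemma Y_trunc_nat:
  assumes "u \<in> A" "w \<in> W"
  shows "\<exists>K. \<forall>i\<ge>K. Y u (n + int i) w = 0"
proof -
  obtain N where "\<forall>n\<ge>N. Y u n w = 0" using Y_trunc[OF assms] by blast
  then show ?thesis by (intro exI[of _ "nat (N - n)"]) auto
qed

lemma V_trunc_nat:
  assumes "u \<in> A" "v \<in> A"
  shows "\<exists>K. \<forall>i\<ge>K. vmode V u (n + int i) v = 0"
proof -
  obtain N where "\<forall>n\<ge>N. vmode V u n v = 0" using V_trunc[OF assms] by blast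
  then show ?thesis by (intro exI[of _ "nat (N - n)"]) auto
qed

lemma Y_vac: "w \<in> W \<Longrightarrow> Y (vac V) n w = (if n = -1 then w else 0)"
  using weak unfolding weak_module_def Let_def by blast

lemma borcherds:
  assumes "u \<in> A" "v \<in> A" "w \<in> W"
    and Kl: "\<And>i. i \<ge> Kl \<Longrightarrow> vmode V u (l + int i) v = 0"
    and Kr: "\<And>i. i \<ge> Kr \<Longrightarrow> Y v (n + int i) w = 0" "\<And>i. i \<ge> Kr \<Longrightarrow> Y u (m + int i) w = 0"
  shows "(\<Sum>i<Kl. mscale M ((of_int m :: complex) gchoose i) (Y (vmode V u (l + int i) v) (m + n - int i) w))
    = (\<Sum>i<Kr. mscale M ((-1) ^ i * ((of_int l :: complex) gchoose i))
        (Y u (l + m - int i) (Y v (n + int i) w)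
          - mscale M ((-1) powi l) (Y v (l + n - int i) (Y u (m + int i) w))))"
    (is "sum ?f _ = sum ?g _")
proof -
  have "Sum_any ?f = Sum_any ?g"
    using weak assms(1-3) unfolding weak_module_def Let_def by blast
  moreover have "Sum_any ?f = sum ?f {..<Kl}"
    using Kl by (intro Sum_any_lessThan) (simp add: Y_left_0 assms(1-3))
  moreover have "Sum_any ?g = sum ?g {..<Kr}"
    using Kr by (intro Sum_any_lessThan) (simp add: Y_right_0 assms(1-3))
  ultimately show ?thesis by simp
qed

text \<open>Borcherds with \<open>m = l\<close> so large that \<open>u\<close> already annihilates
  \<open>w\<close>: the terms in which \<open>u\<close> acts first drop out, and products of modes
  turn into modes of products.\<close>

lemma weak_associativity:
  assumes "u \<in> A" "v \<in> A" "w \<in> W"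
    and l: "\<And>i. Y u (l + int i) w = 0"
    and Kl: "\<And>i. i \<ge> Kl \<Longrightarrow> vmode V u (k + int i) v = 0"
    and Kr: "\<And>i. i \<ge> Kr \<Longrightarrow> Y v (n + int i) w = 0"
  shows "(\<Sum>i<Kl. mscale M ((of_int l :: complex) gchoose i) (Y (vmode V u (k + int i) v) (l + n - int i) w))
    = (\<Sum>i<Kr. mscale M ((-1) ^ i * ((of_int k :: complex) gchoose i)) (Y u (k + l - int i) (Y v (n + int i) w)))"
  using borcherds[OF assms(1-3) Kl Kr, where m = l] l by (simp add: Y_right_0 assms)

text \<open>The case \<open>m = 0\<close> of the Borcherds identity, whose left side keeps only its
  term \<open>i = 0\<close>.\<close>

lemma iterate:
  assumes "u \<in> A" "v \<in> A" "w \<in> W"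
    and K: "\<And>i. i \<ge> K \<Longrightarrow> Y v (n + int i) w = 0" "\<And>i. i \<ge> K \<Longrightarrow> Y u (int i) w = 0"
  shows "Y (vmode V u p v) n w = (\<Sum>i<K. mscale M ((-1) ^ i * ((of_int p :: complex) gchoose i))
        (Y u (p - int i) (Y v (n + int i) w)
          - mscale M ((-1) powi p) (Y v (p + n - int i) (Y u (int i) w))))"
proof -
  obtain Kl where Kl: "\<forall>i\<ge>Kl. vmode V u (p + int i) v = 0" using V_trunc_nat assms by blast
  have "(\<Sum>i<Suc Kl. mscale M ((of_int 0 :: complex) gchoose i) (Y (vmode V u (p + int i) v) (0 + n - int i) w))
     = Y (vmode V u p v) n w"
    by (subst sum.lessThan_Suc_shift) (simp add: gbinomial_0)
  then show ?thesis
    using borcherds[OF assms(1-3), of "Suc Kl" p K n 0] K Kl by simp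
qed

text \<open>The case \<open>l = 0\<close>, whose right side keeps only its term
  \<open>i = 0\<close>.\<close>

lemma commutator:
  assumes "u \<in> A" "v \<in> A" "w \<in> W"
    and K: "\<And>i. i \<ge> K \<Longrightarrow> vmode V u (int i) v = 0"
  shows "Y u m (Y v n w) - Y v n (Y u m w)
    = (\<Sum>i<K. mscale M ((of_int m :: complex) gchoose i) (Y (vmode V u (int i) v) (m + n - int i) w))"
proof -
  obtain K1 K2 where K12: "\<forall>i\<ge>K1. Y v (n + int i) w = 0" "\<forall>i\<ge>K2. Y u (m + int i) w = 0"
    using Y_trunc_nat assms(1-3) by metis
  let ?K = "Suc (max K1 K2)"
  have "(\<Sum>i<K. mscale M ((of_int m :: complex) gchoose i) (Y (vmode V u (0 + int i) v) (m + n - int i) w))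
    = (\<Sum>i<?K. mscale M ((-1) ^ i * ((of_int 0 :: complex) gchoose i))
        (Y u (0 + m - int i) (Y v (n + int i) w)
          - mscale M ((-1) powi 0) (Y v (0 + n - int i) (Y u (m + int i) w))))"
    using K12 K by (intro borcherds assms) auto
  also have "\<dots> = Y u m (Y v n w) - Y v n (Y u m w)"
    by (subst sum.lessThan_Suc_shift) (simp add: gbinomial_0)
  finally show ?thesis by simp
qed

text \<open>The case \<open>l = N\<close>, from where on all modes of \<open>u\<close> annihilate
  \<open>v\<close>: the left side is empty, and the binomial coefficients of \<open>N\<close> cut
  the right side at \<open>N\<close>.\<close>

lemma locality:
  assumes "u \<in> A" "v \<in> A" "w \<in> W"
    and N: "\<And>i. i \<ge> N \<Longrightarrow> vmode V u (int i) v = 0"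
  shows "(\<Sum>i\<le>N. mscale M ((-1) ^ i * ((of_int (int N) :: complex) gchoose i))
            (Y u (int N + m - int i) (Y v (n + int i) w)))
    = (\<Sum>i\<le>N. mscale M ((-1) ^ i * ((of_int (int N) :: complex) gchoose i) * (-1) ^ N)
            (Y v (int N + n - int i) (Y u (m + int i) w)))"
proof -
  obtain K1 K2 where K12: "\<forall>i\<ge>K1. Y v (n + int i) w = 0" "\<forall>i\<ge>K2. Y u (m + int i) w = 0"
    using Y_trunc_nat assms(1-3) by metis
  let ?K = "Suc (max N (max K1 K2))"
  let ?f = "\<lambda>i. mscale M ((-1) ^ i * ((of_int (int N) :: complex) gchoose i))
        (Y u (int N + m - int i) (Y v (n + int i) w)
          - mscale M ((-1) powi int N) (Y v (int N + n - int i) (Y u (m + int i) w)))"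
  have "(\<Sum>i<0. mscale M ((of_int m :: complex) gchoose i) (Y (vmode V u (int N + int i) v) (m + n - int i) w))
    = sum ?f {..<?K}"
  proof (rule borcherds[OF assms(1-3)])
    show "vmode V u (int N + int i) v = 0" for i
      using N[of "N + i"] by simp
  qed (use K12 in auto)
  also have "\<dots> = sum ?f {..N}"
    by (intro sum.mono_neutral_right) (auto simp: gchoose_nat_eq_0)
  finally have "sum ?f {..N} = 0" by simp
  then show ?thesis
    by (simp add: MM.scale_right_diff_distrib sum_subtractf)
qed

lemma V_submodule_iff:
  "submodule V M S \<longleftrightarrow> MM.subspace S \<and> S \<subseteq> W \<and> (\<forall>u\<in>A. \<forall>n. \<forall>w\<in>S. Y u n w \<in> S)"
  unfolding submodule_def ..

text \<open>Locality equates a combination of the \<open>u_(m-i) v_(n+i) w\<close>, with leading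
  coefficient 1, to a combination of vectors \<open>v_p (u_q w)\<close>, which are in
  \<open>J\<close> by assumption; so \<open>descent_mem\<close> applies.\<close>

lemma commute_mem:
  assumes "u \<in> A" "v \<in> A" "w \<in> W" and J: "MM.subspace J" and vu: "\<And>m n. Y v m (Y u n w) \<in> J"
  shows "Y u m (Y v n w) \<in> J"
proof -
  obtain n0 where n0: "\<forall>n\<ge>n0. Y v n w = 0" using Y_trunc assms by blast
  obtain N where N: "\<forall>i\<ge>N. vmode V u (0 + int i) v = 0" using V_trunc_nat assms by blast
  show ?thesis
  proof (rule MM.descent_mem[OF J, of n0 "\<lambda>m n. Y u m (Y v n w)"])
    show "Y u m (Y v n w) \<in> J" if "n \<ge> n0" for m n
      using n0 that assms J by (simp add: Y_right_0 MM.subspace_0)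
    fix m n
    let ?c = "\<lambda>i. (-1) ^ i * ((of_int (int N) :: complex) gchoose i)"
    have "(\<Sum>i\<le>N. mscale M (?c i) (Y u (int N + (m - int N) - int i) (Y v (n + int i) w))) \<in> J"
      using N J vu by (subst locality) (auto intro!: assms MM.subspace_sum MM.subspace_scale)
    then show "\<exists>K c. (\<Sum>i\<le>K. mscale M (c i) (Y u (m - int i) (Y v (n + int i) w))) \<in> J \<and> c 0 = 1"
      by (intro exI[of _ N] exI[of _ ?c]) simp
  qed
qed

text \<open>The vectors all of whose modes send \<open>w\<close> into \<open>J\<close> form an ideal of \<open>V\<close>.\<close>
lemma mem_if_modes_mem:
  assumes "simple V" and J: "submodule V M J" and a: "a \<in> A" "a \<noteq> 0" and w: "w \<in> W"
    and mem: "\<And>n. Y a n w \<in> J"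
  shows "w \<in> J"
proof -
  have Js: "MM.subspace J" and Jc: "\<And>u n x. u \<in> A \<Longrightarrow> x \<in> J \<Longrightarrow> Y u n x \<in> J"
    using J unfolding submodule_def by auto
  define I where "I = {a \<in> A. \<forall>n. Y a n w \<in> J}"
  have "submodule V (adjoint V) I"
    unfolding submodule_def adjoint_def vmod.simps
  proof (intro conjI ballI allI)
    show "VV.subspace I"
      unfolding VV.subspace_def I_def using Js w A_subspace
      by (auto simp: Y_left_0 Y_left_add Y_left_scale VV.subspace_0 VV.subspace_add VV.subspace_scale
          MM.subspace_0 MM.subspace_add MM.subspace_scale)
    show "I \<subseteq> A" unfolding I_def by blast
    fix b p c assume b: "b \<in> A" and c: "c \<in> I"
    have cA: "c \<in> A" and cJ: "\<And>n. Y c n w \<in> J" using c unfolding I_def by auto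
    have "Y (vmode V b p c) n w \<in> J" for n
    proof -
      obtain K1 K2 where K: "\<forall>i\<ge>K1. Y c (n + int i) w = 0" "\<forall>i\<ge>K2. Y b (0 + int i) w = 0"
        using Y_trunc_nat b cA w by metis
      have swap: "Y c q (Y b i w) \<in> J" for q i
        using commute_mem[OF cA b w Js] Jc[OF b cJ] by blast
      show ?thesis
        by (subst iterate[where K = "max K1 K2"])
          (use K b cA w Js cJ Jc swap in \<open>auto intro!: MM.subspace_sum MM.subspace_scale MM.subspace_diff\<close>)
    qed
    then show "vmode V b p c \<in> I" using b cA unfolding I_def by simp
  qed
  moreover have "I \<noteq> {0}" using a mem unfolding I_def by blast
  ultimately have "I = A"
    using assms(1) unfolding simple_def irreducible_def by (auto simp: adjoint_def)
  then have "Y (vac V) (-1) w \<in> J" using vac_in unfolding I_def by blast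
  then show ?thesis using w by (simp add: Y_vac)
qed

end

section \<open>Galois descent along the fixed-point subalgebra\<close>

lemma sum_fun_apply: "(\<Sum>i\<in>I. f i) x = (\<Sum>i\<in>I. f i x)"
  by (induction I rule: infinite_finite_induct) auto

locale voa_group_module = weak_voa_module V M
  for V :: "'v::ab_group_add voa" and M :: "('v, 'w::ab_group_add) vmod" +
  fixes G :: "('v \<Rightarrow> 'v) set"
  assumes simple: "simple V" and grp: "finite_aut_group V G"
begin

abbreviation "U \<equiv> fixed_sub V G"

lemma finite_G [simp]: "finite G" and id_G [simp]: "id \<in> G"
  and comp_G: "g \<in> G \<Longrightarrow> h \<in> G \<Longrightarrow> g \<circ> h \<in> G"
  using grp unfolding finite_aut_group_def id_def by auto

lemma aut: "g \<in> G \<Longrightarrow> voa_aut V g"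
  using grp unfolding finite_aut_group_def by blast

lemma aut_in [simp]: "g \<in> G \<Longrightarrow> u \<in> A \<Longrightarrow> g u \<in> A"
  using aut unfolding voa_aut_def bij_betw_def by blast

lemma aut_lin: "g \<in> G \<Longrightarrow> lin_on (vscale V) (vscale V) A g"
  using aut unfolding voa_aut_def by blast

lemma aut_mode: "g \<in> G \<Longrightarrow> u \<in> A \<Longrightarrow> v \<in> A \<Longrightarrow> g (vmode V u n v) = vmode V (g u) n (g v)"
  using aut unfolding voa_aut_def by blast

lemma aut_vac [simp]: "g \<in> G \<Longrightarrow> g (vac V) = vac V" and aut_omg [simp]: "g \<in> G \<Longrightarrow> g (omg V) = omg V"
  using aut unfolding voa_aut_def by blast+

lemmas aut_0 = VV.lin_on_0[OF A_subspace aut_lin VV.vector_space_axioms]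
  and aut_scale = VV.lin_on_scale[OF A_subspace aut_lin VV.vector_space_axioms]
  and aut_sum = VV.lin_on_sum[OF A_subspace aut_lin VV.vector_space_axioms]

lemma aut_inverse:
  assumes "g \<in> G"
  obtains h where "h \<in> G" "\<And>x. h (g x) = x" "\<And>x. g (h x) = x"
proof -
  obtain h where h: "h \<in> G" "h \<circ> g = id" using grp assms unfolding finite_aut_group_def by blast
  obtain k where k: "k \<in> G" "k \<circ> h = id" using grp h(1) unfolding finite_aut_group_def by blast
  have "k = g" using h k by (metis comp_assoc comp_id id_comp)
  then show thesis using that[of h] h k by (metis comp_apply id_apply)
qed

text \<open>If all differences vanished, \<open>g\<close> and \<open>h\<close> would agree on
  \<open>A\<close>. Off \<open>A\<close> every automorphism is the identity by
  \<open>voa_aut\<close>, so they would be equal as functions.\<close>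

lemma aut_separate:
  assumes "g \<in> G" "h \<in> G" "g \<noteq> h" and h': "\<And>x. h' (h x) = x"
  shows "\<exists>b\<in>A. b - g (h' b) \<noteq> 0"
proof (rule ccontr)
  assume *: "\<not> ?thesis"
  have "g u = h u" for u
  proof (cases "u \<in> A")
    case True
    then have "h u \<in> A" using assms by simp
    then show ?thesis using * h' by (metis right_minus_eq)
  next
    case False
    then show ?thesis using aut[OF assms(1)] aut[OF assms(2)] unfolding voa_aut_def by simp
  qed
  then show False using assms(3) by blast
qed

lemma U_carrier: "vcarrier U = {v \<in> A. \<forall>g\<in>G. g v = v}"
  unfolding fixed_sub_def by simp

lemma U_subset: "u \<in> vcarrier U \<Longrightarrow> u \<in> A"
  unfolding U_carrier by blast

lemma orbit_sum_fixed:
  assumes "a \<in> A"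
  shows "(\<Sum>g\<in>G. g a) \<in> vcarrier U"
proof -
  have "h (\<Sum>g\<in>G. g a) = (\<Sum>g\<in>G. g a)" if h: "h \<in> G" for h
  proof -
    obtain k where k: "k \<in> G" "\<And>x. k (h x) = x" "\<And>x. h (k x) = x" using aut_inverse[OF h] by blast
    have "h (\<Sum>g\<in>G. g a) = (\<Sum>g\<in>G. (h \<circ> g) a)"
      using assms by (simp add: aut_sum[OF h])
    also have "\<dots> = (\<Sum>g\<in>G. g a)"
      by (rule sum.reindex_bij_witness[of _ "\<lambda>g. k \<circ> g" "\<lambda>g. h \<circ> g"])
        (use h k in \<open>auto simp: comp_G fun_eq_iff\<close>)
    finally show ?thesis .
  qed
  then show ?thesis
    unfolding U_carrier using assms A_subspace by (auto intro: VV.subspace_sum)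
qed

lemma submodule_U:
  "submodule U M S \<longleftrightarrow> MM.subspace S \<and> S \<subseteq> W \<and> (\<forall>u\<in>vcarrier U. \<forall>n. \<forall>w\<in>S. Y u n w \<in> S)"
  unfolding submodule_def ..

end

section \<open>Tuples of module vectors indexed by the group\<close>

sublocale voa_group_module \<subseteq> FF: vector_space "\<lambda>c (k::('v \<Rightarrow> 'v) \<Rightarrow> 'w) g. mscale M c (k g)"
  by unfold_locales
    (auto simp: fun_eq_iff MM.scale_right_distrib MM.scale_left_distrib)

context voa_group_module
begin

definition tup :: "(('v \<Rightarrow> 'v) \<Rightarrow> 'w) \<Rightarrow> ('v \<Rightarrow> 'v) \<Rightarrow> 'w"
  where "tup f = (\<lambda>g. if g \<in> G then f g else 0)"

definition Full :: "(('v \<Rightarrow> 'v) \<Rightarrow> 'w) set"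
  where "Full = {k. (\<forall>g\<in>G. k g \<in> W) \<and> (\<forall>g. g \<notin> G \<longrightarrow> k g = 0)}"

definition single :: "('v \<Rightarrow> 'v) \<Rightarrow> 'w \<Rightarrow> ('v \<Rightarrow> 'v) \<Rightarrow> 'w"
  where "single h x = (\<lambda>g. if g = h then x else 0)"

text \<open>The two actions of \<open>V\<close> on tuples: on the component at \<open>g\<close>, either through \<open>g\<close> or directly.\<close>

definition twisted_closed :: "(('v \<Rightarrow> 'v) \<Rightarrow> 'w) set \<Rightarrow> bool"
  where "twisted_closed K \<longleftrightarrow> (\<forall>k\<in>K. \<forall>b\<in>A. \<forall>n. tup (\<lambda>g. Y (g b) n (k g)) \<in> K)"

definition untwisted_closed :: "(('v \<Rightarrow> 'v) \<Rightarrow> 'w) set \<Rightarrow> bool"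
  where "untwisted_closed K \<longleftrightarrow> (\<forall>k\<in>K. \<forall>b\<in>A. \<forall>n. tup (\<lambda>g. Y b n (k g)) \<in> K)"

lemma tup_in [simp]: "g \<in> G \<Longrightarrow> tup f g = f g" and tup_notin [simp]: "g \<notin> G \<Longrightarrow> tup f g = 0"
  unfolding tup_def by auto

lemma tup_eq_iff: "tup f = tup f' \<longleftrightarrow> (\<forall>g\<in>G. f g = f' g)"
  unfolding tup_def fun_eq_iff by auto

lemma tup_sum: "(\<Sum>i\<in>I. tup (f i)) = tup (\<lambda>g. \<Sum>i\<in>I. f i g)"
  by (auto simp: fun_eq_iff sum_fun_apply tup_def)

lemma tup_scale: "(\<lambda>g. mscale M c (tup f g)) = tup (\<lambda>g. mscale M c (f g))"
  by (auto simp: fun_eq_iff tup_def)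

lemma Full_subspace: "FF.subspace Full"
  unfolding FF.subspace_def Full_def using W_subspace
  by (auto simp: MM.subspace_0 MM.subspace_add MM.subspace_scale)

lemma tup_Full: "(\<And>g. g \<in> G \<Longrightarrow> f g \<in> W) \<Longrightarrow> tup f \<in> Full"
  unfolding Full_def by auto

lemma FullD: "k \<in> Full \<Longrightarrow> g \<in> G \<Longrightarrow> k g \<in> W"
  unfolding Full_def by auto

lemma uniform_trunc_nat:
  assumes "\<And>g. g \<in> G \<Longrightarrow> \<exists>K. \<forall>i\<ge>(K::nat). P g i"
  shows "\<exists>K. \<forall>g\<in>G. \<forall>i\<ge>K. P g i"
proof -
  obtain K where K: "\<And>g i. g \<in> G \<Longrightarrow> i \<ge> K g \<Longrightarrow> P g i" using assms by metis
  show ?thesis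
  proof (intro exI ballI allI impI)
    fix g i assume "g \<in> G" "Max (K ` G) \<le> i"
    then show "P g i" using K order_trans[OF Max_ge[of "K ` G" "K g"]] by simp
  qed
qed

lemma uniform_trunc:
  assumes "\<And>g. g \<in> G \<Longrightarrow> u g \<in> A" "\<And>g. g \<in> G \<Longrightarrow> w g \<in> W"
  shows "\<exists>n0. \<forall>n\<ge>n0. \<forall>g\<in>G. Y (u g) n (w g) = 0"
proof -
  obtain K where K: "\<forall>g\<in>G. \<forall>i\<ge>K. Y (u g) (0 + int i) (w g) = 0"
    using uniform_trunc_nat[of "\<lambda>g i. Y (u g) (0 + int i) (w g) = 0"] Y_trunc_nat assms by blast
  have "Y (u g) n (w g) = 0" if "n \<ge> int K" "g \<in> G" for n g
    using K that by (metis add_0 le_nat_iff nat_0_le of_nat_0_le_iff order_trans)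
  then show ?thesis by blast
qed

text \<open>The difference of the two actions of \<open>b\<close> and \<open>h'b\<close>, with \<open>h'\<close> inverse to \<open>h\<close>, kills the
  component at \<open>h\<close>; as in Artin's proof of the independence of characters, all components but
  one can thus be removed.\<close>
lemma component_mem:
  assumes K: "FF.subspace K" "K \<subseteq> Full" "twisted_closed K" "untwisted_closed K"
    and k: "k \<in> K" and h: "h \<in> G"
  shows "single h (k h) \<in> K"
proof -
  \<comment> \<open>Untwisted closure makes \<open>J\<close> a \<open>V\<close>-submodule, so
    membership in it can be tested on the modes of a single nonzero vector.\<close>
  define J where "J = {x \<in> W. single h x \<in> K}"
  have J: "submodule V M J"
    unfolding V_submodule_iff
  proof (intro conjI ballI allI)
    have "single h 0 = 0" "\<And>x y. single h (x + y) = single h x + single h y"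
      "\<And>c x. single h (mscale M c x) = (\<lambda>g. mscale M c (single h x g))"
      by (auto simp: single_def fun_eq_iff)
    then show "MM.subspace J"
      unfolding MM.subspace_def J_def using W_subspace K(1)
      by (auto simp: MM.subspace_0 MM.subspace_add MM.subspace_scale
          FF.subspace_0 FF.subspace_add FF.subspace_scale)
    show "J \<subseteq> W" unfolding J_def by blast
    fix u n x assume u: "u \<in> A" and x: "x \<in> J"
    have "tup (\<lambda>g. Y u n (single h x g)) \<in> K"
      using K(4) x u unfolding untwisted_closed_def J_def by blast
    moreover have "tup (\<lambda>g. Y u n (single h x g)) = single h (Y u n x)"
      using h u unfolding tup_def single_def by (intro ext) (simp add: Y_right_0)
    ultimately show "Y u n x \<in> J" using x u unfolding J_def by simp
  qed
  \<comment> \<open>\<open>S\<close> bounds the support of \<open>k\<close> away from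
    \<open>h\<close>; each induction step removes one element \<open>g0\<close> from it.\<close>
  have "k h \<in> J" if "finite S" "S \<subseteq> G - {h}" "k \<in> K" "\<And>g. g \<in> G \<Longrightarrow> g \<noteq> h \<Longrightarrow> g \<notin> S \<Longrightarrow> k g = 0" for S k
    using that
  proof (induction S arbitrary: k rule: finite_induct)
    case empty
    have "k = single h (k h)"
    proof
      show "k g = single h (k h) g" for g
        using empty K(2) unfolding single_def Full_def by (cases "g \<in> G") auto
    qed
    then show ?case unfolding J_def using empty K(2) h FullD by auto
  next
    case (insert g0 S)
    have g0: "g0 \<in> G" "h \<noteq> g0" using insert.prems by auto
    obtain g0' where g0': "g0' \<in> G" "\<And>x. g0' (g0 x) = x" "\<And>x. g0 (g0' x) = x"
      using aut_inverse[OF g0(1)] by blast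
    obtain b where b: "b \<in> A" "b - h (g0' b) \<noteq> 0"
      using aut_separate[OF h g0 g0'(2)] by blast
    have kW: "g \<in> G \<Longrightarrow> k g \<in> W" for g using insert.prems(2) K(2) FullD by blast
    show ?case
    proof (rule mem_if_modes_mem[OF simple J _ b(2) kW[OF h]])
      show "b - h (g0' b) \<in> A" using b h g0' A_subspace by (simp add: VV.subspace_diff)
      fix n
      \<comment> \<open>At \<open>g0\<close> the two modes coincide and the component drops out. At
        \<open>h\<close> there remains the mode of \<open>b - h (g0' b)\<close>, a vector chosen
        nonzero.\<close>
      let ?k = "tup (\<lambda>g. Y b n (k g)) - tup (\<lambda>g. Y (g (g0' b)) n (k g))"
      have "?k h \<in> J"
      proof (rule insert.IH)
        show "?k \<in> K"
          using K insert.prems(2) b(1) g0'(1) unfolding twisted_closed_def untwisted_closed_def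
          by (intro FF.subspace_diff) auto
        show "?k g = 0" if "g \<in> G" "g \<noteq> h" "g \<notin> S" for g
          using that insert.prems(3)[of g] b(1) g0' by (cases "g = g0") (auto simp: Y_right_0)
      qed (use insert.prems in auto)
      then show "Y (b - h (g0' b)) n (k h) \<in> J"
        using h b g0' kW by (simp add: Y_left_diff)
    qed
  qed
  from this[of "G - {h}" k] have "k h \<in> J" using k by auto
  then show ?thesis unfolding J_def by blast
qed

text \<open>The tuples \<open>Z\<close> with vanishing orbit sums are stable under both actions, so
  \<open>component_mem\<close> isolates each component within \<open>Z\<close>. Testing it with the
  mode -1 of the vacuum shows that it is 0. This is the injectivity half of the descent.\<close>

lemma tuple_zero_if_orbit_sums_zero:
  assumes k: "k \<in> Full" and zero: "\<And>v n. v \<in> A \<Longrightarrow> (\<Sum>g\<in>G. Y (g v) n (k g)) = 0"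
  shows "k = 0"
proof -
  define Z where "Z = {k \<in> Full. \<forall>v\<in>A. \<forall>n. (\<Sum>g\<in>G. Y (g v) n (k g)) = 0}"
  have Zsub: "FF.subspace Z"
    unfolding FF.subspace_def
  proof (intro conjI ballI allI)
    show "0 \<in> Z" unfolding Z_def using Full_subspace by (auto simp: FF.subspace_0 Y_right_0)
    show "x + y \<in> Z" if "x \<in> Z" "y \<in> Z" for x y
    proof -
      have "(\<Sum>g\<in>G. Y (g v) n ((x + y) g)) = (\<Sum>g\<in>G. Y (g v) n (x g)) + (\<Sum>g\<in>G. Y (g v) n (y g))"
        if "v \<in> A" for v n
        unfolding sum.distrib[symmetric] using that \<open>x \<in> Z\<close> \<open>y \<in> Z\<close>
        by (intro sum.cong) (auto simp: Z_def FullD Y_right_add)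
      then show ?thesis using that Full_subspace unfolding Z_def by (auto intro: FF.subspace_add)
    qed
    show "(\<lambda>g. mscale M c (x g)) \<in> Z" if "x \<in> Z" for c x
    proof -
      have "(\<Sum>g\<in>G. Y (g v) n (mscale M c (x g))) = mscale M c (\<Sum>g\<in>G. Y (g v) n (x g))"
        if "v \<in> A" for v n
        unfolding MM.scale_sum_right using that \<open>x \<in> Z\<close>
        by (intro sum.cong) (auto simp: Z_def FullD Y_right_scale)
      then show ?thesis
        using that FF.subspace_scale[OF Full_subspace, of x c] unfolding Z_def by auto
    qed
  qed
  have Zun: "untwisted_closed Z"
    unfolding untwisted_closed_def
  proof (intro ballI allI)
    fix k b n assume k: "k \<in> Z" and b: "b \<in> A"
    have kW: "\<And>g. g \<in> G \<Longrightarrow> k g \<in> W" and kz: "\<And>v n. v \<in> A \<Longrightarrow> (\<Sum>g\<in>G. Y (g v) n (k g)) = 0"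
      using k unfolding Z_def by (auto simp: FullD)
    have "(\<Sum>g\<in>G. Y (g v) m (Y b n (k g))) \<in> {0}" if v: "v \<in> A" for v m n
    proof -
      obtain n0 where n0: "\<forall>n\<ge>n0. \<forall>g\<in>G. Y b n (k g) = 0"
        using uniform_trunc[of "\<lambda>g. b" k] b kW by blast
      obtain N where N: "\<forall>g\<in>G. \<forall>i\<ge>N. vmode V (g v) (0 + int i) b = 0"
        using uniform_trunc_nat[of "\<lambda>g i. vmode V (g v) (0 + int i) b = 0"] V_trunc_nat v b
        by (metis aut_in)
      let ?a = "\<lambda>m n. \<Sum>g\<in>G. Y (g v) m (Y b n (k g))"
      let ?c = "\<lambda>i. (-1) ^ i * ((of_int (int N) :: complex) gchoose i)"
      show ?thesis
      proof (rule MM.descent_mem[of "{0}" n0 ?a])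
        show "?a m n \<in> {0}" if "n \<ge> n0" for m n
          using n0 that v by (simp add: Y_right_0)
        fix m n
        have "(\<Sum>i\<le>N. mscale M (?c i) (?a (m - int i) (n + int i)))
          = (\<Sum>g\<in>G. \<Sum>i\<le>N. mscale M (?c i) (Y (g v) (int N + (m - int N) - int i) (Y b (n + int i) (k g))))"
          by (subst sum.swap) (simp add: MM.scale_sum_right)
        also have "\<dots> = (\<Sum>g\<in>G. \<Sum>i\<le>N. mscale M (?c i * (-1) ^ N)
            (Y b (int N + n - int i) (Y (g v) ((m - int N) + int i) (k g))))"
          using N b v kW by (intro sum.cong refl locality) auto
        \<comment> \<open>Now the outer mode belongs to \<open>b\<close> and does not depend on
          \<open>g\<close>, so it can be taken out of the orbit sum.\<close>
        also have "\<dots> = (\<Sum>i\<le>N. mscale M (?c i * (-1) ^ N)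
            (\<Sum>g\<in>G. Y b (int N + n - int i) (Y (g v) ((m - int N) + int i) (k g))))"
          by (subst sum.swap) (simp add: MM.scale_sum_right)
        also have "\<dots> = 0"
          using b v kW kz by (simp add: Y_right_sum[symmetric] Y_right_0)
        finally show "\<exists>K c. (\<Sum>i\<le>K. mscale M (c i) (?a (m - int i) (n + int i))) \<in> {0} \<and> c 0 = 1"
          by (intro exI[of _ N] exI[of _ ?c]) simp
      qed simp
    qed
    then show "tup (\<lambda>g. Y b n (k g)) \<in> Z" unfolding Z_def using b kW by (simp add: tup_Full)
  qed
  have Ztw: "twisted_closed Z"
    unfolding twisted_closed_def
  proof (intro ballI allI)
    fix k b n assume k: "k \<in> Z" and b: "b \<in> A"
    have kW: "\<And>g. g \<in> G \<Longrightarrow> k g \<in> W" and kz: "\<And>v n. v \<in> A \<Longrightarrow> (\<Sum>g\<in>G. Y (g v) n (k g)) = 0"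
      using k unfolding Z_def by (auto simp: FullD)
    have "(\<Sum>g\<in>G. Y (g v) m (Y (g b) n (k g))) \<in> {0}" if v: "v \<in> A" for v m n
    proof -
      obtain n0 where n0: "\<forall>n\<ge>n0. \<forall>g\<in>G. Y (g b) n (k g) = 0"
        using uniform_trunc[of "\<lambda>g. g b" k] b kW by auto
      \<comment> \<open>Beyond \<open>l\<close> all \<open>g v\<close> annihilate the components, as
        weak associativity requires. It yields orbit sums for the vectors \<open>v_i b\<close>,
        because \<open>g\<close> respects modes.\<close>
      obtain l where l: "\<forall>n\<ge>l. \<forall>g\<in>G. Y (g v) n (k g) = 0"
        using uniform_trunc[of "\<lambda>g. g v" k] v kW by auto
      let ?a = "\<lambda>m n. \<Sum>g\<in>G. Y (g v) m (Y (g b) n (k g))"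
      show ?thesis
      proof (rule MM.descent_mem[of "{0}" n0 ?a])
        show "?a m n \<in> {0}" if "n \<ge> n0" for m n
          using n0 that v by (simp add: Y_right_0)
        fix m n
        let ?c = "\<lambda>i. (-1) ^ i * ((of_int (m - l) :: complex) gchoose i)"
        obtain Kl where Kl: "\<forall>i\<ge>Kl. vmode V v (m - l + int i) b = 0" using V_trunc_nat v b by blast
        define Kr where "Kr = nat (n0 - n)"
        have "(\<Sum>i\<le>Kr. mscale M (?c i) (?a (m - int i) (n + int i)))
          = (\<Sum>g\<in>G. \<Sum>i<Suc Kr. mscale M (?c i) (Y (g v) ((m - l) + l - int i) (Y (g b) (n + int i) (k g))))"
          by (subst sum.swap) (simp add: MM.scale_sum_right lessThan_Suc_atMost del: sum.lessThan_Suc)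
        also have "\<dots> = (\<Sum>g\<in>G. \<Sum>i<Kl. mscale M ((of_int l :: complex) gchoose i)
            (Y (vmode V (g v) ((m - l) + int i) (g b)) (l + n - int i) (k g)))"
          using l Kl n0 b v kW
          by (intro sum.cong refl weak_associativity[symmetric])
            (auto simp: aut_mode[symmetric] aut_0 Kr_def)
        also have "\<dots> = (\<Sum>i<Kl. mscale M ((of_int l :: complex) gchoose i)
            (\<Sum>g\<in>G. Y (g (vmode V v ((m - l) + int i) b)) (l + n - int i) (k g)))"
          using b v by (subst sum.swap) (simp add: MM.scale_sum_right aut_mode)
        also have "\<dots> = 0"
          using b v by (simp add: kz)
        finally show "\<exists>K c. (\<Sum>i\<le>K. mscale M (c i) (?a (m - int i) (n + int i))) \<in> {0} \<and> c 0 = 1"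
          by (intro exI[of _ Kr] exI[of _ ?c]) simp
      qed simp
    qed
    then show "tup (\<lambda>g. Y (g b) n (k g)) \<in> Z" unfolding Z_def using b kW by (simp add: tup_Full)
  qed
  have kZ: "k \<in> Z" using k zero unfolding Z_def by blast
  have "k h = 0" for h
  proof (cases "h \<in> G")
    case True
    have "single h (k h) \<in> Z"
      using component_mem[OF Zsub _ Ztw Zun kZ True] unfolding Z_def by blast
    then have "(\<Sum>g\<in>G. Y (g (vac V)) (-1) (single h (k h) g)) = 0"
      using vac_in unfolding Z_def by blast
    moreover have "single h (k h) g \<in> W" if "g \<in> G" for g
      using \<open>single h (k h) \<in> Z\<close> that unfolding Z_def by (auto simp: FullD)
    ultimately have "(\<Sum>g\<in>G. single h (k h) g) = 0" by (simp add: Y_vac)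
    then show ?thesis using True by (simp add: single_def)
  next
    case False
    then show ?thesis using k unfolding Full_def by blast
  qed
  then show ?thesis by (simp add: fun_eq_iff)
qed

section \<open>Tuples generated from a subspace\<close>

definition gen :: "'w set \<Rightarrow> (('v \<Rightarrow> 'v) \<Rightarrow> 'w) set"
  where "gen C = FF.span {tup (\<lambda>g. Y (g a) n c) | a n c. a \<in> A \<and> c \<in> C}"

lemma gen_base: "a \<in> A \<Longrightarrow> c \<in> C \<Longrightarrow> tup (\<lambda>g. Y (g a) n c) \<in> gen C"
  unfolding gen_def by (intro FF.span_base) blast

lemma gen_diag: "c \<in> C \<Longrightarrow> c \<in> W \<Longrightarrow> tup (\<lambda>g. c) \<in> gen C"
  using gen_base[OF vac_in, of c C "-1"] by (simp add: Y_vac cong: tup_eq_iff[THEN iffD2, rule_format])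

lemma gen_mono: "C \<subseteq> C' \<Longrightarrow> gen C \<subseteq> gen C'"
  unfolding gen_def by (intro FF.span_mono) blast

lemma gen_subspace: "FF.subspace (gen C)"
  unfolding gen_def by (rule FF.subspace_span)

lemma gen_minimal:
  assumes "FF.subspace K" "\<And>a n c. a \<in> A \<Longrightarrow> c \<in> C \<Longrightarrow> tup (\<lambda>g. Y (g a) n c) \<in> K"
  shows "gen C \<subseteq> K"
  unfolding gen_def using assms by (intro FF.span_minimal) auto

lemma gen_Full: "C \<subseteq> W \<Longrightarrow> gen C \<subseteq> Full"
  by (rule gen_minimal[OF Full_subspace]) (auto intro!: tup_Full)

lemma subspace_vimage_mode:
  assumes K: "FF.subspace K" and u: "\<And>g. g \<in> G \<Longrightarrow> u g \<in> A"
  shows "FF.subspace {k \<in> Full. tup (\<lambda>g. Y (u g) n (k g)) \<in> K}"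
  unfolding FF.subspace_def
proof (intro conjI ballI allI)
  have "tup (\<lambda>g. Y (u g) n ((0 :: ('v \<Rightarrow> 'v) \<Rightarrow> 'w) g)) = 0"
    using u by (auto simp: tup_def fun_eq_iff Y_right_0)
  then show "0 \<in> {k \<in> Full. tup (\<lambda>g. Y (u g) n (k g)) \<in> K}"
    using K Full_subspace by (auto simp: FF.subspace_0)
next
  fix x y assume xy: "x \<in> {k \<in> Full. tup (\<lambda>g. Y (u g) n (k g)) \<in> K}"
    "y \<in> {k \<in> Full. tup (\<lambda>g. Y (u g) n (k g)) \<in> K}"
  have "tup (\<lambda>g. Y (u g) n ((x + y) g)) = tup (\<lambda>g. Y (u g) n (x g)) + tup (\<lambda>g. Y (u g) n (y g))"
    using u xy by (auto simp: tup_def fun_eq_iff Y_right_add FullD)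
  then show "x + y \<in> {k \<in> Full. tup (\<lambda>g. Y (u g) n (k g)) \<in> K}"
    using K Full_subspace xy by (auto intro: FF.subspace_add)
next
  fix c x assume x: "x \<in> {k \<in> Full. tup (\<lambda>g. Y (u g) n (k g)) \<in> K}"
  have "tup (\<lambda>g. Y (u g) n (mscale M c (x g))) = (\<lambda>g. mscale M c (tup (\<lambda>g. Y (u g) n (x g)) g))"
    using u x by (auto simp: tup_def fun_eq_iff Y_right_scale FullD)
  then show "(\<lambda>g. mscale M c (x g)) \<in> {k \<in> Full. tup (\<lambda>g. Y (u g) n (k g)) \<in> K}"
    using FF.subspace_scale[OF K, of "tup (\<lambda>g. Y (u g) n (x g))" c]
      FF.subspace_scale[OF Full_subspace, of x c] x by auto
qed

text \<open>Weak associativity, with descent on the inner mode, expresses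
  \<open>(gb)_m (ga)_n c\<close> through modes of the vectors \<open>g (b_i a)\<close> on
  \<open>c\<close>. The coefficients must not depend on \<open>g\<close>, which is why the
  truncation bounds are uniform over \<open>G\<close>.\<close>

lemma gen_twisted_closed:
  assumes C: "C \<subseteq> W"
  shows "twisted_closed (gen C)"
  unfolding twisted_closed_def
proof (intro ballI allI)
  fix k b m assume k: "k \<in> gen C" and b: "b \<in> A"
  have "gen C \<subseteq> {k \<in> Full. tup (\<lambda>g. Y (g b) m (k g)) \<in> gen C}"
  proof (rule gen_minimal)
    show "FF.subspace {k \<in> Full. tup (\<lambda>g. Y (g b) m (k g)) \<in> gen C}"
      using b by (intro subspace_vimage_mode gen_subspace) auto
    fix a n c assume a: "a \<in> A" and c: "c \<in> C"
    have cW: "c \<in> W" using c C by blast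
    let ?a = "\<lambda>m n. tup (\<lambda>g. Y (g b) m (Y (g a) n c))"
    obtain n0 where n0: "\<forall>n\<ge>n0. \<forall>g\<in>G. Y (g a) n c = 0"
      using uniform_trunc[of "\<lambda>g. g a" "\<lambda>g. c"] a cW by auto
    obtain l where l: "\<forall>n\<ge>l. \<forall>g\<in>G. Y (g b) n c = 0"
      using uniform_trunc[of "\<lambda>g. g b" "\<lambda>g. c"] b cW by auto
    have "?a m n \<in> gen C"
    proof (rule FF.descent_mem[OF gen_subspace, of n0 ?a])
      show "?a m n \<in> gen C" if "n \<ge> n0" for m n
      proof -
        have "?a m n = 0" using that n0 b by (auto simp: tup_def fun_eq_iff Y_right_0)
        then show ?thesis using gen_subspace FF.subspace_0 by metis
      qed
      fix m n
      let ?c = "\<lambda>i. (-1) ^ i * ((of_int (m - l) :: complex) gchoose i)"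
      obtain Kl where Kl: "\<forall>i\<ge>Kl. vmode V b (m - l + int i) a = 0" using V_trunc_nat a b by blast
      define Kr where "Kr = nat (n0 - n)"
      have "(\<Sum>i\<le>Kr. (\<lambda>g. mscale M (?c i) (?a (m - int i) (n + int i) g)))
        = tup (\<lambda>g. \<Sum>i<Suc Kr. mscale M (?c i) (Y (g b) ((m - l) + l - int i) (Y (g a) (n + int i) c)))"
        by (simp add: tup_scale tup_sum lessThan_Suc_atMost del: sum.lessThan_Suc)
      also have "\<dots> = tup (\<lambda>g. \<Sum>i<Kl. mscale M ((of_int l :: complex) gchoose i)
            (Y (vmode V (g b) ((m - l) + int i) (g a)) (l + n - int i) c))"
        unfolding tup_eq_iff using l Kl n0 a b cW
        by (intro ballI weak_associativity[symmetric])
          (auto simp: aut_mode[symmetric] aut_0 Kr_def)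
      also have "\<dots> = (\<Sum>i<Kl. (\<lambda>g. mscale M ((of_int l :: complex) gchoose i)
          (tup (\<lambda>g. Y (g (vmode V b ((m - l) + int i) a)) (l + n - int i) c) g)))"
        unfolding tup_scale tup_sum tup_eq_iff using a b by (simp add: aut_mode)
      also have "\<dots> \<in> gen C"
        using a b c by (intro FF.subspace_sum[OF gen_subspace] FF.subspace_scale[OF gen_subspace] gen_base) auto
      finally show "\<exists>K c. (\<Sum>i\<le>K. (\<lambda>g. mscale M (c i) (?a (m - int i) (n + int i) g))) \<in> gen C \<and> c 0 = 1"
        by (intro exI[of _ Kr] exI[of _ ?c]) simp
    qed
    moreover have "tup (\<lambda>g. Y (g b) m (tup (\<lambda>g. Y (g a) n c) g)) = ?a m n"
      by (simp add: tup_eq_iff)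
    ultimately show "tup (\<lambda>g. Y (g a) n c) \<in> {k \<in> Full. tup (\<lambda>g. Y (g b) m (k g)) \<in> gen C}"
      using a cW by (auto intro: tup_Full)
  qed
  then show "tup (\<lambda>g. Y (g b) m (k g)) \<in> gen C" using k by blast
qed

text \<open>Locality moves the untwisted \<open>b\<close> inside, where it acts on \<open>c\<close>.
  The result stays in \<open>W\<close> but could leave a smaller \<open>U\<close>-submodule, hence
  the restriction to \<open>gen W\<close>.\<close>

lemma gen_untwisted_closed: "untwisted_closed (gen W)"
  unfolding untwisted_closed_def
proof (intro ballI allI)
  fix k b m assume k: "k \<in> gen W" and b: "b \<in> A"
  have "gen W \<subseteq> {k \<in> Full. tup (\<lambda>g. Y b m (k g)) \<in> gen W}"
  proof (rule gen_minimal)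
    show "FF.subspace {k \<in> Full. tup (\<lambda>g. Y b m (k g)) \<in> gen W}"
      using b by (intro subspace_vimage_mode gen_subspace) auto
    fix a n c assume a: "a \<in> A" and c: "c \<in> W"
    let ?a = "\<lambda>m n. tup (\<lambda>g. Y b m (Y (g a) n c))"
    obtain n0 where n0: "\<forall>n\<ge>n0. \<forall>g\<in>G. Y (g a) n c = 0"
      using uniform_trunc[of "\<lambda>g. g a" "\<lambda>g. c"] a c by auto
    obtain N where N: "\<forall>g\<in>G. \<forall>i\<ge>N. vmode V b (0 + int i) (g a) = 0"
      using uniform_trunc_nat[of "\<lambda>g i. vmode V b (0 + int i) (g a) = 0"] V_trunc_nat a b
      by (metis aut_in)
    have "?a m n \<in> gen W"
    proof (rule FF.descent_mem[OF gen_subspace, of n0 ?a])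
      show "?a m n \<in> gen W" if "n \<ge> n0" for m n
      proof -
        have "?a m n = 0" using that n0 b by (auto simp: tup_def fun_eq_iff Y_right_0)
        then show ?thesis using gen_subspace FF.subspace_0 by metis
      qed
      fix m n
      let ?c = "\<lambda>i. (-1) ^ i * ((of_int (int N) :: complex) gchoose i)"
      have "(\<Sum>i\<le>N. (\<lambda>g. mscale M (?c i) (?a (m - int i) (n + int i) g)))
        = tup (\<lambda>g. \<Sum>i\<le>N. mscale M (?c i) (Y b (int N + (m - int N) - int i) (Y (g a) (n + int i) c)))"
        by (simp add: tup_scale tup_sum)
      also have "\<dots> = tup (\<lambda>g. \<Sum>i\<le>N. mscale M (?c i * (-1) ^ N)
            (Y (g a) (int N + n - int i) (Y b ((m - int N) + int i) c)))"
        unfolding tup_eq_iff using N a b c by (intro ballI locality) auto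
      also have "\<dots> = (\<Sum>i\<le>N. (\<lambda>g. mscale M (?c i * (-1) ^ N)
          (tup (\<lambda>g. Y (g a) (int N + n - int i) (Y b ((m - int N) + int i) c)) g)))"
        unfolding tup_scale tup_sum ..
      also have "\<dots> \<in> gen W"
        using a b c by (intro FF.subspace_sum[OF gen_subspace] FF.subspace_scale[OF gen_subspace] gen_base) auto
      finally show "\<exists>K c. (\<Sum>i\<le>K. (\<lambda>g. mscale M (c i) (?a (m - int i) (n + int i) g))) \<in> gen W \<and> c 0 = 1"
        by (intro exI[of _ N] exI[of _ ?c]) simp
    qed
    moreover have "tup (\<lambda>g. Y b m (tup (\<lambda>g. Y (g a) n c) g)) = ?a m n"
      by (simp add: tup_eq_iff)
    ultimately show "tup (\<lambda>g. Y (g a) n c) \<in> {k \<in> Full. tup (\<lambda>g. Y b m (k g)) \<in> gen W}"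
      using a c by (auto intro: tup_Full)
  qed
  then show "tup (\<lambda>g. Y b m (k g)) \<in> gen W" using k by blast
qed

lemma single_mem_gen:
  assumes "x \<in> W" "h \<in> G"
  shows "single h x \<in> gen W"
  using component_mem[OF gen_subspace gen_Full[OF order_refl] gen_twisted_closed[OF order_refl]
      gen_untwisted_closed gen_diag[OF assms(1,1)] assms(2)] assms(2) by simp

text \<open>The components of a generator add up to a mode on \<open>c\<close> of the orbit sum of
  \<open>a\<close>, which is an element of \<open>U\<close>.\<close>

lemma sum_gen_mem:
  assumes C: "submodule U M C" and k: "k \<in> gen C"
  shows "(\<Sum>g\<in>G. k g) \<in> C"
proof -
  have Cs: "MM.subspace C" "C \<subseteq> W" using C unfolding submodule_U by auto
  have "gen C \<subseteq> {k. (\<Sum>g\<in>G. k g) \<in> C}"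
  proof (rule gen_minimal)
    show "FF.subspace {k. (\<Sum>g\<in>G. k g) \<in> C}"
      unfolding FF.subspace_def using Cs(1)
      by (auto simp: sum.distrib MM.scale_sum_right[symmetric] MM.subspace_0 MM.subspace_add MM.subspace_scale)
    fix a n c assume a: "a \<in> A" and c: "c \<in> C"
    have "(\<Sum>g\<in>G. tup (\<lambda>g. Y (g a) n c) g) = Y (\<Sum>g\<in>G. g a) n c"
      using a c Cs by (subst Y_left_sum) auto
    then show "tup (\<lambda>g. Y (g a) n c) \<in> {k. (\<Sum>g\<in>G. k g) \<in> C}"
      using C orbit_sum_fixed[OF a] c unfolding submodule_U by simp
  qed
  then show ?thesis using k by blast
qed

text \<open>Modulo \<open>N\<close>, the tuples in \<open>KD\<close> are concentrated at
  \<open>id\<close>, where \<open>V\<close> acts without twist; their components at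
  \<open>id\<close> therefore form a \<open>V\<close>-submodule. If such a component lies in
  \<open>N\<close> as well, all orbit sums of the tuple lie in both \<open>N\<close> and
  \<open>C\<close>, so they vanish and the tuple is 0.\<close>

theorem complement_from_fixed_points:
  assumes N: "submodule V M N" and C: "submodule U M C"
    and disj: "N \<inter> C = {0}" and total: "\<And>w. w \<in> W \<Longrightarrow> \<exists>x\<in>N. \<exists>c\<in>C. w = x + c"
  shows "\<exists>D. submodule V M D \<and> N \<inter> D = {0} \<and> (\<forall>w\<in>W. \<exists>x\<in>N. \<exists>d\<in>D. w = x + d)"
proof -
  have Ns: "MM.subspace N" "N \<subseteq> W" and Nc: "\<And>u n x. u \<in> A \<Longrightarrow> x \<in> N \<Longrightarrow> Y u n x \<in> N"
    using N unfolding submodule_def by auto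
  have Cs: "MM.subspace C" "C \<subseteq> W" using C unfolding submodule_U by auto
  define KD where "KD = {k \<in> gen C. \<forall>g\<in>G. g \<noteq> id \<longrightarrow> k g \<in> N}"
  define D where "D = (\<lambda>k. k id) ` KD"
  have KD_sub: "FF.subspace KD"
    unfolding FF.subspace_def KD_def using gen_subspace[of C] Ns(1)
    by (auto simp: FF.subspace_0 MM.subspace_0 intro: FF.subspace_add MM.subspace_add
        FF.subspace_scale MM.subspace_scale)
  have "submodule V M D"
    unfolding V_submodule_iff
  proof (intro conjI ballI allI)
    show "MM.subspace D"
      unfolding MM.subspace_def D_def
    proof (intro conjI ballI allI)
      show "0 \<in> (\<lambda>k. k id) ` KD"
        using FF.subspace_0[OF KD_sub] by (intro image_eqI[of _ _ 0]) auto
      show "x + y \<in> (\<lambda>k. k id) ` KD" if "x \<in> (\<lambda>k. k id) ` KD" "y \<in> (\<lambda>k. k id) ` KD" for x y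
      proof -
        obtain k k' where "x = k id" "y = k' id" "k \<in> KD" "k' \<in> KD" using \<open>x \<in> _\<close> \<open>y \<in> _\<close> by blast
        then show ?thesis
          using FF.subspace_add[OF KD_sub] by (intro image_eqI[of _ _ "k + k'"]) auto
      qed
      show "mscale M c x \<in> (\<lambda>k. k id) ` KD" if x: "x \<in> (\<lambda>k. k id) ` KD" for c x
      proof -
        obtain k where k: "x = k id" "k \<in> KD" using x by blast
        then show ?thesis
          using FF.subspace_scale[OF KD_sub k(2), of c] by (intro image_eqI[of _ _ "\<lambda>g. mscale M c (k g)"]) auto
      qed
    qed
    show "D \<subseteq> W"
      unfolding D_def KD_def using gen_Full[OF Cs(2)] FullD by auto
    fix u n d assume u: "u \<in> A" and d: "d \<in> D"
    obtain k where k: "k \<in> gen C" "\<And>g. g \<in> G \<Longrightarrow> g \<noteq> id \<Longrightarrow> k g \<in> N" "d = k id"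
      using d unfolding D_def KD_def by blast
    let ?k = "tup (\<lambda>g. Y (g u) n (k g))"
    have "?k \<in> KD"
      unfolding KD_def using gen_twisted_closed[OF Cs(2)] k u Nc
      unfolding twisted_closed_def by auto
    moreover have "?k id = Y u n d" using k by simp
    ultimately show "Y u n d \<in> D" unfolding D_def by (intro image_eqI[of _ _ ?k]) simp_all
  qed
  moreover have "N \<inter> D = {0}"
  proof -
    have "x = 0" if "x \<in> N" "x \<in> D" for x
    proof -
      obtain k where k: "k \<in> gen C" "\<And>g. g \<in> G \<Longrightarrow> g \<noteq> id \<Longrightarrow> k g \<in> N" "x = k id"
        using \<open>x \<in> D\<close> unfolding D_def KD_def by blast
      have kN: "k g \<in> N" if "g \<in> G" for g using k \<open>x \<in> N\<close> that by (cases "g = id") auto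
      have "k = 0"
      proof (rule tuple_zero_if_orbit_sums_zero)
        show "k \<in> Full" using k gen_Full[OF Cs(2)] by blast
        fix v n assume v: "v \<in> A"
        have "tup (\<lambda>g. Y (g v) n (k g)) \<in> gen C"
          using gen_twisted_closed[OF Cs(2)] k(1) v unfolding twisted_closed_def by blast
        then have "(\<Sum>g\<in>G. Y (g v) n (k g)) \<in> C"
          using sum_gen_mem[OF C] by fastforce
        moreover have "(\<Sum>g\<in>G. Y (g v) n (k g)) \<in> N"
          using Nc v kN by (intro MM.subspace_sum[OF Ns(1)]) auto
        ultimately show "(\<Sum>g\<in>G. Y (g v) n (k g)) = 0" using disj by blast
      qed
      then show ?thesis using k by simp
    qed
    moreover have "0 \<in> N" "0 \<in> D"
      using MM.subspace_0 Ns(1) \<open>submodule V M D\<close> unfolding submodule_def by auto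
    ultimately show ?thesis by blast
  qed
  moreover have "\<exists>x\<in>N. \<exists>d\<in>D. w = x + d" if w: "w \<in> W" for w
  proof -
    \<comment> \<open>As \<open>W\<close> is the sum of \<open>N\<close> and \<open>C\<close>, every
      generated tuple splits into one over \<open>N\<close> and one from \<open>gen C\<close>. For
      \<open>single id w\<close> the second part has its components off \<open>id\<close> in
      \<open>N\<close>, so it belongs to \<open>KD\<close>.\<close>
    define K where "K = {k1 + k2 |k1 k2. k1 \<in> {k. \<forall>g\<in>G. k g \<in> N} \<and> k2 \<in> gen C}"
    have "gen W \<subseteq> K"
    proof (rule gen_minimal)
      have "FF.subspace {k. \<forall>g\<in>G. k g \<in> N}"
        unfolding FF.subspace_def using Ns(1)
        by (auto simp: MM.subspace_0 MM.subspace_add MM.subspace_scale)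
      then show "FF.subspace K"
        unfolding K_def by (rule FF.subspace_sums[OF _ gen_subspace[of C]])
      fix a n w assume a: "a \<in> A" and "w \<in> W"
      then obtain x c where xc: "x \<in> N" "c \<in> C" "w = x + c" using total by blast
      have "tup (\<lambda>g. Y (g a) n w) = tup (\<lambda>g. Y (g a) n x) + tup (\<lambda>g. Y (g a) n c)"
        using xc a Ns Cs by (auto simp: tup_def fun_eq_iff Y_right_add subset_iff)
      moreover have "tup (\<lambda>g. Y (g a) n x) \<in> {k. \<forall>g\<in>G. k g \<in> N}"
        using Nc a xc by simp
      ultimately show "tup (\<lambda>g. Y (g a) n w) \<in> K"
        unfolding K_def using gen_base[OF a xc(2)] by blast
    qed
    then have "single id w \<in> K" using single_mem_gen[OF w id_G] by blast
    then obtain k1 k2 where k12: "\<And>g. g \<in> G \<Longrightarrow> k1 g \<in> N" "k2 \<in> gen C" "single id w = k1 + k2"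
      unfolding K_def by blast
    have "k2 g \<in> N" if "g \<in> G" "g \<noteq> id" for g
    proof -
      have "k1 g + k2 g = 0"
        using fun_cong[OF k12(3), of g] that by (simp add: single_def)
      then have "k2 g = - k1 g" by (simp add: eq_neg_iff_add_eq_0 add.commute)
      then show ?thesis using k12(1) that Ns(1) by (simp add: MM.subspace_neg)
    qed
    then have "k2 id \<in> D" unfolding D_def KD_def using k12(2) by blast
    moreover have "w = k1 id + k2 id"
      using fun_cong[OF k12(3), of id] by (simp add: single_def)
    ultimately show ?thesis using k12(1)[OF id_G] by blast
  qed
  ultimately show ?thesis by blast
qed

section \<open>Length of spaces of tuples over an irreducible module\<close>

definition lead :: "('v \<Rightarrow> 'v) list \<Rightarrow> (('v \<Rightarrow> 'v) \<Rightarrow> 'w) set \<Rightarrow> nat \<Rightarrow> 'w set"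
  where "lead gs K j = {k (gs ! j) |k. k \<in> K \<and> (\<forall>i<j. k (gs ! i) = 0)}"

lemma lead_mono: "K \<subseteq> K' \<Longrightarrow> lead gs K j \<subseteq> lead gs K' j"
  unfolding lead_def by blast

text \<open>Position \<open>j\<close> carries a twisted action, so the direct action of
  \<open>u\<close> there is the twisted action of \<open>h u\<close> with \<open>h\<close> inverse
  to \<open>gs ! j\<close>. Zeros at earlier positions are preserved.\<close>

lemma lead_submodule:
  assumes gs: "set gs = G" "j < length gs" and K: "FF.subspace K" "K \<subseteq> Full" "twisted_closed K"
  shows "submodule V M (lead gs K j)"
  unfolding V_submodule_iff
proof (intro conjI ballI allI)
  have g: "gs ! j \<in> G" using gs by auto
  show "MM.subspace (lead gs K j)"
    unfolding MM.subspace_def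
  proof (intro conjI ballI allI)
    show "0 \<in> lead gs K j"
      unfolding lead_def using FF.subspace_0[OF K(1)] by (auto intro!: exI[of _ 0])
    show "x + y \<in> lead gs K j" if x: "x \<in> lead gs K j" and y: "y \<in> lead gs K j" for x y
    proof -
      obtain k k' where "x = k (gs ! j)" "k \<in> K" "\<forall>i<j. k (gs ! i) = 0"
        "y = k' (gs ! j)" "k' \<in> K" "\<forall>i<j. k' (gs ! i) = 0" using x y unfolding lead_def by blast
      then show ?thesis
        unfolding lead_def using FF.subspace_add[OF K(1), of k k'] by (auto intro!: exI[of _ "k + k'"])
    qed
    show "mscale M c x \<in> lead gs K j" if x: "x \<in> lead gs K j" for c x
    proof -
      obtain k where "x = k (gs ! j)" "k \<in> K" "\<forall>i<j. k (gs ! i) = 0" using x unfolding lead_def by blast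
      then show ?thesis
        unfolding lead_def using FF.subspace_scale[OF K(1), of k c]
        by (auto intro!: exI[of _ "\<lambda>g. mscale M c (k g)"])
    qed
  qed
  show "lead gs K j \<subseteq> W"
    unfolding lead_def using K(2) FullD g by blast
  fix u n w assume u: "u \<in> A" and w: "w \<in> lead gs K j"
  obtain k where k: "w = k (gs ! j)" "k \<in> K" "\<And>i. i < j \<Longrightarrow> k (gs ! i) = 0"
    using w unfolding lead_def by blast
  obtain h where h: "h \<in> G" "\<And>x. (gs ! j) (h x) = x" using aut_inverse[OF g] by metis
  let ?k = "tup (\<lambda>g. Y (g (h u)) n (k g))"
  have "?k \<in> K" using K(3) k(2) h(1) u unfolding twisted_closed_def by simp
  moreover have "?k (gs ! j) = Y u n w" using g h k by simp
  moreover have "?k (gs ! i) = 0" if "i < j" for i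
  proof -
    have "gs ! i \<in> G" using that gs by auto
    then show ?thesis using k(3)[OF that] h u by (simp add: Y_right_0)
  qed
  ultimately show "Y u n w \<in> lead gs K j"
    unfolding lead_def by (intro CollectI exI[of _ ?k]) simp
qed

text \<open>Gaussian elimination: by irreducibility the leading entries at a position form 0 or all
  of \<open>W\<close>. Equal pivot positions thus allow an element of \<open>K'\<close> to be
  cleared position by position with elements of \<open>K\<close>.\<close>

lemma subset_if_lead_eq:
  assumes irr: "irreducible V M" and gs: "set gs = G"
    and K: "FF.subspace K" "K \<subseteq> Full" "twisted_closed K"
    and K': "FF.subspace K'" "K' \<subseteq> Full" "twisted_closed K'"
    and sub: "K \<subseteq> K'"
    and eq: "{j. j < length gs \<and> lead gs K j \<noteq> {0}} = {j. j < length gs \<and> lead gs K' j \<noteq> {0}}"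
  shows "K' \<subseteq> K"
proof -
  have cases01: "lead gs K'' j = {0} \<or> lead gs K'' j = W"
    if "FF.subspace K''" "K'' \<subseteq> Full" "twisted_closed K''" "j < length gs" for K'' j
    using irr lead_submodule[OF gs that(4,1-3)] unfolding irreducible_def by blast
  have "k \<in> K" if "k \<in> K'" "\<forall>i<j. k (gs ! i) = 0" "j \<le> length gs" for j k
    using that
  proof (induction "length gs - j" arbitrary: j k)
    case 0
    have "k g = 0" for g
    proof (cases "g \<in> G")
      case True
      then show ?thesis using 0 gs by (metis diff_is_0_eq in_set_conv_nth le_antisym)
    next
      case False
      then show ?thesis using 0 K' unfolding Full_def by auto
    qed
    then have "k = 0" by (simp add: fun_eq_iff)
    then show ?case using FF.subspace_0[OF K(1)] by metis
  next
    case (Suc d)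
    have j: "j < length gs" using Suc by simp
    have inK': "k (gs ! j) \<in> lead gs K' j" unfolding lead_def using Suc.prems by blast
    have "k (gs ! j) \<in> lead gs K j"
    proof (cases "lead gs K' j = {0}")
      case True
      then show ?thesis
        using inK' lead_submodule[OF gs j K] MM.subspace_0 unfolding submodule_def by auto
    next
      case False
      then have "lead gs K j \<noteq> {0}" using eq j by blast
      then have "lead gs K j = W" using cases01[OF K j] by blast
      then show ?thesis using inK' lead_submodule[OF gs j K'] unfolding submodule_def by blast
    qed
    then obtain k0 where k0: "k0 \<in> K" "k0 (gs ! j) = k (gs ! j)" "\<forall>i<j. k0 (gs ! i) = 0"
      unfolding lead_def by auto
    have "k - k0 \<in> K"
    proof (rule Suc.hyps(1)[of "Suc j"])
      show "k - k0 \<in> K'" using Suc.prems(1) k0(1) sub K'(1) by (auto intro: FF.subspace_diff)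
      show "\<forall>i<Suc j. (k - k0) (gs ! i) = 0"
        using k0 Suc.prems(2) by (auto simp: less_Suc_eq)
    qed (use Suc.hyps(2) j in auto)
    then have "(k - k0) + k0 \<in> K" using k0(1) K(1) by (intro FF.subspace_add)
    then show ?case by simp
  qed
  from this[of _ 0] show ?thesis by auto
qed

text \<open>Tuples generated by a \<open>U\<close>-submodule determine it, and the tuples over an irreducible
  \<open>V\<close>-module have length \<open>card G\<close>; so chains of \<open>U\<close>-submodules have length at most \<open>card G\<close>.\<close>
theorem irreducible_finitely_generated:
  assumes irr: "irreducible V M"
  shows "\<exists>B. finite B \<and> B \<subseteq> W \<and> (\<forall>S. submodule U M S \<longrightarrow> B \<subseteq> S \<longrightarrow> S = W)"
proof -
  \<comment> \<open>Entries of \<open>gs\<close> may repeat; a repeated one has leading space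
    0.\<close>
  obtain gs where gs: "set gs = G" using finite_list[OF finite_G] by blast
  define Ug where "Ug B = \<Inter>{S. submodule U M S \<and> B \<subseteq> S}" for B
  define L where "L B = {j. j < length gs \<and> lead gs (gen (Ug B)) j \<noteq> {0}}" for B
  have subW: "submodule U M W"
    unfolding submodule_U using W_subspace U_subset by auto
  have Ug: "submodule U M (Ug B)" "B \<subseteq> Ug B" if "B \<subseteq> W" for B
  proof -
    have "MM.subspace (Ug B)"
      unfolding Ug_def submodule_U by (intro MM.subspace_Inter) auto
    moreover have "Ug B \<subseteq> W" unfolding Ug_def using subW that by blast
    ultimately show "submodule U M (Ug B)"
      unfolding submodule_U by (simp add: Ug_def) (simp add: submodule_U)
    show "B \<subseteq> Ug B" unfolding Ug_def by blast
  qed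
  have finL: "finite (L B)" and cardL: "card (L B) \<le> length gs" for B
  proof -
    have "L B \<subseteq> {..<length gs}" unfolding L_def by auto
    then show "finite (L B)" "card (L B) \<le> length gs"
      using finite_subset card_mono[of "{..<length gs}" "L B"] by auto
  qed
  \<comment> \<open>The number of pivots is at most \<open>length gs\<close>, so some finite
    \<open>B\<close> attains the maximum. Adjoining any \<open>y\<close> then adds no pivot and does
    not enlarge \<open>gen\<close>.\<close>
  have "\<exists>B. (finite B \<and> B \<subseteq> W) \<and> (\<forall>B'. finite B' \<and> B' \<subseteq> W \<longrightarrow> card (L B') \<le> card (L B))"
    using ex_has_greatest_nat[of "\<lambda>B. finite B \<and> B \<subseteq> W" "{}" "\<lambda>B. card (L B)" "Suc (length gs)"] cardL
    by (auto simp: less_Suc_eq_le)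
  then obtain B where B: "finite B" "B \<subseteq> W"
    and max: "\<forall>B'. finite B' \<and> B' \<subseteq> W \<longrightarrow> card (L B') \<le> card (L B)" by (elim exE conjE)
  have "y \<in> Ug B" if y: "y \<in> W" for y
  proof -
    let ?B' = "insert y B"
    have B': "?B' \<subseteq> W" using B y by blast
    have mono: "Ug B \<subseteq> Ug ?B'" unfolding Ug_def by blast
    have UW: "Ug B \<subseteq> W" "Ug ?B' \<subseteq> W"
      using Ug(1)[OF B(2)] Ug(1)[OF B'] unfolding submodule_U by auto
    have "L B \<subseteq> L ?B'"
    proof
      fix j assume j: "j \<in> L B"
      have "j < length gs" using j unfolding L_def by blast
      then have "0 \<in> lead gs (gen (Ug B)) j"
        using lead_submodule[OF gs _ gen_subspace gen_Full[OF UW(1)] gen_twisted_closed[OF UW(1)]] MM.subspace_0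
        unfolding submodule_def by blast
      then have "\<exists>x\<in>lead gs (gen (Ug B)) j. x \<noteq> 0" using j unfolding L_def by blast
      then show "j \<in> L ?B'"
        using lead_mono[OF gen_mono[OF mono], of gs j] \<open>j < length gs\<close> unfolding L_def by blast
    qed
    then have "L B = L ?B'" using max[rule_format, of ?B'] B(1) B' finL by (intro card_seteq) auto
    then have "gen (Ug ?B') \<subseteq> gen (Ug B)"
      unfolding L_def using gen_mono[OF mono]
      by (rule subset_if_lead_eq[OF irr gs gen_subspace gen_Full[OF UW(1)] gen_twisted_closed[OF UW(1)]
            gen_subspace gen_Full[OF UW(2)] gen_twisted_closed[OF UW(2)], rotated])
    moreover have "tup (\<lambda>g. y) \<in> gen (Ug ?B')"
      using Ug(2)[OF B'] y by (intro gen_diag) auto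
    \<comment> \<open>Summing the constant tuple returns \<open>card G\<close> copies of
      \<open>y\<close>, and \<open>card G\<close> is invertible in the scalars.\<close>
    ultimately have "(\<Sum>g\<in>G. tup (\<lambda>g. y) g) \<in> Ug B"
      using sum_gen_mem[OF Ug(1)[OF B(2)]] by blast
    then have "mscale M (of_nat (card G)) y \<in> Ug B"
      by (simp add: MM.sum_constant_scale)
    then have "mscale M (inverse (of_nat (card G))) (mscale M (of_nat (card G)) y) \<in> Ug B"
      using Ug(1)[OF B(2)] MM.subspace_scale unfolding submodule_U by blast
    moreover have "card G \<noteq> 0" using id_G finite_G card_0_eq by blast
    ultimately show ?thesis by simp
  qed
  then have "S = W" if "submodule U M S" "B \<subseteq> S" for S
    using that unfolding Ug_def submodule_U by blast
  then show ?thesis using B by blast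
qed

end

section \<open>Rationality\<close>

context weak_voa_module
begin

lemma weak_module_submodule:
  assumes X: "submodule V M X"
  shows "weak_module V (M\<lparr>mcarrier := X\<rparr>)"
proof -
  have Xs: "MM.subspace X" and XW: "\<And>w. w \<in> X \<Longrightarrow> w \<in> W" and Xc: "\<And>u n w. u \<in> A \<Longrightarrow> w \<in> X \<Longrightarrow> Y u n w \<in> X"
    using X unfolding submodule_def by auto
  have lin: "lin_on (mscale M) (mscale M) X (Y u n)" if "u \<in> A" for u n
    using Y_lin_right[OF that] XW unfolding lin_on_def by blast
  show ?thesis
    using weak Xs Xc XW lin unfolding weak_module_def Let_def by simp
qed

lemma irreducible_submodule_iff:
  assumes X: "submodule V M X"
  shows "irreducible V (M\<lparr>mcarrier := X\<rparr>) \<longleftrightarrow>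
    X \<noteq> {0} \<and> (\<forall>S. submodule V M S \<longrightarrow> S \<subseteq> X \<longrightarrow> S = {0} \<or> S = X)"
proof -
  have "submodule V (M\<lparr>mcarrier := X\<rparr>) S \<longleftrightarrow> submodule V M S \<and> S \<subseteq> X" for S
    using X unfolding submodule_def by auto
  then show ?thesis unfolding irreducible_def by auto
qed

lemma operator_space_modes:
  assumes "A' \<subseteq> A"
  shows "operator_space (mscale M) W {Y u n |u n. u \<in> A'}"
  using assms W_subspace Y_lin_right by unfold_locales auto

end

context voa_group_module
begin

lemma weak_module_U: "weak_module U M"
proof -
  have sc: "vscale U = vscale V" "vmode U = vmode V" "vac U = vac V" unfolding fixed_sub_def by auto
  have lin: "lin_on (vscale V) (mscale M) (vcarrier U) (\<lambda>u. Y u n w)" if "w \<in> W" for w n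
    using Y_lin_left[OF that] U_subset unfolding lin_on_def by blast
  show ?thesis
    using weak U_subset lin unfolding weak_module_def Let_def sc by simp
qed

lemma wtsp_U: "wtsp U k \<subseteq> wtsp V k"
  unfolding wtsp_def Lop_def fixed_sub_def by auto

lemma N_gradable_U: "N_gradable V M \<Longrightarrow> N_gradable U M"
  unfolding N_gradable_def using wtsp_U by blast

lemma grading_restricted_U: "grading_restricted U N = grading_restricted V N"
  unfolding grading_restricted_def mwtsp_def fixed_sub_def by simp

text \<open>\<open>X\<close> is generated over \<open>U\<close> by a finite set, which involves only
  finitely many members \<open>F\<close> of \<open>S\<close>; so \<open>X\<close> lies in the span
  of \<open>F\<close>. Since \<open>U\<close> and \<open>V\<close> share the conformal vector, the
  weight spaces of \<open>X\<close> lie in finite sums of weight spaces of members of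
  \<open>F\<close>.\<close>

lemma grading_restricted_irreducible:
  assumes span: "MM.span (\<Union>S) = W"
    and S: "\<And>X. X \<in> S \<Longrightarrow> submodule U M X" "\<And>X. X \<in> S \<Longrightarrow> grading_restricted V (M\<lparr>mcarrier := X\<rparr>)"
    and X: "submodule V M X" "irreducible V (M\<lparr>mcarrier := X\<rparr>)"
  shows "grading_restricted V (M\<lparr>mcarrier := X\<rparr>)"
proof -
  interpret X: voa_group_module V "M\<lparr>mcarrier := X\<rparr>" G
    using voa weak_module_submodule[OF X(1)] simple grp by unfold_locales
  interpret UO: operator_space "mscale M" W "{Y u n |u n. u \<in> vcarrier U}"
    using U_subset by (intro operator_space_modes) blast
  let ?T = "Y (omg V) 1"
  have T: "lin_on (mscale M) (mscale M) W ?T" by (rule Y_lin_right[OF omg_in])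
  have Xs: "MM.subspace X" "X \<subseteq> W" and XT: "\<And>x. x \<in> X \<Longrightarrow> ?T x \<in> X"
    using X(1) unfolding submodule_def by auto
  have Ss: "MM.subspace Z" "Z \<subseteq> W" if "Z \<in> S" for Z
    using S(1)[OF that] unfolding submodule_U by auto
  obtain B where B: "finite B" "B \<subseteq> X"
    and gen: "\<And>S. submodule U (M\<lparr>mcarrier := X\<rparr>) S \<Longrightarrow> B \<subseteq> S \<Longrightarrow> S = X"
    using X.irreducible_finitely_generated[OF X(2)] by auto
  have "\<exists>F. finite F \<and> F \<subseteq> S \<and> b \<in> MM.span (\<Union>F)" if b: "b \<in> B" for b
  proof -
    have "b \<in> MM.span (\<Union>i\<in>S. i)" using span b B(2) Xs(2) by auto
    then obtain J z where J: "finite J" "J \<subseteq> S" "\<forall>i\<in>J. z i \<in> i" "b = (\<Sum>i\<in>J. z i)"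
      using MM.span_UN_decomp[of b "\<lambda>i. i" S] Ss by blast
    have "b \<in> MM.span (\<Union>J)"
      unfolding J(4) using J(3) by (intro MM.span_sum MM.span_base) blast
    then show ?thesis using J by blast
  qed
  then obtain f where f: "\<And>b. b \<in> B \<Longrightarrow> finite (f b) \<and> f b \<subseteq> S \<and> b \<in> MM.span (\<Union>(f b))" by metis
  define F where "F = (\<Union>b\<in>B. f b)"
  have F: "finite F" "F \<subseteq> S" unfolding F_def using f B by auto
  have "UO.invariant (MM.span (\<Union>F))"
  proof (rule UO.invariant_span)
    show "\<Union>F \<subseteq> W" using F Ss by blast
    show "T x \<in> MM.span (\<Union>F)" if T: "T \<in> {Y u n |u n. u \<in> vcarrier U}" and x: "x \<in> \<Union>F" for T x
    proof -
      obtain Z where "Z \<in> F" "x \<in> Z" using x by blast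
      then have "T x \<in> Z" using T S(1) F unfolding submodule_U by blast
      then show ?thesis using \<open>Z \<in> F\<close> by (auto intro: MM.span_base)
    qed
  qed
  then have "submodule U (M\<lparr>mcarrier := X\<rparr>) (X \<inter> MM.span (\<Union>F))"
    using X(1) U_subset unfolding UO.invariant_def submodule_def
    by (auto intro!: MM.subspace_inter) blast
  moreover have "B \<subseteq> X \<inter> MM.span (\<Union>F)"
  proof
    fix b assume b: "b \<in> B"
    have "MM.span (\<Union>(f b)) \<subseteq> MM.span (\<Union>F)" using b unfolding F_def by (intro MM.span_mono) blast
    then show "b \<in> X \<inter> MM.span (\<Union>F)" using f[OF b] b B by blast
  qed
  ultimately have XF: "X \<subseteq> MM.span (\<Union>F)" using gen by blast
  define EF where "EF lam = MM.span (\<Union>Z\<in>F. mwtsp V (M\<lparr>mcarrier := Z\<rparr>) lam)" for lam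
  have EF_sub: "MM.subspace (EF lam)" for lam unfolding EF_def by simp
  have EF_eig: "EF lam \<subseteq> {w \<in> W. ?T w = mscale M lam w}" for lam
    unfolding EF_def
  proof (rule MM.span_minimal)
    show "(\<Union>Z\<in>F. mwtsp V (M\<lparr>mcarrier := Z\<rparr>) lam) \<subseteq> {w \<in> W. ?T w = mscale M lam w}"
      unfolding mwtsp_def using F Ss by auto
  qed (rule MM.subspace_eigenspace[OF W_subspace T])
  have in_EF: "x \<in> MM.span (\<Union>lam. EF lam)" if x: "x \<in> X" for x
  proof -
    have "MM.span (\<Union>F) \<subseteq> MM.span (\<Union>lam. EF lam)"
    proof (rule MM.span_minimal[OF _ MM.subspace_span])
      show "\<Union>F \<subseteq> MM.span (\<Union>lam. EF lam)"
      proof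
        fix y assume "y \<in> \<Union>F"
        then obtain Z where Z: "Z \<in> F" "y \<in> Z" by blast
        have "y \<in> MM.span (\<Union>lam. mwtsp V (M\<lparr>mcarrier := Z\<rparr>) lam)"
          using S(2)[of Z] Z F unfolding grading_restricted_def by auto
        moreover have "mwtsp V (M\<lparr>mcarrier := Z\<rparr>) lam \<subseteq> EF lam" for lam
          using Z(1) unfolding EF_def by (auto intro: MM.span_base)
        ultimately show "y \<in> MM.span (\<Union>lam. EF lam)"
          using MM.span_mono[of "\<Union>lam. mwtsp V (M\<lparr>mcarrier := Z\<rparr>) lam" "\<Union>lam. EF lam"] by blast
      qed
    qed
    then show ?thesis using XF x by blast
  qed
  have mw: "mwtsp V (M\<lparr>mcarrier := X\<rparr>) lam = {w \<in> X. ?T w = mscale M lam w}" for lam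
    unfolding mwtsp_def by simp
  have sub_EF: "mwtsp V (M\<lparr>mcarrier := X\<rparr>) lam \<subseteq> EF lam" for lam
  proof
    fix x assume "x \<in> mwtsp V (M\<lparr>mcarrier := X\<rparr>) lam"
    then show "x \<in> EF lam"
      using Xs(2) in_EF EF_eig EF_sub unfolding mw
      by (intro MM.eigenspace_of_span[OF W_subspace T, of "\<lambda>l. l" UNIV EF x lam]) auto
  qed
  have "MM.span (\<Union>lam. mwtsp V (M\<lparr>mcarrier := X\<rparr>) lam) = X"
  proof
    show "MM.span (\<Union>lam. mwtsp V (M\<lparr>mcarrier := X\<rparr>) lam) \<subseteq> X"
      using Xs(1) by (intro MM.span_minimal) (auto simp: mw)
    show "X \<subseteq> MM.span (\<Union>lam. mwtsp V (M\<lparr>mcarrier := X\<rparr>) lam)"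
    proof
      fix x assume x: "x \<in> X"
      \<comment> \<open>The components are found in the spaces \<open>EF\<close>; they return to
        \<open>X\<close> because \<open>X\<close> is stable under the mode of
        \<open>omg V\<close>.\<close>
      obtain J z where J: "finite J" "\<forall>i\<in>J. z i \<in> EF i" "x = (\<Sum>i\<in>J. z i)"
        using MM.span_UN_decomp[OF in_EF[OF x]] EF_sub by blast
      have "z i \<in> mwtsp V (M\<lparr>mcarrier := X\<rparr>) i" if i: "i \<in> J" for i
      proof -
        have "z i \<in> X"
        proof (rule MM.eigen_components[OF W_subspace T Xs XT J(1), of "\<lambda>l. l" z i])
          show "z j \<in> W" "?T (z j) = mscale M j (z j)" if "j \<in> J" for j
            using that J(2) EF_eig by blast+
        qed (use J x i in auto)
        then show ?thesis unfolding mw using J(2) i EF_eig by blast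
      qed
      then show "x \<in> MM.span (\<Union>lam. mwtsp V (M\<lparr>mcarrier := X\<rparr>) lam)"
        unfolding J(3) by (intro MM.span_sum MM.span_base) blast
    qed
  qed
  moreover have "fin_dim_sub (mscale M) (mwtsp V (M\<lparr>mcarrier := X\<rparr>) lam)" for lam
  proof -
    have "\<exists>b. finite b \<and> mwtsp V (M\<lparr>mcarrier := Z\<rparr>) lam = MM.span b" if "Z \<in> F" for Z
    proof -
      have "fin_dim_sub (mscale M) (mwtsp V (M\<lparr>mcarrier := Z\<rparr>) lam)"
        using S(2)[of Z] F that unfolding grading_restricted_def by auto
      then show ?thesis unfolding fin_dim_sub_def by metis
    qed
    then obtain b where b: "\<And>Z. Z \<in> F \<Longrightarrow> finite (b Z) \<and> mwtsp V (M\<lparr>mcarrier := Z\<rparr>) lam = MM.span (b Z)"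
      by metis
    have "EF lam \<subseteq> MM.span (\<Union>Z\<in>F. b Z)"
      unfolding EF_def
    proof (rule MM.span_minimal[OF _ MM.subspace_span])
      show "(\<Union>Z\<in>F. mwtsp V (M\<lparr>mcarrier := Z\<rparr>) lam) \<subseteq> MM.span (\<Union>Z\<in>F. b Z)"
        using b MM.span_mono[of "b _" "\<Union>Z\<in>F. b Z"] by blast
    qed
    then have "mwtsp V (M\<lparr>mcarrier := X\<rparr>) lam \<subseteq> MM.span (\<Union>Z\<in>F. b Z)" using sub_EF by blast
    moreover have "MM.subspace (mwtsp V (M\<lparr>mcarrier := X\<rparr>) lam)"
      unfolding mwtsp_def using X.Y_lin_right[OF omg_in] Xs(1)
      by (simp add: MM.subspace_eigenspace)
    moreover have "finite (\<Union>Z\<in>F. b Z)" using F b by auto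
    ultimately show ?thesis
      by (intro fin_dim_sub_subspace[OF MM.vector_space_axioms, of "\<Union>Z\<in>F. b Z"]) auto
  qed
  moreover have "\<exists>N. \<forall>n::int. n < N \<longrightarrow> mwtsp V (M\<lparr>mcarrier := X\<rparr>) (lam + of_int n) = {0}" for lam
  proof -
    have "\<exists>N. \<forall>n::int. n < N \<longrightarrow> mwtsp V (M\<lparr>mcarrier := Z\<rparr>) (lam + of_int n) = {0}" if "Z \<in> F" for Z
      using S(2)[of Z] F that unfolding grading_restricted_def by auto
    then obtain N where N: "\<And>Z n. Z \<in> F \<Longrightarrow> n < N Z \<Longrightarrow> mwtsp V (M\<lparr>mcarrier := Z\<rparr>) (lam + of_int n) = {0}"
      by metis
    \<comment> \<open>\<open>insert 0\<close> keeps the minimum meaningful when \<open>F\<close> is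
      empty.\<close>
    have "mwtsp V (M\<lparr>mcarrier := X\<rparr>) (lam + of_int n) = {0}" if n: "n < Min (insert 0 (N ` F))" for n
    proof -
      have "n < N Z" if "Z \<in> F" for Z
        using n F that by (auto simp: Min_gr_iff)
      then have "(\<Union>Z\<in>F. mwtsp V (M\<lparr>mcarrier := Z\<rparr>) (lam + of_int n)) \<subseteq> {0}" using N by blast
      then have "EF (lam + of_int n) \<subseteq> {0}"
        unfolding EF_def by (intro MM.span_minimal) auto
      moreover have "0 \<in> mwtsp V (M\<lparr>mcarrier := X\<rparr>) (lam + of_int n)"
        unfolding mw using MM.subspace_0[OF Xs(1)] by (simp add: Y_right_0)
      ultimately show ?thesis using sub_EF by blast
    qed
    then show ?thesis by blast
  qed
  ultimately show ?thesis unfolding grading_restricted_def by simp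
qed

theorem decomposition_from_fixed_points:
  assumes rat: "rational TYPE('w) U" and gr: "N_gradable V M"
  shows "\<exists>S. internal_dsum (mscale M) W id S \<and>
    (\<forall>X\<in>S. submodule V M X \<and> irreducible V (M\<lparr>mcarrier := X\<rparr>) \<and> grading_restricted V (M\<lparr>mcarrier := X\<rparr>))"
proof -
  \<comment> \<open>The same space \<open>W\<close> carries two sets of operators: complements are
    obtained for \<open>UO\<close> and transferred to \<open>VO\<close>.\<close>
  interpret VO: operator_space "mscale M" W "{Y u n |u n. u \<in> A}"
    by (intro operator_space_modes) blast
  interpret UO: operator_space "mscale M" W "{Y u n |u n. u \<in> vcarrier U}"
    using U_subset by (intro operator_space_modes) blast
  have VO: "VO.invariant Z \<longleftrightarrow> submodule V M Z" for Z
    unfolding VO.invariant_def submodule_def by auto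
  have UO: "UO.invariant Z \<longleftrightarrow> submodule U M Z" for Z
    unfolding UO.invariant_def submodule_def by auto
  obtain SU where SU: "internal_dsum (mscale M) W id SU"
    "\<And>X. X \<in> SU \<Longrightarrow> submodule U M X" "\<And>X. X \<in> SU \<Longrightarrow> irreducible U (M\<lparr>mcarrier := X\<rparr>)"
    "\<And>X. X \<in> SU \<Longrightarrow> grading_restricted U (M\<lparr>mcarrier := X\<rparr>)"
    using rat weak_module_U N_gradable_U[OF gr] unfolding rational_def by blast
  have spanSU: "MM.span (\<Union>SU) = W" using SU(1) unfolding internal_dsum_def by simp
  have minU: "UO.minimal X" if "X \<in> SU" for X
    using SU(2,3)[OF that] unfolding UO.minimal_def UO irreducible_def submodule_def by auto
  have "VO.complemented N" if N: "VO.invariant N" for N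
  proof -
    have N': "submodule V M N" using N VO by simp
    have "submodule U M N" using N' U_subset unfolding submodule_def by auto
    then obtain C where C: "submodule U M C" "N \<inter> C = {0}" "UO.ssum N C = W"
      using UO.complemented_if_sum_of_minimals[OF spanSU minU] unfolding UO.complemented_def UO by blast
    have "\<exists>x\<in>N. \<exists>c\<in>C. w = x + c" if "w \<in> W" for w
      using that C(3) unfolding UO.ssum_def by blast
    then obtain D where D: "submodule V M D" "N \<inter> D = {0}" "\<forall>w\<in>W. \<exists>x\<in>N. \<exists>d\<in>D. w = x + d"
      using complement_from_fixed_points[OF N' C(1,2)] by blast
    have "VO.ssum N D = W"
    proof
      show "VO.ssum N D \<subseteq> W"
        using VO.invariant_ssum[OF N, of D] D(1) VO unfolding VO.invariant_def by blast
      show "W \<subseteq> VO.ssum N D" using D(3) unfolding VO.ssum_def by blast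
    qed
    then show ?thesis unfolding VO.complemented_def VO using D by blast
  qed
  then obtain S where S: "internal_dsum (mscale M) W id S" "\<And>X. X \<in> S \<Longrightarrow> VO.minimal X"
    using VO.direct_sum_of_minimals by blast
  have "submodule V M X \<and> irreducible V (M\<lparr>mcarrier := X\<rparr>)" if "X \<in> S" for X
    using S(2)[OF that] irreducible_submodule_iff[of X] unfolding VO.minimal_def VO by blast
  moreover from this have "grading_restricted V (M\<lparr>mcarrier := X\<rparr>)" if "X \<in> S" for X
    using grading_restricted_irreducible[OF spanSU SU(2) SU(4)[unfolded grading_restricted_U]] that by blast
  ultimately show ?thesis using S(1) by blast
qed

end

theorem rational_from_fixed_points:
  fixes V :: "'v::ab_group_add voa"
  assumes "voa V" "simple V" "finite_aut_group V G" "rational TYPE('w::ab_group_add) (fixed_sub V G)"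
  shows "rational TYPE('w) V"
  unfolding rational_def
proof (intro allI impI)
  fix M :: "('v, 'w) vmod"
  assume M: "weak_module V M \<and> N_gradable V M"
  then interpret voa_group_module V M G using assms by unfold_locales auto
  show "\<exists>S. internal_dsum (mscale M) (mcarrier M) id S \<and>
    (\<forall>X\<in>S. submodule V M X \<and> irreducible V (M\<lparr>mcarrier := X\<rparr>) \<and> grading_restricted V (M\<lparr>mcarrier := X\<rparr>))"
    using decomposition_from_fixed_points[OF assms(4)] M by blast
qed

section \<open>The grading\<close>

locale voa_algebra =
  fixes V :: "'v::ab_group_add voa"
  assumes is_voa: "voa V"
begin

lemma adjoint_simps: "mmode (adjoint V) = vmode V" "mcarrier (adjoint V) = vcarrier V"
    "mscale (adjoint V) = vscale V"
  unfolding adjoint_def by simp_all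

end

sublocale voa_algebra \<subseteq> weak_voa_module V "adjoint V"
  rewrites "mmode (adjoint V) = vmode V" and "mcarrier (adjoint V) = vcarrier V"
    and "mscale (adjoint V) = vscale V"
proof -
  have "weak_module V (adjoint V)" using is_voa unfolding voa_def Let_def by blast
  then show "weak_voa_module V (adjoint V)" using is_voa by unfold_locales
qed (rule adjoint_simps)+

context voa_algebra
begin

lemma creation:
  assumes "u \<in> A"
  shows "n \<ge> 0 \<Longrightarrow> vmode V u n (vac V) = 0" "vmode V u (-1) (vac V) = u"
  using is_voa assms unfolding voa_def Let_def by blast+

lemma derivative:
  "u \<in> A \<Longrightarrow> w \<in> A \<Longrightarrow> vmode V (Lop V (-1) u) n w = vscale V (- of_int n) (vmode V u (n - 1) w)"
  using is_voa unfolding voa_def Let_def by blast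

lemma span_wtsp: "VV.span (\<Union>k. wtsp V k) = A"
  using is_voa unfolding voa_def Let_def by blast

lemma Lop_in [simp]: "u \<in> A \<Longrightarrow> Lop V n u \<in> A"
  unfolding Lop_def by simp

lemma Lop_lin: "lin_on (vscale V) (vscale V) A (Lop V n)"
  unfolding Lop_def by (rule Y_lin_right) simp

lemma wtsp_subspace: "VV.subspace (wtsp V k)"
  unfolding wtsp_def by (rule VV.subspace_eigenspace[OF A_subspace Lop_lin])

lemma wtsp_in: "u \<in> wtsp V k \<Longrightarrow> u \<in> A"
  unfolding wtsp_def by simp

lemma Lop_0_wtsp: "u \<in> wtsp V k \<Longrightarrow> Lop V 0 u = vscale V (of_int k) u"
  unfolding wtsp_def by simp

text \<open>In the commutator formula for \<open>omg V\<close> at mode 1 only the terms with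
  \<open>L(-1) u\<close> and \<open>L(0) u\<close> remain, giving
  \<open>[L(0), u_n] = (k - n - 1) u_n\<close>.\<close>

lemma mode_wtsp:
  assumes u: "u \<in> wtsp V k" and v: "v \<in> wtsp V l"
  shows "vmode V u n v \<in> wtsp V (k + l - n - 1)"
proof -
  have uA: "u \<in> A" and vA: "v \<in> A" using u v wtsp_in by auto
  obtain K where K: "\<forall>i\<ge>K. vmode V (omg V) (0 + int i) u = 0" using V_trunc_nat uA omg_in by blast
  \<comment> \<open>The increment makes sure that the indices 0 and 1 are in range.\<close>
  let ?K = "Suc (Suc K)"
  have "vmode V (omg V) 1 (vmode V u n v) - vmode V u n (vmode V (omg V) 1 v)
    = (\<Sum>i<?K. vscale V ((of_int 1 :: complex) gchoose i) (vmode V (vmode V (omg V) (int i) u) (1 + n - int i) v))"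
    using K uA vA by (intro commutator) auto
  also have "\<dots> = (\<Sum>i\<in>{0, 1}. vscale V ((of_int 1 :: complex) gchoose i) (vmode V (vmode V (omg V) (int i) u) (1 + n - int i) v))"
  proof (rule sum.mono_neutral_right)
    show "\<forall>i\<in>{..<?K} - {0, 1}. vscale V ((of_int 1 :: complex) gchoose i)
        (vmode V (vmode V (omg V) (int i) u) (1 + n - int i) v) = 0"
      using gchoose_nat_eq_0[of 1] by auto
  qed auto
  also have "\<dots> = vmode V (Lop V (-1) u) (1 + n) v + vmode V (Lop V 0 u) n v"
    by (simp add: Lop_def)
  also have "\<dots> = vscale V (- of_int (n + 1)) (vmode V u n v) + vscale V (of_int k) (vmode V u n v)"
    using uA vA u by (simp add: derivative Lop_0_wtsp Y_left_scale)
  finally have "Lop V 0 (vmode V u n v) - vmode V u n (Lop V 0 v)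
      = vscale V (of_int k - of_int (n + 1)) (vmode V u n v)"
    unfolding Lop_def by (simp add: VV.scale_left_diff_distrib VV.scale_left_distrib)
  moreover have "vmode V u n (Lop V 0 v) = vscale V (of_int l) (vmode V u n v)"
    using uA vA v by (simp add: Lop_0_wtsp Y_right_scale)
  ultimately have "Lop V 0 (vmode V u n v)
    = vscale V (of_int k - of_int (n + 1)) (vmode V u n v) + vscale V (of_int l) (vmode V u n v)"
    by (simp add: diff_eq_eq)
  also have "\<dots> = vscale V (of_int (k + l - n - 1)) (vmode V u n v)"
  proof -
    have "of_int k - of_int (n + 1) + of_int l = (of_int (k + l - n - 1) :: complex)" by simp
    then show ?thesis by (simp only: VV.scale_left_distrib[symmetric])
  qed
  finally show ?thesis unfolding wtsp_def using uA vA by simp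
qed

lemma wtsp_decomp:
  assumes "u \<in> A"
  shows "\<exists>J z. finite J \<and> (\<forall>k\<in>J. z k \<in> wtsp V k) \<and> u = (\<Sum>k\<in>J. z k)"
proof -
  have "u \<in> VV.span (\<Union>k\<in>UNIV. wtsp V k)" using assms span_wtsp by simp
  from VV.span_UN_decomp[OF this wtsp_subspace] show ?thesis by blast
qed

lemma wtsp_of_span:
  assumes E: "\<And>k. VV.subspace (E k)" "\<And>k. E k \<subseteq> wtsp V k"
    and x: "x \<in> VV.span (\<Union>k. E k)" "x \<in> wtsp V k"
  shows "x \<in> E k"
proof (rule VV.eigenspace_of_span[OF A_subspace Lop_lin[of 0], of "of_int :: int \<Rightarrow> complex" UNIV E])
  show "E i \<subseteq> {w \<in> A. Lop V 0 w = vscale V (of_int i) w}" for i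
    using E(2)[of i] unfolding wtsp_def .
qed (use E x in \<open>auto simp: inj_on_def wtsp_in Lop_0_wtsp\<close>)

definition C2set :: "'v set"
  where "C2set = {vmode V u (-2) v |u v. u \<in> A \<and> v \<in> A}"

lemma C2set_subset: "C2set \<subseteq> A"
  unfolding C2set_def by auto

text \<open>By the derivative property \<open>(L(-1) u)_(-2-j)\<close> is \<open>2 + j\<close> times
  \<open>u_(-3-j)\<close>, a nonzero multiple, so induction on \<open>j\<close> reaches all lower
  modes.\<close>

lemma mode_in_C2:
  assumes "u \<in> A" "v \<in> A" "n \<le> -2"
  shows "vmode V u n v \<in> VV.span C2set"
proof -
  have "\<forall>u\<in>A. vmode V u (- 2 - int j) v \<in> VV.span C2set" for j
  proof (induction j)
    case 0
    then show ?case using assms(2) unfolding C2set_def by (auto intro: VV.span_base)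
  next
    case (Suc j)
    show ?case
    proof
      fix u assume u: "u \<in> A"
      have "vmode V (Lop V (-1) u) (- 2 - int j) v \<in> VV.span C2set" using Suc u by simp
      then have "vscale V (- of_int (- 2 - int j)) (vmode V u (- 2 - int j - 1) v) \<in> VV.span C2set"
        using u assms(2) by (simp only: derivative)
      then have "vscale V (inverse (- of_int (- 2 - int j)))
          (vscale V (- of_int (- 2 - int j)) (vmode V u (- 2 - int j - 1) v)) \<in> VV.span C2set"
        by (rule VV.span_scale)
      moreover have nz: "(- of_int (- 2 - int j) :: complex) \<noteq> 0"
        unfolding neg_equal_0_iff_equal of_int_eq_0_iff by simp
      moreover have "- 2 - int (Suc j) = - 2 - int j - 1" by simp
      ultimately show "vmode V u (- 2 - int (Suc j)) v \<in> VV.span C2set"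
        by (simp only: VV.scale_scale left_inverse[OF nz] VV.scale_one)
    qed
  qed
  from this[of "nat (- 2 - n)"] show ?thesis using assms by simp
qed

end

section \<open>\<open>C\<^sub>2\<close>-cofiniteness of finitely generated extensions\<close>

text \<open>The argument concerns any subalgebra with the same conformal vector and no negative
  weights. The latter makes total weights natural numbers, on which induction is possible.\<close>

locale sub_voa = voa_algebra V for V :: "'v::ab_group_add voa" +
  fixes U :: "'v voa"
  assumes voaU: "voa U" and U_scale [simp]: "vscale U = vscale V" and U_mode [simp]: "vmode U = vmode V"
    and U_omg [simp]: "omg U = omg V" and U_sub: "vcarrier U \<subseteq> vcarrier V"
    and nonneg: "\<And>k. k < 0 \<Longrightarrow> wtsp U k = {0}"
begin

sublocale UU: voa_algebra U
  rewrites "vscale U = vscale V" and "vmode U = vmode V" and "omg U = omg V"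
  using voaU by unfold_locales simp_all

abbreviation "AU \<equiv> vcarrier U"

lemma AU_in: "u \<in> AU \<Longrightarrow> u \<in> A"
  using U_sub by blast

lemma wtsp_U_in: "u \<in> wtsp U k \<Longrightarrow> u \<in> A"
  using UU.wtsp_in AU_in by blast

text \<open>A triple \<open>(u, k, n)\<close> stands for the mode \<open>u\<^sub>n\<close> of a vector \<open>u\<close> of weight \<open>k\<close>.\<close>

definition str :: "('v \<times> nat \<times> int) list \<Rightarrow> 'v \<Rightarrow> 'v"
  where "str xs y = foldr (\<lambda>(u, k, n) x. vmode V u n x) xs y"

definition valid :: "('v \<times> nat \<times> int) list \<Rightarrow> bool"
  where "valid xs \<longleftrightarrow> (\<forall>(u, k, n)\<in>set xs. u \<in> wtsp U (int k))"

text \<open>The modes are deliberately left out: this is a filtration degree, not the degree of the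
  operator. A commutator term \<open>u_i v\<close> with \<open>i >= 0\<close> has weight
  \<open>k + l - i - 1\<close>, below \<open>k + l\<close>, whatever the modes are.\<close>

definition wt :: "('v \<times> nat \<times> int) list \<Rightarrow> nat"
  where "wt xs = (\<Sum>(u, k, n)\<leftarrow>xs. k)"

lemma str_simps [simp]: "str [] y = y" "str ((u, k, n) # xs) y = vmode V u n (str xs y)"
    "str (xs @ ys) y = str xs (str ys y)"
  unfolding str_def by auto

lemma valid_simps [simp]: "valid []" "valid ((u, k, n) # xs) \<longleftrightarrow> u \<in> wtsp U (int k) \<and> valid xs"
    "valid (xs @ ys) \<longleftrightarrow> valid xs \<and> valid ys"
  unfolding valid_def by (simp_all add: ball_Un)

lemma wt_simps [simp]: "wt [] = 0" "wt ((u, k, n) # xs) = k + wt xs" "wt (xs @ ys) = wt xs + wt ys"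
  unfolding wt_def by auto

lemma str_in [simp]: "valid xs \<Longrightarrow> y \<in> A \<Longrightarrow> str xs y \<in> A"
  by (induction xs) (auto simp: wtsp_U_in)

lemma str_lin: "valid xs \<Longrightarrow> lin_on (vscale V) (vscale V) A (str xs)"
proof (induction xs)
  case Nil
  then show ?case unfolding lin_on_def by simp
next
  case (Cons a xs)
  obtain u k n where a: "a = (u, k, n)" by (cases a)
  then show ?case
    using Cons Y_lin_right[of u n] unfolding lin_on_def by (auto simp: wtsp_U_in)
qed

lemmas str_0 = VV.lin_on_0[OF A_subspace str_lin VV.vector_space_axioms]
  and str_add = VV.lin_on_add[OF A_subspace str_lin VV.vector_space_axioms]
  and str_scale = VV.lin_on_scale[OF A_subspace str_lin VV.vector_space_axioms]
  and str_diff = VV.lin_on_diff[OF A_subspace str_lin VV.vector_space_axioms]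
  and str_sum = VV.lin_on_sum[OF A_subspace str_lin VV.vector_space_axioms]

text \<open>Modulo strings of smaller total weight, modes commute and modes of \<open>C\<^sub>2(U)\<close> vanish.\<close>

context
  fixes T :: "'v set" and y :: 'v and s :: nat
  assumes T: "VV.subspace T" and y: "y \<in> A"
    and low: "\<And>xs. valid xs \<Longrightarrow> wt xs < s \<Longrightarrow> str xs y \<in> T"
begin

text \<open>Commutator terms can have a negative weight \<open>j\<close>; such vectors are 0 by
  \<open>nonneg\<close>. Otherwise \<open>nat j\<close> completes a genuine string.\<close>

lemma low_term:
  assumes "valid xs" "valid ys" "u \<in> wtsp U j" "int (wt xs + wt ys) + j < int s"
  shows "str xs (vmode V u q (str ys y)) \<in> T"
proof (cases "j < 0")
  case True
  then have "u = 0" using assms nonneg by blast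
  then show ?thesis using assms y T by (simp add: Y_left_0 str_0 VV.subspace_0)
next
  case False
  then show ?thesis using low[of "xs @ (u, nat j, q) # ys"] assms by simp
qed

lemma str_swap:
  assumes v: "valid (xs @ a # b # ys)" and w: "wt (xs @ a # b # ys) = s"
  shows "str (xs @ a # b # ys) y - str (xs @ b # a # ys) y \<in> T"
proof -
  obtain u k m where a: "a = (u, k, m)" by (cases a)
  obtain v l n where b: "b = (v, l, n)" by (cases b)
  have ul: "u \<in> wtsp U (int k)" "v \<in> wtsp U (int l)" "valid xs" "valid ys" using assms a b by auto
  then have uA: "u \<in> A" "v \<in> A" using wtsp_U_in by auto
  let ?z = "str ys y"
  have z: "?z \<in> A" using ul y by simp
  obtain K where K: "\<forall>i\<ge>K. vmode V u (0 + int i) v = 0" using V_trunc_nat uA by blast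
  have "str (xs @ a # b # ys) y - str (xs @ b # a # ys) y
    = str xs (vmode V u m (vmode V v n ?z) - vmode V v n (vmode V u m ?z))"
    using a b ul uA z by (simp add: str_diff)
  also have "\<dots> = str xs (\<Sum>i<K. vscale V ((of_int m :: complex) gchoose i)
      (vmode V (vmode V u (int i) v) (m + n - int i) ?z))"
    using K uA z by (subst commutator[of u v ?z K]) auto
  also have "\<dots> = (\<Sum>i<K. vscale V ((of_int m :: complex) gchoose i)
      (str xs (vmode V (vmode V u (int i) v) (m + n - int i) ?z)))"
    using ul uA z A_subspace by (simp add: str_sum str_scale VV.subspace_scale)
  also have "\<dots> \<in> T"
  proof (intro VV.subspace_sum[OF T] VV.subspace_scale[OF T] low_term ul)
    fix i
    show "vmode V u (int i) v \<in> wtsp U (int k + int l - int i - 1)"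
      using UU.mode_wtsp[OF ul(1,2)] .
    show "int (wt xs + wt ys) + (int k + int l - int i - 1) < int s"
      using w a b by simp
  qed
  finally show ?thesis .
qed

lemma str_move:
  assumes "valid (ps @ a # xs @ ys)" "wt (ps @ a # xs @ ys) = s"
  shows "str (ps @ a # xs @ ys) y - str (ps @ xs @ a # ys) y \<in> T"
  using assms
proof (induction xs arbitrary: ps)
  case Nil
  then show ?case using T by (simp add: VV.subspace_0)
next
  case (Cons b xs)
  have 1: "str (ps @ a # b # xs @ ys) y - str (ps @ b # a # xs @ ys) y \<in> T"
    using str_swap[of ps a b "xs @ ys"] Cons.prems by simp
  have "valid ((ps @ [b]) @ a # xs @ ys)" "wt ((ps @ [b]) @ a # xs @ ys) = s"
    using Cons.prems by (cases a; cases b; simp)+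
  from Cons.IH[OF this]
  have 2: "str (ps @ b # a # xs @ ys) y - str (ps @ b # xs @ a # ys) y \<in> T" by simp
  show ?case using VV.subspace_add[OF T 1 2] by simp
qed

lemma str_perm:
  assumes "valid (ps @ xs)" "wt (ps @ xs) = s" "mset xs = mset ys"
  shows "str (ps @ xs) y - str (ps @ ys) y \<in> T"
  using assms
proof (induction xs arbitrary: ps ys)
  case Nil
  then have "ys = []" by simp
  then show ?case using T by (simp add: VV.subspace_0)
next
  case (Cons a xs)
  then have "a \<in> set ys" by (metis list.set_intros(1) set_mset_mset)
  then obtain ys1 ys2 where ys: "ys = ys1 @ a # ys2" by (meson split_list)
  have xs: "mset xs = mset (ys1 @ ys2)" using Cons.prems(3) ys by simp
  have set_eq: "set xs = set (ys1 @ ys2)" using xs by (metis set_mset_mset)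
  have wt_eq: "wt xs = wt (ys1 @ ys2)"
    unfolding wt_def using xs by (metis mset_map sum_mset_sum_list)
  have "valid ((ps @ [a]) @ xs)" "wt ((ps @ [a]) @ xs) = s"
    using Cons.prems by simp_all
  from Cons.IH[OF this xs]
  have 1: "str (ps @ a # xs) y - str (ps @ a # ys1 @ ys2) y \<in> T" by simp
  have "valid (ps @ a # ys1 @ ys2)"
    using Cons.prems(1) set_eq unfolding valid_def by auto
  moreover have "wt (ps @ a # ys1 @ ys2) = s"
    using Cons.prems(2) wt_eq by (cases a) simp
  ultimately have 2: "str (ps @ a # ys1 @ ys2) y - str (ps @ ys1 @ a # ys2) y \<in> T"
    by (rule str_move)
  show ?case using VV.subspace_add[OF T 1 2] ys by simp
qed

lemma str_perm_mem:
  assumes "valid xs" "wt xs = s" "mset xs = mset ys" "str ys y \<in> T"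
  shows "str xs y \<in> T"
  using str_perm[where ps = "[]" and xs = xs and ys = ys] assms VV.subspace_add[OF T, of "str xs y - str ys y" "str ys y"] by simp

text \<open>The iterate formula expands \<open>(a_(-2) c)_n\<close> into products of one mode of
  \<open>a\<close> and one of \<open>c\<close>. Their total weight is \<open>p + q\<close>, one less
  than the weight of \<open>a_(-2) c\<close>.\<close>

lemma str_C2_term:
  assumes "valid xs" "valid ys" "a \<in> wtsp U p" "c \<in> wtsp U q"
    and w: "int (wt xs + wt ys) + p + q < int s"
  shows "str xs (vmode V (vmode V a (-2) c) n (str ys y)) \<in> T"
proof (cases "p < 0 \<or> q < 0")
  case True
  then have "a = 0 \<or> c = 0" using assms nonneg by blast
  moreover have "a \<in> A" "c \<in> A" using assms wtsp_U_in by auto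
  ultimately have "vmode V a (-2) c = 0" by (auto simp: Y_left_0 Y_right_0)
  then show ?thesis using assms y T by (simp add: Y_left_0 str_0 VV.subspace_0)
next
  case False
  have less: "wt xs + (nat p + (nat q + wt ys)) < s" "wt xs + (nat q + (nat p + wt ys)) < s"
    using False w by linarith+
  have ac: "a \<in> A" "c \<in> A" using assms wtsp_U_in by auto
  let ?z = "str ys y"
  have z: "?z \<in> A" using assms y by simp
  obtain K1 K2 where K: "\<forall>i\<ge>K1. vmode V c (n + int i) ?z = 0" "\<forall>i\<ge>K2. vmode V a (0 + int i) ?z = 0"
    using Y_trunc_nat ac z by metis
  have "str xs (vmode V (vmode V a (-2) c) n ?z)
    = str xs (\<Sum>i<max K1 K2. vscale V ((-1) ^ i * ((of_int (-2) :: complex) gchoose i))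
        (vmode V a (-2 - int i) (vmode V c (n + int i) ?z)
          - vscale V ((-1) powi (-2)) (vmode V c (-2 + n - int i) (vmode V a (int i) ?z))))"
    using K ac z by (subst iterate[where K = "max K1 K2"]) auto
  also have "\<dots> = (\<Sum>i<max K1 K2. vscale V ((-1) ^ i * ((of_int (-2) :: complex) gchoose i))
        (str xs (vmode V a (-2 - int i) (vmode V c (n + int i) ?z))
          - vscale V ((-1) powi (-2)) (str xs (vmode V c (-2 + n - int i) (vmode V a (int i) ?z)))))"
    using assms ac z A_subspace
    by (simp add: str_sum str_scale str_diff VV.subspace_scale VV.subspace_diff)
  also have "\<dots> \<in> T"
  proof (intro VV.subspace_sum[OF T] VV.subspace_scale[OF T] VV.subspace_diff[OF T])
    fix i
    show "str xs (vmode V a (-2 - int i) (vmode V c (n + int i) ?z)) \<in> T"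
      using low[of "xs @ (a, nat p, -2 - int i) # (c, nat q, n + int i) # ys"] False assms less by simp
    show "str xs (vmode V c (-2 + n - int i) (vmode V a (int i) ?z)) \<in> T"
      using low[of "xs @ (c, nat q, -2 + n - int i) # (a, nat p, int i) # ys"] False assms less by simp
  qed
  finally show ?thesis .
qed

end

section \<open>Rewriting strings into a bounded window of modes\<close>

definition hom_C2 :: "int \<Rightarrow> 'v set"
  where "hom_C2 k = {vmode V a (-2) c |a c p q. a \<in> wtsp U p \<and> c \<in> wtsp U q \<and> p + q + 1 = k}"

definition sq :: "('v \<times> nat \<times> int) list \<Rightarrow> int"
  where "sq xs = (\<Sum>(u, k, n)\<leftarrow>xs. n\<^sup>2)"

text \<open>For suitable \<open>t\<close>, a mode at or above \<open>t\<close> moved to the right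
  end annihilates the starting vector, and a mode at or below -2 moved to the left end produces an
  element of the span of \<open>C2set\<close>. The \<open>t + 1\<close> modes in between need a
  separate treatment.\<close>

definition in_window :: "int \<Rightarrow> ('v \<times> nat \<times> int) list \<Rightarrow> bool"
  where "in_window t xs \<longleftrightarrow> (\<forall>(u, k, n)\<in>set xs. -1 \<le> n \<and> n < t)"

definition over :: "('v \<times> nat) set \<Rightarrow> ('v \<times> nat \<times> int) list \<Rightarrow> bool"
  where "over BB xs \<longleftrightarrow> (\<forall>(u, k, n)\<in>set xs. (u, k) \<in> BB)"

lemma sq_simps [simp]: "sq [] = 0" "sq ((u, k, n) # xs) = n\<^sup>2 + sq xs" "sq (xs @ ys) = sq xs + sq ys"
  unfolding sq_def by auto

lemma over_simps [simp]: "over BB []" "over BB ((u, k, n) # xs) \<longleftrightarrow> (u, k) \<in> BB \<and> over BB xs"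
    "over BB (xs @ ys) \<longleftrightarrow> over BB xs \<and> over BB ys"
  unfolding over_def by (simp_all add: ball_Un)

lemma sq_le:
  assumes "in_window t xs" "t \<ge> 0"
  shows "sq xs \<le> int (length xs) * (t + 1)\<^sup>2"
  using assms(1)
proof (induction xs)
  case (Cons a xs)
  obtain u k n where a: "a = (u, k, n)" by (cases a)
  have "\<bar>n\<bar> \<le> t + 1" using Cons.prems a assms(2) unfolding in_window_def by auto
  then have "n\<^sup>2 \<le> (t + 1)\<^sup>2" using abs_le_square_iff[of n "t + 1"] assms(2) by simp
  moreover have "sq xs \<le> int (length xs) * (t + 1)\<^sup>2"
    using Cons unfolding in_window_def by simp
  ultimately show ?case using a by (simp add: algebra_simps)
qed simp

text \<open>Pigeonhole: the window contains \<open>t + 1\<close> modes.\<close>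

lemma repeated_mode:
  assumes "in_window t xs" "t \<ge> 0" "length xs > nat (t + 1)"
  shows "\<exists>ps u k n qs v l rs. xs = ps @ (u, k, n) # qs @ (v, l, n) # rs"
proof -
  let ?f = "\<lambda>(u, k, n). n"
  have "set (map ?f xs) \<subseteq> {-1..<t}" using assms(1) unfolding in_window_def by auto
  then have "card (set (map ?f xs)) \<le> nat (t + 1)"
    using card_mono[of "{-1..<t}" "set (map ?f xs)"] by simp
  then have "\<not> distinct (map ?f xs)" using assms(3) distinct_card[of "map ?f xs"] by auto
  then obtain as bs cs n where "map ?f xs = as @ [n] @ bs @ [n] @ cs"
    using not_distinct_decomp by blast
  then obtain ps e1 qs e2 rs where "xs = ps @ e1 # qs @ e2 # rs" "?f e1 = n" "?f e2 = n"
    by (auto simp: map_eq_append_conv map_eq_Cons_conv append_eq_map_conv Cons_eq_map_conv)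
  then show ?thesis by (cases e1; cases e2) (simp, blast)
qed

text \<open>One stage of a nested induction, on the total weight \<open>s\<close> and within it on
  the number \<open>r\<close> of factors. \<open>low\<close> and \<open>short\<close> are the two
  induction hypotheses; \<open>base\<close> covers the strings that will be put into the spanning
  set by hand.\<close>

context
  fixes T :: "'v set" and y :: 'v and s r :: nat and BB :: "('v \<times> nat) set" and t :: int
  assumes T: "VV.subspace T" and y: "y \<in> A" and C2: "C2set \<subseteq> T"
    and low: "\<And>xs. valid xs \<Longrightarrow> wt xs < s \<Longrightarrow> str xs y \<in> T"
    and BB: "\<And>b k. (b, k) \<in> BB \<Longrightarrow> b \<in> wtsp U (int k)"
    and t: "t \<ge> 0" "\<And>b k n. (b, k) \<in> BB \<Longrightarrow> n \<ge> t \<Longrightarrow> vmode V b n y = 0"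
    and base: "\<And>xs. over BB xs \<Longrightarrow> in_window t xs \<Longrightarrow> length xs \<le> nat (t + 1) \<Longrightarrow> str xs y \<in> T"
    and short: "\<And>xs. valid xs \<Longrightarrow> wt xs = s \<Longrightarrow> length xs < r \<Longrightarrow> str xs y \<in> T"
begin

lemma over_valid: "over BB xs \<Longrightarrow> valid xs"
  unfolding over_def valid_def using BB by auto

lemma outside_window:
  assumes xs: "over BB xs" "wt xs = s" "\<not> in_window t xs"
  shows "str xs y \<in> T"
proof -
  obtain b k n where b: "(b, k, n) \<in> set xs" "n \<ge> t \<or> n \<le> -2"
    using xs(3) unfolding in_window_def by force
  then obtain ps qs where ps: "xs = ps @ (b, k, n) # qs" by (meson split_list)
  have v: "valid xs" "valid (ps @ qs)" "(b, k) \<in> BB"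
    using over_valid[of xs] over_valid[of "ps @ qs"] xs(1) ps by auto
  have bA: "b \<in> A" using BB v wtsp_U_in by blast
  show ?thesis
  proof (cases "n \<ge> t")
    case True
    have "str (ps @ qs @ [(b, k, n)]) y = 0"
      using t(2)[OF v(3) True] v(2) by (simp add: str_0)
    then have "str (ps @ qs @ [(b, k, n)]) y \<in> T" using T by (simp add: VV.subspace_0)
    then show ?thesis
      by (rule str_perm_mem[OF T y low v(1) xs(2), rotated -1]) (simp_all add: ps)
  next
    case False
    have "str ((b, k, n) # ps @ qs) y \<in> VV.span C2set"
      using mode_in_C2[OF bA, of "str (ps @ qs) y" n] False b v(2) y by simp
    then have "str ((b, k, n) # ps @ qs) y \<in> T"
      using C2 T VV.span_minimal by blast
    then show ?thesis
      by (rule str_perm_mem[OF T y low v(1) xs(2), rotated -1]) (simp_all add: ps)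
  qed
qed

text \<open>Two equal modes \<open>a\<^sub>n b\<^sub>n\<close> are one term of the expansion of \<open>(a\<^sub>-\<^sub>1b)\<^sub>2\<^sub>n\<^sub>+\<^sub>1\<close>; in the other terms
  \<open>a\<^sub>p b\<^sub>q\<close> with \<open>p + q = 2n\<close> the sum of the squared modes has increased.\<close>
lemma spread:
  assumes ab: "(a, k) \<in> BB" "(b, l) \<in> BB" and zs: "over BB zs"
    and w: "k + l + wt zs = s" and len: "Suc (Suc (length zs)) = r"
    and more: "\<And>xs. over BB xs \<Longrightarrow> wt xs = s \<Longrightarrow> length xs = r \<Longrightarrow> sq xs > 2 * n\<^sup>2 + sq zs \<Longrightarrow> str xs y \<in> T"
    and n: "n \<ge> -1"
  shows "str ((a, k, n) # (b, l, n) # zs) y \<in> T"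
proof -
  let ?z = "str zs y"
  have abU: "a \<in> wtsp U (int k)" "b \<in> wtsp U (int l)" using ab BB by auto
  have abA: "a \<in> A" "b \<in> A" using abU wtsp_U_in by auto
  have z: "valid zs" "?z \<in> A" using over_valid[OF zs] y by auto
  have other: "vmode V a p (vmode V b (2 * n - p) ?z) \<in> T" "vmode V b (2 * n - p) (vmode V a p ?z) \<in> T"
    if "p \<noteq> n" for p
  proof -
    have "2 * n\<^sup>2 < p\<^sup>2 + (2 * n - p)\<^sup>2"
    proof -
      have "p\<^sup>2 + (2 * n - p)\<^sup>2 = 2 * n\<^sup>2 + 2 * (p - n)\<^sup>2" by (simp add: power2_eq_square algebra_simps)
      moreover have "(p - n)\<^sup>2 > 0" using that by simp
      ultimately show ?thesis by linarith
    qed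
    then show "vmode V a p (vmode V b (2 * n - p) ?z) \<in> T" "vmode V b (2 * n - p) (vmode V a p ?z) \<in> T"
      using more[of "(a, k, p) # (b, l, 2 * n - p) # zs"] more[of "(b, l, 2 * n - p) # (a, k, p) # zs"]
        ab zs w len by auto
  qed
  obtain K1 K2 where K: "\<forall>i\<ge>K1. vmode V b (2 * n + 1 + int i) ?z = 0" "\<forall>i\<ge>K2. vmode V a (0 + int i) ?z = 0"
    using Y_trunc_nat abA z by metis
  \<comment> \<open>\<open>nat n\<close> is included so that the wanted term, of index
    \<open>i0\<close>, occurs in the sum.\<close>
  define K where "K = Suc (max (nat n) (max K1 K2))"
  define f where "f i = vmode V a (-1 - int i) (vmode V b (2 * n + 1 + int i) ?z)" for i
  define g where "g i = vmode V b (2 * n - int i) (vmode V a (int i) ?z)" for i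
  have "vmode V (vmode V a (-1) b) (2 * n + 1) ?z
    = (\<Sum>i<K. vscale V ((-1) ^ i * ((of_int (-1) :: complex) gchoose i))
        (f i - vscale V ((-1) powi (-1)) (g i)))"
    unfolding f_def g_def using K abA z
    by (subst iterate[where K = K]) (auto simp: K_def algebra_simps)
  \<comment> \<open>The binomial coefficient of -1 at \<open>i\<close> is \<open>(-1)^i\<close>, so
    all coefficients become 1; likewise \<open>(-1) powi (-1) = -1\<close> turns the difference into
    a sum.\<close>
  also have "\<dots> = (\<Sum>i<K. f i + g i)"
    by (intro sum.cong) (auto simp: gbinomial_minus gbinomial_of_nat_symmetric power_mult_distrib[symmetric]
        simp flip: binomial_gbinomial)
  finally have sum_eq: "vmode V (vmode V a (-1) b) (2 * n + 1) ?z = (\<Sum>i<K. f i + g i)" .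
  have "vmode V a (-1) b \<in> wtsp U (int (k + l))"
    using UU.mode_wtsp[OF abU, of "-1"] by simp
  \<comment> \<open>Replacing the pair by \<open>a_(-1) b\<close> keeps the weight and removes one
    factor.\<close>
  then have "str ((vmode V a (-1) b, k + l, 2 * n + 1) # zs) y \<in> T"
    using z w len by (intro short) auto
  then have total: "(\<Sum>i<K. f i + g i) \<in> T" using sum_eq by simp
  have f_mem: "f i \<in> T" if "-1 - int i \<noteq> n" for i
    using other(1)[OF that] unfolding f_def by (simp add: algebra_simps)
  have g_mem: "g i \<in> T" if "int i \<noteq> n" for i
    using other(2)[OF that] unfolding g_def by simp
  \<comment> \<open>The pair of equal modes is \<open>f 0\<close> if \<open>n = -1\<close> and
    \<open>g n\<close> up to order if \<open>n >= 0\<close>; \<open>nat n\<close> is the right index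
    in both cases.\<close>
  define i0 where "i0 = nat n"
  have i0: "i0 < K" unfolding i0_def K_def by simp
  have "(\<Sum>i\<in>{..<K} - {i0}. f i + g i) \<in> T"
  proof (intro VV.subspace_sum[OF T] VV.subspace_add[OF T] f_mem g_mem)
    fix i assume "i \<in> {..<K} - {i0}"
    then show "-1 - int i \<noteq> n" "int i \<noteq> n" using n unfolding i0_def by auto
  qed
  moreover have "(\<Sum>i<K. f i + g i) = (f i0 + g i0) + (\<Sum>i\<in>{..<K} - {i0}. f i + g i)"
    using i0 by (intro sum.remove) auto
  ultimately have fg: "f i0 + g i0 \<in> T"
    using VV.subspace_diff[OF T total, of "\<Sum>i\<in>{..<K} - {i0}. f i + g i"] by simp
  show ?thesis
  proof (cases "n = -1")
    case True
    then have "g i0 \<in> T" by (intro g_mem) simp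
    then have "f i0 \<in> T" using VV.subspace_diff[OF T fg, of "g i0"] by simp
    then show ?thesis unfolding f_def i0_def using True by simp
  next
    case False
    then have "f i0 \<in> T" using n by (intro f_mem) simp
    then have "g i0 \<in> T" using VV.subspace_diff[OF T fg, of "f i0"] by simp
    then have "str ((b, l, n) # (a, k, n) # zs) y \<in> T"
      unfolding g_def i0_def using False n by simp
    then show ?thesis
      by (rule str_perm_mem[OF T y low _ _ _, rotated -1]) (use abU z w in auto)
  qed
qed

text \<open>Within the window \<open>sq\<close> is at most \<open>r (t + 1)^2\<close> on strings of
  length \<open>r\<close>, while \<open>spread\<close> only calls for strings with larger
  \<open>sq\<close>; so the rewriting terminates.\<close>

lemma over_mem:
  assumes "over BB xs" "wt xs = s" "length xs = r"
  shows "str xs y \<in> T"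
  using assms
proof (induction "nat (int r * (t + 1)\<^sup>2 - sq xs)" arbitrary: xs rule: less_induct)
  case less
  consider "\<not> in_window t xs" | "in_window t xs" "r \<le> nat (t + 1)" | "in_window t xs" "r > nat (t + 1)"
    by linarith
  then show ?case
  proof cases
    case 1
    then show ?thesis using outside_window less.prems by blast
  next
    case 2
    then show ?thesis using base less.prems by blast
  next
    case 3
    obtain ps u k n qs v l rs where xs: "xs = ps @ (u, k, n) # qs @ (v, l, n) # rs"
      using repeated_mode[OF 3(1) t(1)] 3(2) less.prems(3) by blast
    let ?zs = "ps @ qs @ rs"
    have "str ((u, k, n) # (v, l, n) # ?zs) y \<in> T"
    proof (rule spread)
      show "(u, k) \<in> BB" "(v, l) \<in> BB" "over BB ?zs" "k + l + wt ?zs = s" "Suc (Suc (length ?zs)) = r"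
        using less.prems xs by auto
      show "n \<ge> -1" using 3(1) xs unfolding in_window_def by auto
      fix xs' assume xs': "over BB xs'" "wt xs' = s" "length xs' = r" "sq xs' > 2 * n\<^sup>2 + sq ?zs"
      show "str xs' y \<in> T"
      proof (cases "in_window t xs'")
        case True
        have "sq xs' \<le> int r * (t + 1)\<^sup>2" using sq_le[OF True t(1)] xs'(3) by simp
        moreover have "sq xs < sq xs'" using xs'(4) xs by simp
        ultimately show ?thesis using xs' by (intro less.hyps) auto
      next
        case False
        then show ?thesis using outside_window xs' by blast
      qed
    qed
    then show ?thesis
      by (rule str_perm_mem[OF T y low _ less.prems(2), rotated -1])
        (use over_valid[OF less.prems(1)] in \<open>auto simp: xs\<close>)
  qed
qed

text \<open>Vectors are replaced from the left by generators in \<open>BB\<close>, with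
  \<open>ps\<close> the part already done. The remainders from \<open>hom_C2\<close> are absorbed by
  \<open>str_C2_term\<close>.\<close>

lemma valid_mem:
  assumes gen: "\<And>k. wtsp U (int k) \<subseteq> VV.span ({b. (b, k) \<in> BB} \<union> hom_C2 (int k))"
    and xs: "valid xs" "wt xs = s" "length xs = r"
  shows "str xs y \<in> T"
proof -
  have "str (ps @ xs) y \<in> T" if "over BB ps" "valid xs" "wt (ps @ xs) = s" "length (ps @ xs) = r" for ps xs
    using that
  proof (induction xs arbitrary: ps)
    case Nil
    then show ?case using over_mem by simp
  next
    case (Cons a xs)
    obtain u k n where a: "a = (u, k, n)" by (cases a)
    have ps: "valid ps" using Cons.prems(1) over_valid by blast
    have xsv: "valid xs" using Cons.prems(2) a by simp
    let ?P = "{u \<in> A. str ps (vmode V u n (str xs y)) \<in> T}"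
    have z: "str xs y \<in> A" using xsv y by simp
    have "VV.subspace ?P"
      unfolding VV.subspace_def using A_subspace T z ps
      by (auto simp: Y_left_0 Y_left_add Y_left_scale str_0 str_add str_scale
          VV.subspace_0 VV.subspace_add VV.subspace_scale)
    moreover have "{b. (b, k) \<in> BB} \<subseteq> ?P"
    proof
      fix b assume "b \<in> {b. (b, k) \<in> BB}"
      then have b: "(b, k) \<in> BB" by simp
      have "str ((ps @ [(b, k, n)]) @ xs) y \<in> T"
        using Cons.prems a b xsv by (intro Cons.IH) auto
      then show "b \<in> ?P" using BB[OF b] wtsp_U_in by auto
    qed
    moreover have "hom_C2 (int k) \<subseteq> ?P"
    proof
      fix x assume "x \<in> hom_C2 (int k)"
      then obtain c d p q where x: "x = vmode V c (-2) d" "c \<in> wtsp U p" "d \<in> wtsp U q" "p + q + 1 = int k"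
        unfolding hom_C2_def by blast
      have "int (wt ps + wt xs) + p + q < int s" using x(4) Cons.prems(3) a by auto
      then show "x \<in> ?P"
        using str_C2_term[OF T y low ps xsv x(2,3)] x wtsp_U_in by auto
    qed
    ultimately have "VV.span ({b. (b, k) \<in> BB} \<union> hom_C2 (int k)) \<subseteq> ?P"
      by (intro VV.span_minimal) auto
    then have "u \<in> ?P" using gen[of k] Cons.prems(2) a by auto
    then show ?case using a by simp
  qed
  from this[of "[]" xs] show ?thesis using xs by simp
qed

end

text \<open>As \<open>BB\<close> is finite, one truncation bound \<open>t\<close> serves all
  generators acting on \<open>y\<close>. Then only finitely many strings over \<open>BB\<close> lie
  in the window with at most \<open>t + 1\<close> factors, and these form \<open>F\<close>; any
  longer one repeats a mode.\<close>

lemma strings_span: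
  assumes BB: "finite BB" "\<And>b k. (b, k) \<in> BB \<Longrightarrow> b \<in> wtsp U (int k)"
    and gen: "\<And>k. wtsp U (int k) \<subseteq> VV.span ({b. (b, k) \<in> BB} \<union> hom_C2 (int k))"
    and y: "y \<in> A"
  shows "\<exists>F. finite F \<and> F \<subseteq> A \<and> (\<forall>xs. valid xs \<longrightarrow> str xs y \<in> VV.span (F \<union> C2set))"
proof -
  have ex: "\<exists>N\<ge>0. \<forall>n\<ge>N. vmode V b n y = 0" if bk: "(b, k) \<in> BB" for b k
  proof -
    obtain N where "\<forall>n\<ge>N. vmode V b n y = 0" using V_trunc[OF wtsp_U_in[OF BB(2)[OF bk]] y] by blast
    then show ?thesis by (intro exI[of _ "max 0 N"]) auto
  qed
  define N where "N = (\<lambda>bk :: 'v \<times> nat. SOME N. N \<ge> 0 \<and> (\<forall>n\<ge>N. vmode V (fst bk) n y = 0))"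
  have N: "N (b, k) \<ge> 0 \<and> (\<forall>n\<ge>N (b, k). vmode V b n y = 0)" if "(b, k) \<in> BB" for b k
    unfolding N_def fst_conv using someI_ex[OF ex[OF that]] .
  define t where "t = Max (insert 0 (N ` BB))"
  have t: "t \<ge> 0" "\<And>b k n. (b, k) \<in> BB \<Longrightarrow> n \<ge> t \<Longrightarrow> vmode V b n y = 0"
  proof -
    show "t \<ge> 0" unfolding t_def using BB(1) by simp
    fix b k n assume bk: "(b, k) \<in> BB" "n \<ge> t"
    have "N (b, k) \<le> t" unfolding t_def using BB(1) bk by (intro Max_ge) auto
    then show "vmode V b n y = 0" using N[OF bk(1)] bk(2) by auto
  qed
  define X where "X = {xs. over BB xs \<and> in_window t xs \<and> length xs \<le> nat (t + 1)}"
  define F where "F = (\<lambda>xs. str xs y) ` X"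
  have "X \<subseteq> {xs. set xs \<subseteq> (\<lambda>((b, k), n). (b, k, n)) ` (BB \<times> {-1..<t}) \<and> length xs \<le> nat (t + 1)}"
    unfolding X_def over_def in_window_def by (force simp: image_iff)
  then have "finite F"
    unfolding F_def using BB(1)
    by (intro finite_imageI) (erule finite_subset, intro finite_lists_length_le, simp)
  moreover have "F \<subseteq> A"
  proof -
    have "valid xs" if "xs \<in> X" for xs
      using that BB(2) unfolding X_def over_def valid_def by auto
    then show ?thesis unfolding F_def using y by auto
  qed
  moreover have "str xs y \<in> VV.span (F \<union> C2set)" if "valid xs" for xs
  proof -
    have "\<forall>xs. valid xs \<longrightarrow> wt xs = s \<longrightarrow> str xs y \<in> VV.span (F \<union> C2set)" for s
    proof (induction s rule: less_induct)
      case (less s)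
      have low: "str xs y \<in> VV.span (F \<union> C2set)" if "valid xs" "wt xs < s" for xs
        using less that by blast
      have "\<forall>xs. valid xs \<longrightarrow> wt xs = s \<longrightarrow> length xs = r \<longrightarrow> str xs y \<in> VV.span (F \<union> C2set)" for r
      proof (induction r rule: less_induct)
        case (less r)
        show ?case
        proof (intro allI impI)
          fix xs assume xs: "valid xs" "wt xs = s" "length xs = r"
          show "str xs y \<in> VV.span (F \<union> C2set)"
          proof (rule valid_mem[where BB = BB and t = t and s = s and r = r])
            show "VV.subspace (VV.span (F \<union> C2set))" by simp
            show "C2set \<subseteq> VV.span (F \<union> C2set)" by (auto intro: VV.span_base)
            show "str xs y \<in> VV.span (F \<union> C2set)"
              if "over BB xs" "in_window t xs" "length xs \<le> nat (t + 1)" for xs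
              using that unfolding F_def X_def by (auto intro!: VV.span_base)
            show "str xs y \<in> VV.span (F \<union> C2set)" if "valid xs" "wt xs = s" "length xs < r" for xs
              using less that by blast
          qed (use y low BB(2) t gen xs in auto)
        qed
      qed
      then show ?case by blast
    qed
    then show ?thesis using that by blast
  qed
  ultimately show ?thesis by blast
qed

text \<open>The given finite set is replaced by the homogeneous components of its elements. The
  products \<open>a_(-2) c\<close> also split into homogeneous ones, so the spanning property can be
  read off in each weight by \<open>wtsp_of_span\<close>.\<close>

lemma homogeneous_generators:
  assumes "C2_cofinite U"
  shows "\<exists>BB. finite BB \<and> (\<forall>(b, k)\<in>BB. b \<in> wtsp U (int k)) \<and>
    (\<forall>k. wtsp U (int k) \<subseteq> VV.span ({b. (b, k) \<in> BB} \<union> hom_C2 (int k)))"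
proof -
  obtain B where B: "finite B" "B \<subseteq> AU" "VV.span (B \<union> UU.C2set) = AU"
    using assms unfolding C2_cofinite_def UU.C2set_def by auto
  have "\<exists>z. \<exists>J. finite J \<and> (\<forall>k\<in>J. z k \<in> wtsp U k) \<and> b = (\<Sum>k\<in>J. z k)" if "b \<in> B" for b
    using UU.wtsp_decomp[of b] that B(2) by blast
  then obtain z J where zJ: "\<And>b. b \<in> B \<Longrightarrow> finite (J b) \<and> (\<forall>k\<in>J b. z b k \<in> wtsp U k) \<and> b = (\<Sum>k\<in>J b. z b k)"
    by metis
  define BB where "BB = (\<Union>b\<in>B. (\<lambda>k. (z b k, nat k)) ` {k \<in> J b. k \<ge> 0})"
  have fin: "finite BB" unfolding BB_def using B(1) zJ by auto
  have BB: "b \<in> wtsp U (int k)" if "(b, k) \<in> BB" for b k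
    using that zJ unfolding BB_def by auto
  define E where "E k = VV.span ({b. k \<ge> 0 \<and> (b, nat k) \<in> BB} \<union> hom_C2 k)" for k
  have E_sub: "E k \<subseteq> wtsp U k" for k
    unfolding E_def
  proof (rule VV.span_minimal)
    have "vmode V a (-2) c \<in> wtsp U (p + q + 1)" if "a \<in> wtsp U p" "c \<in> wtsp U q" for a c p q
      using UU.mode_wtsp[OF that, of "-2"] by (simp add: ac_simps)
    then have "hom_C2 k \<subseteq> wtsp U k" unfolding hom_C2_def by blast
    moreover have "b \<in> wtsp U k" if "k \<ge> 0" "(b, nat k) \<in> BB" for b
      using BB[OF that(2)] that(1) by simp
    ultimately show "{b. k \<ge> 0 \<and> (b, nat k) \<in> BB} \<union> hom_C2 k \<subseteq> wtsp U k" by blast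
  qed (use UU.wtsp_subspace in auto)
  have B_E: "b \<in> VV.span (\<Union>k. E k)" if b: "b \<in> B" for b
  proof -
    have "z b k \<in> VV.span (\<Union>k. E k)" if k: "k \<in> J b" for k
    proof (cases "k \<ge> 0")
      case True
      then have "(z b k, nat k) \<in> BB" using b k unfolding BB_def by auto
      then have "z b k \<in> E k" unfolding E_def using True by (auto intro: VV.span_base)
      then show ?thesis by (auto intro: VV.span_base)
    next
      case False
      then have "z b k = 0" using zJ[OF b] k nonneg[of k] by auto
      then show ?thesis by (simp add: VV.span_zero)
    qed
    then show ?thesis using zJ[OF b] by (metis VV.span_sum)
  qed
  have C_E: "vmode V a (-2) c \<in> VV.span (\<Union>k. E k)" if a: "a \<in> AU" and c: "c \<in> AU" for a c
  proof -
    obtain Ja za where ja: "finite Ja" "\<forall>k\<in>Ja. za k \<in> wtsp U k" "a = (\<Sum>k\<in>Ja. za k)"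
      using UU.wtsp_decomp[OF a] by blast
    obtain Jc zc where jc: "finite Jc" "\<forall>k\<in>Jc. zc k \<in> wtsp U k" "c = (\<Sum>k\<in>Jc. zc k)"
      using UU.wtsp_decomp[OF c] by blast
    have "vmode V a (-2) c = (\<Sum>p\<in>Ja. \<Sum>q\<in>Jc. vmode V (za p) (-2) (zc q))"
    proof -
      have za: "za p \<in> A" if "p \<in> Ja" for p using ja(2) that wtsp_U_in by blast
      have zc: "zc q \<in> A" if "q \<in> Jc" for q using jc(2) that wtsp_U_in by blast
      have "vmode V a (-2) c = (\<Sum>p\<in>Ja. vmode V (za p) (-2) c)"
        unfolding ja(3) using za AU_in[OF c] by (intro Y_left_sum) auto
      also have "\<dots> = (\<Sum>p\<in>Ja. \<Sum>q\<in>Jc. vmode V (za p) (-2) (zc q))"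
        unfolding jc(3) using za zc by (intro sum.cong refl Y_right_sum) auto
      finally show ?thesis .
    qed
    also have "\<dots> \<in> VV.span (\<Union>k. E k)"
    proof (intro VV.span_sum)
      fix p q assume "p \<in> Ja" "q \<in> Jc"
      then have "vmode V (za p) (-2) (zc q) \<in> hom_C2 (p + q + 1)"
        unfolding hom_C2_def using ja(2) jc(2) by blast
      then have "vmode V (za p) (-2) (zc q) \<in> E (p + q + 1)"
        unfolding E_def by (auto intro: VV.span_base)
      then show "vmode V (za p) (-2) (zc q) \<in> VV.span (\<Union>k. E k)" by (auto intro: VV.span_base)
    qed
    finally show ?thesis .
  qed
  have all: "AU \<subseteq> VV.span (\<Union>k. E k)"
    unfolding B(3)[symmetric]
    by (rule VV.span_minimal) (use B_E C_E in \<open>auto simp: UU.C2set_def\<close>)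
  have "wtsp U (int k) \<subseteq> VV.span ({b. (b, k) \<in> BB} \<union> hom_C2 (int k))" for k
  proof
    fix x assume x: "x \<in> wtsp U (int k)"
    have "x \<in> E (int k)"
    proof (rule UU.wtsp_of_span[OF _ E_sub _ x])
      show "VV.subspace (E k)" for k unfolding E_def by simp
      show "x \<in> VV.span (\<Union>k. E k)" using x UU.wtsp_in all by blast
    qed
    then show "x \<in> VV.span ({b. (b, k) \<in> BB} \<union> hom_C2 (int k))" unfolding E_def by simp
  qed
  then show ?thesis using fin BB by blast
qed

text \<open>Hypothesis \<open>gen\<close> says that \<open>Y0\<close> generates \<open>V\<close> as
  a \<open>U\<close>-module. The span of all strings on \<open>Y0\<close> is
  \<open>U\<close>-stable, hence everything, and each of the finitely many starting vectors
  contributes a finite set modulo \<open>C2set\<close>.\<close>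

theorem C2_cofinite_extension:
  assumes C2: "C2_cofinite U" and Y0: "finite Y0" "Y0 \<subseteq> A"
    and gen: "\<And>S. VV.subspace S \<Longrightarrow> S \<subseteq> A \<Longrightarrow> (\<forall>u\<in>AU. \<forall>n. \<forall>w\<in>S. vmode V u n w \<in> S) \<Longrightarrow> Y0 \<subseteq> S \<Longrightarrow> S = A"
  shows "C2_cofinite V"
proof -
  obtain BB where BB: "finite BB" "\<And>b k. (b, k) \<in> BB \<Longrightarrow> b \<in> wtsp U (int k)"
    "\<And>k. wtsp U (int k) \<subseteq> VV.span ({b. (b, k) \<in> BB} \<union> hom_C2 (int k))"
    using homogeneous_generators[OF C2] by blast
  obtain F where F: "\<And>y. y \<in> Y0 \<Longrightarrow> finite (F y) \<and> F y \<subseteq> A \<and>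
      (\<forall>xs. valid xs \<longrightarrow> str xs y \<in> VV.span (F y \<union> C2set))"
    using strings_span[OF BB] Y0(2) by (metis subsetD)
  define S where "S = VV.span {str xs y |xs y. valid xs \<and> y \<in> Y0}"
  have S_sub: "S \<subseteq> A"
    unfolding S_def using A_subspace Y0(2) by (intro VV.span_minimal) auto
  have "S = A"
  proof (rule gen[OF _ S_sub])
    show "VV.subspace S" unfolding S_def by simp
    show "Y0 \<subseteq> S"
    proof
      fix y assume "y \<in> Y0"
      then have "str [] y \<in> S"
        unfolding S_def by (intro VV.span_base CollectI exI[of _ "[]"] exI[of _ y]) auto
      then show "y \<in> S" by simp
    qed
    show "\<forall>u\<in>AU. \<forall>n. \<forall>w\<in>S. vmode V u n w \<in> S"
    proof (intro ballI allI)
      fix u n w assume u: "u \<in> AU" and w: "w \<in> S"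
      have hom: "vmode V x n (str xs y) \<in> S" if "x \<in> wtsp U k" "valid xs" "y \<in> Y0" for x k xs y
      proof (cases "k < 0")
        case True
        then have "x = 0" using nonneg that by blast
        moreover have "str xs y \<in> A" using that Y0 by auto
        ultimately show ?thesis unfolding S_def by (simp add: Y_left_0 VV.span_zero)
      next
        case False
        then have "str ((x, nat k, n) # xs) y \<in> S"
          unfolding S_def using that
          by (intro VV.span_base CollectI exI[of _ "(x, nat k, n) # xs"] exI[of _ y]) auto
        then show ?thesis by simp
      qed
      obtain J z where J: "finite J" "\<forall>k\<in>J. z k \<in> wtsp U k" "u = (\<Sum>k\<in>J. z k)"
        using UU.wtsp_decomp[OF u] by blast
      have S1: "vmode V u n (str xs y) \<in> S" if "valid xs" "y \<in> Y0" for xs y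
      proof -
        have "str xs y \<in> A" using that Y0 by auto
        then have "vmode V u n (str xs y) = (\<Sum>k\<in>J. vmode V (z k) n (str xs y))"
          unfolding J(3) using J(2) wtsp_U_in by (intro Y_left_sum) auto
        also have "\<dots> \<in> S"
          unfolding S_def using hom that J(2) unfolding S_def by (intro VV.span_sum) blast
        finally show ?thesis .
      qed
      have uA: "u \<in> A" using u AU_in by blast
      have "VV.subspace {w \<in> A. vmode V u n w \<in> S}"
        unfolding VV.subspace_def S_def using A_subspace uA
        by (auto simp: Y_right_0 Y_right_add Y_right_scale VV.subspace_0 VV.subspace_add
            VV.subspace_scale VV.span_zero VV.span_add VV.span_scale)
      then have "S \<subseteq> {w \<in> A. vmode V u n w \<in> S}"
        using S1 Y0(2) by (subst S_def) (intro VV.span_minimal, auto)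
      then show "vmode V u n w \<in> S" using w by blast
    qed
  qed
  define F' where "F' = (\<Union>y\<in>Y0. F y)"
  have F': "finite F'" "F' \<subseteq> A" unfolding F'_def using F Y0 by auto
  have "A \<subseteq> VV.span (F' \<union> C2set)"
    unfolding \<open>S = A\<close>[symmetric] S_def
  proof (rule VV.span_minimal)
    show "{str xs y |xs y. valid xs \<and> y \<in> Y0} \<subseteq> VV.span (F' \<union> C2set)"
    proof clarify
      fix xs y assume "valid xs" "y \<in> Y0"
      then have "str xs y \<in> VV.span (F y \<union> C2set)" using F by blast
      moreover have "F y \<union> C2set \<subseteq> F' \<union> C2set" using \<open>y \<in> Y0\<close> unfolding F'_def by blast
      ultimately show "str xs y \<in> VV.span (F' \<union> C2set)" using VV.span_mono by blast
    qed
  qed simp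
  moreover have "VV.span (F' \<union> C2set) \<subseteq> A"
    using F' C2set_subset A_subspace by (intro VV.span_minimal) auto
  ultimately show ?thesis
    unfolding C2_cofinite_def C2set_def[symmetric] using F' by blast
qed

end

section \<open>The contragredient module\<close>

text \<open>Exponents in the Leibniz rule for \<open>L(1)^c / c!\<close> on \<open>u_n w\<close>:
  \<open>a\<close> falls on \<open>u\<close>, \<open>b\<close> on \<open>w\<close>, and
  \<open>d\<close> raises the mode.\<close>

definition triples :: "nat \<Rightarrow> (nat \<times> nat \<times> nat) set"
  where "triples c = {(a, b, d). a + b + d = c}"

lemma finite_triples [simp]: "finite (triples c)"
  by (rule finite_subset[of _ "{..c} \<times> {..c} \<times> {..c}"]) (auto simp: triples_def)

lemma sum_triples_shift:
  fixes h :: "nat \<Rightarrow> nat \<Rightarrow> nat \<Rightarrow> 'a::comm_monoid_add"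
  shows "(\<Sum>(a, b, d)\<in>triples c. h (Suc a) b d) = (\<Sum>(a, b, d)\<in>triples (Suc c). if a = 0 then 0 else h a b d)"
    and "(\<Sum>(a, b, d)\<in>triples c. h a (Suc b) d) = (\<Sum>(a, b, d)\<in>triples (Suc c). if b = 0 then 0 else h a b d)"
    and "(\<Sum>(a, b, d)\<in>triples c. h a b (Suc d)) = (\<Sum>(a, b, d)\<in>triples (Suc c). if d = 0 then 0 else h a b d)"
proof -
  have *: "(\<Sum>(a, b, d)\<in>triples (Suc c). if a = 0 then 0 else h a b d)
      = (\<Sum>(a, b, d)\<in>{(a, b, d). a + b + d = Suc c \<and> a \<noteq> 0}. h a b d)"
    "(\<Sum>(a, b, d)\<in>triples (Suc c). if b = 0 then 0 else h a b d)
      = (\<Sum>(a, b, d)\<in>{(a, b, d). a + b + d = Suc c \<and> b \<noteq> 0}. h a b d)"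
    "(\<Sum>(a, b, d)\<in>triples (Suc c). if d = 0 then 0 else h a b d)
      = (\<Sum>(a, b, d)\<in>{(a, b, d). a + b + d = Suc c \<and> d \<noteq> 0}. h a b d)"
    by ((rule sum.mono_neutral_cong_right[OF finite_triples], auto simp: triples_def split: if_splits)[])+
  show "(\<Sum>(a, b, d)\<in>triples c. h (Suc a) b d) = (\<Sum>(a, b, d)\<in>triples (Suc c). if a = 0 then 0 else h a b d)"
    unfolding * by (rule sum.reindex_bij_witness[of _ "\<lambda>(a, b, d). (a - 1, b, d)" "\<lambda>(a, b, d). (Suc a, b, d)"])
      (auto simp: triples_def)
  show "(\<Sum>(a, b, d)\<in>triples c. h a (Suc b) d) = (\<Sum>(a, b, d)\<in>triples (Suc c). if b = 0 then 0 else h a b d)"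
    unfolding * by (rule sum.reindex_bij_witness[of _ "\<lambda>(a, b, d). (a, b - 1, d)" "\<lambda>(a, b, d). (a, Suc b, d)"])
      (auto simp: triples_def)
  show "(\<Sum>(a, b, d)\<in>triples c. h a b (Suc d)) = (\<Sum>(a, b, d)\<in>triples (Suc c). if d = 0 then 0 else h a b d)"
    unfolding * by (rule sum.reindex_bij_witness[of _ "\<lambda>(a, b, d). (a, b, d - 1)" "\<lambda>(a, b, d). (a, b, Suc d)"])
      (auto simp: triples_def)
qed

text \<open>Summing over all orders \<open>c\<close> decouples the three exponents; every triple in
  the box has \<open>a + b + d < m1 + m2 + m3\<close>.\<close>

lemma sum_triples_box:
  fixes h :: "nat \<Rightarrow> nat \<Rightarrow> nat \<Rightarrow> 'a::comm_monoid_add"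
  assumes "\<And>a b d. a \<ge> m1 \<or> b \<ge> m2 \<or> d \<ge> m3 \<Longrightarrow> h a b d = 0"
  shows "(\<Sum>c<m1 + m2 + m3. \<Sum>(a, b, d)\<in>triples c. h a b d) = (\<Sum>a<m1. \<Sum>b<m2. \<Sum>d<m3. h a b d)"
proof -
  have "(\<Sum>c<m1 + m2 + m3. \<Sum>(a, b, d)\<in>triples c. h a b d)
      = (\<Sum>(a, b, d)\<in>(\<Union>c\<in>{..<m1 + m2 + m3}. triples c). h a b d)"
    by (rule sum.UNION_disjoint[symmetric]) (simp_all, auto simp: triples_def)
  also have "\<dots> = (\<Sum>(a, b, d)\<in>{..<m1} \<times> {..<m2} \<times> {..<m3}. h a b d)"
  proof (rule sum.mono_neutral_right)
    show "\<forall>i\<in>(\<Union>c\<in>{..<m1 + m2 + m3}. triples c) - {..<m1} \<times> {..<m2} \<times> {..<m3}.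
        (case i of (a, b, d) \<Rightarrow> h a b d) = 0"
    proof
      fix i assume i: "i \<in> (\<Union>c\<in>{..<m1 + m2 + m3}. triples c) - {..<m1} \<times> {..<m2} \<times> {..<m3}"
      obtain a b d where abd: "i = (a, b, d)" by (cases i)
      then have "a \<ge> m1 \<or> b \<ge> m2 \<or> d \<ge> m3" using i by auto
      then show "(case i of (a, b, d) \<Rightarrow> h a b d) = 0" using assms abd by simp
    qed
  qed (simp_all, auto simp: triples_def)
  also have "\<dots> = (\<Sum>a<m1. \<Sum>b<m2. \<Sum>d<m3. h a b d)"
    by (simp add: sum.cartesian_product)
  finally show ?thesis .
qed

context voa_algebra
begin

lemma virasoro: "\<exists>c. \<forall>m n w. w \<in> A \<longrightarrow> Lop V m (Lop V n w) - Lop V n (Lop V m w)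
        = vscale V (of_int (m - n)) (Lop V (m + n) w)
          + vscale V ((of_int (m ^ 3 - m) / 12) * (if m + n = 0 then 1 else 0) * c) w"
  using is_voa unfolding voa_def Let_def by auto

lemma Lop_vac: "n \<ge> -1 \<Longrightarrow> Lop V n (vac V) = 0"
  unfolding Lop_def by (simp add: creation)

lemma vac_nonzero:
  assumes "simple V"
  shows "vac V \<noteq> 0"
proof
  assume 0: "vac V = 0"
  have "u = 0" if "u \<in> A" for u
    using creation(2)[OF that] 0 Y_right_0[OF that] by simp
  then have "A = {0}" using A_subspace VV.subspace_0 by auto
  then show False using assms unfolding simple_def irreducible_def by (simp add: adjoint_simps)
qed

lemma omg_eq: "omg V = Lop V (-2) (vac V)"
  unfolding Lop_def by (simp add: creation)

lemma Lop_0: "Lop V n 0 = 0"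
  unfolding Lop_def by (simp add: Y_right_0)

text \<open>With \<open>omg = L(-2) vac\<close>, the relation \<open>[L(0), L(-2)] = 2 L(-2)\<close>
  has no central term, and \<open>L(0)\<close> annihilates the vacuum.\<close>

lemma omg_wtsp: "omg V \<in> wtsp V 2"
proof -
  obtain c where "Lop V 0 (Lop V (-2) (vac V)) - Lop V (-2) (Lop V 0 (vac V))
      = vscale V (of_int (0 - (-2))) (Lop V (0 + -2) (vac V))
        + vscale V ((of_int (0 ^ 3 - 0) / 12) * (if 0 + -2 = (0::int) then 1 else 0) * c) (vac V)"
    using virasoro vac_in by blast
  then show ?thesis unfolding wtsp_def by (simp add: Lop_vac Lop_0 flip: omg_eq)
qed

text \<open>\<open>[L(1), L(-2)] = 3 L(-1)\<close>, and both \<open>L(1)\<close> and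
  \<open>L(-1)\<close> annihilate the vacuum.\<close>

lemma Lop_1_omg: "Lop V 1 (omg V) = 0"
proof -
  obtain c where "Lop V 1 (Lop V (-2) (vac V)) - Lop V (-2) (Lop V 1 (vac V))
      = vscale V (of_int (1 - (-2))) (Lop V (1 + -2) (vac V))
        + vscale V ((of_int (1 ^ 3 - 1) / 12) * (if 1 + -2 = (0::int) then 1 else 0) * c) (vac V)"
    using virasoro vac_in by blast
  then show ?thesis by (simp add: Lop_vac Lop_0 flip: omg_eq)
qed

lemma vac_wtsp: "vac V \<in> wtsp V 0"
  unfolding wtsp_def by (simp add: Lop_vac)

lemma Lop_1_wtsp: "u \<in> wtsp V k \<Longrightarrow> Lop V 1 u \<in> wtsp V (k - 1)"
  unfolding Lop_def using mode_wtsp[OF omg_wtsp, of u k 2] by simp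

text \<open>The commutator formula for \<open>omg V\<close> at mode 2: \<open>[L(1), u_n] = (L(-1)
  u)_(n+2) + 2 (L(0) u)_(n+1) + (L(1) u)_n\<close>.\<close>

lemma Lop_1_mode:
  assumes u: "u \<in> wtsp V k" and w: "w \<in> A"
  shows "Lop V 1 (vmode V u n w) = vmode V u n (Lop V 1 w)
    + vscale V (of_int (2 * k - n - 2)) (vmode V u (n + 1) w) + vmode V (Lop V 1 u) n w"
proof -
  have uA: "u \<in> A" using u wtsp_in by auto
  obtain K where K: "\<forall>i\<ge>K. vmode V (omg V) (0 + int i) u = 0" using V_trunc_nat uA omg_in by blast
  let ?K = "Suc (Suc (Suc K))"
  have "vmode V (omg V) 2 (vmode V u n w) - vmode V u n (vmode V (omg V) 2 w)
    = (\<Sum>i<?K. vscale V ((of_int 2 :: complex) gchoose i) (vmode V (vmode V (omg V) (int i) u) (2 + n - int i) w))"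
    using K uA w by (intro commutator) auto
  also have "\<dots> = (\<Sum>i\<in>{0, 1, 2}. vscale V ((of_int 2 :: complex) gchoose i) (vmode V (vmode V (omg V) (int i) u) (2 + n - int i) w))"
  proof (rule sum.mono_neutral_right)
    show "\<forall>i\<in>{..<?K} - {0, 1, 2}. vscale V ((of_int 2 :: complex) gchoose i)
        (vmode V (vmode V (omg V) (int i) u) (2 + n - int i) w) = 0"
      using gchoose_nat_eq_0[of 2] by auto
  qed auto
  also have "\<dots> = vmode V (Lop V (-1) u) (2 + n) w + vscale V 2 (vmode V (Lop V 0 u) (1 + n) w) + vmode V (Lop V 1 u) n w"
    using binomial_gbinomial[of 2 2, where 'a = complex] by (simp add: Lop_def add.assoc)
  also have "\<dots> = vscale V (- of_int (2 + n)) (vmode V u (n + 1) w) + vscale V (2 * of_int k) (vmode V u (n + 1) w)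
      + vmode V (Lop V 1 u) n w"
    using uA w u by (simp add: derivative Lop_0_wtsp Y_left_scale add.commute)
  also have "\<dots> = vscale V (of_int (2 * k - n - 2)) (vmode V u (n + 1) w) + vmode V (Lop V 1 u) n w"
  proof -
    have "- of_int (2 + n) + 2 * of_int k = (of_int (2 * k - n - 2) :: complex)" by simp
    then show ?thesis by (simp only: VV.scale_left_distrib[symmetric])
  qed
  finally show ?thesis unfolding Lop_def by (simp add: diff_eq_eq add_ac)
qed

text \<open>The coefficient of \<open>x^c\<close> in \<open>exp(x L(1))\<close>, the exponential
  from which the contragredient modes are built.\<close>

definition dpow :: "nat \<Rightarrow> 'v \<Rightarrow> 'v"
  where "dpow c u = vscale V (1 / fact c) ((Lop V 1 ^^ c) u)"

lemma Lop_pow_in [simp]: "u \<in> A \<Longrightarrow> (Lop V 1 ^^ c) u \<in> A"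
  by (induction c) auto

lemma Lop_pow_wtsp: "u \<in> wtsp V k \<Longrightarrow> (Lop V 1 ^^ c) u \<in> wtsp V (k - int c)"
proof (induction c)
  case (Suc c)
  then show ?case using Lop_1_wtsp[of "(Lop V 1 ^^ c) u" "k - int c"] by (simp add: algebra_simps)
qed simp

lemma dpow_in [simp]: "u \<in> A \<Longrightarrow> dpow c u \<in> A"
  unfolding dpow_def using A_subspace by (simp add: VV.subspace_scale)

lemma dpow_wtsp: "u \<in> wtsp V k \<Longrightarrow> dpow c u \<in> wtsp V (k - int c)"
  unfolding dpow_def using Lop_pow_wtsp wtsp_subspace by (simp add: VV.subspace_scale)

lemma dpow_0 [simp]: "dpow 0 u = u"
  unfolding dpow_def by simp

lemma Lop_1_dpow: "u \<in> A \<Longrightarrow> Lop V 1 (dpow c u) = vscale V (of_nat (Suc c)) (dpow (Suc c) u)"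
  unfolding dpow_def using VV.lin_on_scale[OF A_subspace Lop_lin[of 1] VV.vector_space_axioms]
  by (simp add: fact_Suc field_simps del: of_nat_Suc)

lemma dpow_lin: "lin_on (vscale V) (vscale V) A (dpow c)"
proof -
  have "(Lop V 1 ^^ c) (vscale V a x + y) = vscale V a ((Lop V 1 ^^ c) x) + (Lop V 1 ^^ c) y"
    if "x \<in> A" "y \<in> A" for a x y
    using that Lop_lin[of 1] unfolding lin_on_def by (induction c) auto
  then show ?thesis
    unfolding lin_on_def dpow_def by (simp add: VV.scale_right_distrib mult.commute)
qed

text \<open>The binomial identity \<open>a C(Q+1,d) + b C(Q,d) + (Q-a-d+1) C(Q,d-1) = (a+b+d) C(Q,d)\<close> with
  \<open>Q = 2k-a-n-2\<close>.\<close>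
lemma dpow_mode:
  assumes u: "u \<in> wtsp V k" and w: "w \<in> A"
  shows "dpow c (vmode V u n w) = (\<Sum>(a, b, d)\<in>triples c.
    vscale V ((of_int (2 * k - int a - n - 2) :: complex) gchoose d)
      (vmode V (dpow a u) (n + int d) (dpow b w)))"
proof (induction c)
  case 0
  have "triples 0 = {(0, 0, 0)}" unfolding triples_def by auto
  then show ?case by (simp add: gbinomial_0)
next
  case (Suc c)
  have uA: "u \<in> A" using u wtsp_in by auto
  define q where "q a = (of_int (2 * k - int a - n - 2) :: complex)" for a
  define X where "X a b d = vmode V (dpow a u) (n + int d) (dpow b w)" for a b d
  have XA: "X a b d \<in> A" for a b d unfolding X_def using uA w by simp
  have L1X: "Lop V 1 (X a b d) = vscale V (of_nat (Suc b)) (X a (Suc b) d)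
      + vscale V (q a - of_nat a - of_nat d) (X a b (Suc d)) + vscale V (of_nat (Suc a)) (X (Suc a) b d)" for a b d
  proof -
    have "2 * (k - int a) - (n + int d) - 2 = (2 * k - int a - n - 2) - int a - int d" by simp
    then have "(of_int (2 * (k - int a) - (n + int d) - 2) :: complex) = q a - of_nat a - of_nat d"
      unfolding q_def by (simp only: of_int_diff of_int_of_nat_eq)
    moreover have e: "n + int (Suc d) = n + int d + 1" by simp
    ultimately show ?thesis
      unfolding X_def e using uA w Lop_1_mode[OF dpow_wtsp[OF u, of a], of "dpow b w" "n + int d"]
      by (simp add: Lop_1_dpow Y_left_scale Y_right_scale algebra_simps del: of_nat_Suc)
  qed
  have "vscale V (of_nat (Suc c)) (dpow (Suc c) (vmode V u n w)) = Lop V 1 (dpow c (vmode V u n w))"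
    using uA w by (simp add: Lop_1_dpow del: of_nat_Suc)
  also have "\<dots> = Lop V 1 (\<Sum>(a, b, d)\<in>triples c. vscale V (q a gchoose d) (X a b d))"
    unfolding Suc q_def X_def ..
  also have "\<dots> = (\<Sum>(a, b, d)\<in>triples c. vscale V (q a gchoose d) (Lop V 1 (X a b d)))"
    using XA A_subspace
    by (subst VV.lin_on_sum[OF A_subspace Lop_lin VV.vector_space_axioms])
      (auto simp: VV.lin_on_scale[OF A_subspace Lop_lin VV.vector_space_axioms] VV.subspace_scale intro!: sum.cong)
  also have "\<dots> = (\<Sum>(a, b, d)\<in>triples c. vscale V ((q a gchoose d) * of_nat (Suc b)) (X a (Suc b) d))
      + (\<Sum>(a, b, d)\<in>triples c. vscale V ((q a gchoose d) * (q a - of_nat a - of_nat d)) (X a b (Suc d)))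
      + (\<Sum>(a, b, d)\<in>triples c. vscale V ((q a gchoose d) * of_nat (Suc a)) (X (Suc a) b d))"
    unfolding L1X by (simp add: VV.scale_right_distrib sum.distrib case_prod_unfold del: of_nat_Suc)
  also have "\<dots> = (\<Sum>(a, b, d)\<in>triples (Suc c). if b = 0 then 0 else vscale V ((q a gchoose d) * of_nat b) (X a b d))
      + (\<Sum>(a, b, d)\<in>triples (Suc c). if d = 0 then 0 else
          vscale V ((q a gchoose (d - 1)) * (q a - of_nat a - of_nat (d - 1))) (X a b d))
      + (\<Sum>(a, b, d)\<in>triples (Suc c). if a = 0 then 0 else vscale V ((q (a - 1) gchoose d) * of_nat a) (X a b d))"
    using sum_triples_shift(2)[of "\<lambda>a b d. vscale V ((q a gchoose d) * of_nat b) (X a b d)" c]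
      sum_triples_shift(3)[of "\<lambda>a b d. vscale V ((q a gchoose (d - 1)) * (q a - of_nat a - of_nat (d - 1))) (X a b d)" c]
      sum_triples_shift(1)[of "\<lambda>a b d. vscale V ((q (a - 1) gchoose d) * of_nat a) (X a b d)" c]
    by simp
  also have "\<dots> = (\<Sum>(a, b, d)\<in>triples (Suc c). vscale V (of_nat (Suc c)) (vscale V (q a gchoose d) (X a b d)))"
    unfolding sum.distrib[symmetric]
  proof (intro sum.cong refl, clarify)
    fix a b d assume "(a, b, d) \<in> triples (Suc c)"
    then have abd: "of_nat (Suc c) = (of_nat a + of_nat b + of_nat d :: complex)"
      unfolding triples_def by (metis (mono_tags, lifting) case_prodD mem_Collect_eq of_nat_add)
    have e1: "(if a = 0 then 0 else (q (a - 1) gchoose d) * of_nat a) = ((q a + 1) gchoose d) * of_nat a"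
    proof (cases a)
      case (Suc a')
      have "q a' = q a + 1" unfolding q_def Suc by simp
      then show ?thesis using Suc by simp
    qed simp
    have e2: "of_nat a * ((q a + 1) gchoose d) + of_nat b * (q a gchoose d)
        + (if d = 0 then 0 else (q a gchoose (d - 1)) * (q a - of_nat a - of_nat (d - 1)))
      = (of_nat a + of_nat b + of_nat d) * (q a gchoose d)"
    proof (cases d)
      case (Suc d')
      have p: "(q a + 1) gchoose Suc d' = (q a gchoose d') + (q a gchoose Suc d')"
        by (rule gbinomial_Suc_Suc)
      have m: "q a * (q a gchoose d') = of_nat d' * (q a gchoose d') + of_nat (Suc d') * (q a gchoose Suc d')"
        by (rule gbinomial_mult_1)
      show ?thesis unfolding Suc p using m by (simp add: algebra_simps del: of_nat_Suc)
    qed (simp add: algebra_simps gbinomial_0)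
    have "(if b = 0 then 0 else vscale V ((q a gchoose d) * of_nat b) (X a b d))
        + (if d = 0 then 0 else vscale V ((q a gchoose (d - 1)) * (q a - of_nat a - of_nat (d - 1))) (X a b d))
        + (if a = 0 then 0 else vscale V ((q (a - 1) gchoose d) * of_nat a) (X a b d))
      = vscale V (of_nat b * (q a gchoose d)
        + (if d = 0 then 0 else (q a gchoose (d - 1)) * (q a - of_nat a - of_nat (d - 1)))
        + (if a = 0 then 0 else (q (a - 1) gchoose d) * of_nat a)) (X a b d)"
      by (auto simp: VV.scale_left_distrib mult.commute)
    also have "\<dots> = vscale V ((of_nat a + of_nat b + of_nat d) * (q a gchoose d)) (X a b d)"
      unfolding e1 e2[symmetric] by (simp add: algebra_simps)
    also have "\<dots> = vscale V (of_nat (Suc c)) (vscale V (q a gchoose d) (X a b d))"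
      unfolding abd by simp
    finally show "(if b = 0 then 0 else vscale V ((q a gchoose d) * of_nat b) (X a b d))
        + (if d = 0 then 0 else vscale V ((q a gchoose (d - 1)) * (q a - of_nat a - of_nat (d - 1))) (X a b d))
        + (if a = 0 then 0 else vscale V ((q (a - 1) gchoose d) * of_nat a) (X a b d))
      = vscale V (of_nat (Suc c)) (vscale V (q a gchoose d) (X a b d))" .
  qed
  also have "\<dots> = vscale V (of_nat (Suc c)) (\<Sum>(a, b, d)\<in>triples (Suc c). vscale V (q a gchoose d) (X a b d))"
    unfolding VV.scale_sum_right by (simp add: case_prod_unfold)
  \<comment> \<open>Applying \<open>L(1)\<close> has produced \<open>c + 1\<close> times the claim;
    the factor is cancelled here.\<close>
  finally have "dpow (Suc c) (vmode V u n w) = (\<Sum>(a, b, d)\<in>triples (Suc c). vscale V (q a gchoose d) (X a b d))"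
    by (rule VV.scale_left_imp_eq[of "of_nat (Suc c)", rotated]) (rule of_nat_neq_0)
  then show ?case unfolding q_def X_def .
qed

end

section \<open>Transposes of the contragredient modes\<close>

locale cft_voa = voa_algebra +
  assumes cft: "cft_type V"
begin

lemma wtsp_neg: "u \<in> wtsp V k \<Longrightarrow> k < 0 \<Longrightarrow> u = 0"
  using cft unfolding cft_type_def by auto

lemma wtsp_0: "u \<in> wtsp V 0 \<Longrightarrow> \<exists>c. u = vscale V c (vac V)"
  using cft unfolding cft_type_def by (auto simp: VV.span_singleton)

lemma dpow_eq_0: "u \<in> wtsp V k \<Longrightarrow> k < int c \<Longrightarrow> dpow c u = 0"
  using dpow_wtsp[of u k c] wtsp_neg by auto

text \<open>\<open>(-1)\<^sup>k dg k u m\<close> is the transpose of the mode \<open>u\<^sub>m\<close> of the contragredient module.\<close>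

definition dg :: "int \<Rightarrow> 'a \<Rightarrow> int \<Rightarrow> 'a \<Rightarrow> 'a"
  where "dg k u m x = (\<Sum>a\<le>nat k. vmode V (dpow a u) (2 * k - int a - m - 2) x)"

text \<open>Divided powers beyond \<open>k\<close> have negative weight and vanish, so the range of
  summation may be enlarged at will.\<close>

lemma dg_eq:
  assumes "u \<in> wtsp V k" "x \<in> A" "K > nat k"
  shows "dg k u m x = (\<Sum>a<K. vmode V (dpow a u) (2 * k - int a - m - 2) x)"
  unfolding dg_def
proof (rule sum.mono_neutral_left)
  show "\<forall>a\<in>{..<K} - {..nat k}. vmode V (dpow a u) (2 * k - int a - m - 2) x = 0"
  proof
    fix a assume "a \<in> {..<K} - {..nat k}"
    then have "k < int a" by auto
    then show "vmode V (dpow a u) (2 * k - int a - m - 2) x = 0"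
      using assms by (simp add: dpow_eq_0 Y_left_0)
  qed
qed (use assms in auto)

lemma dg_in [simp]: "u \<in> A \<Longrightarrow> x \<in> A \<Longrightarrow> dg k u m x \<in> A"
  unfolding dg_def using A_subspace by (auto intro: VV.subspace_sum)

lemma dg_wtsp:
  assumes "u \<in> wtsp V k" "x \<in> wtsp V p"
  shows "dg k u m x \<in> wtsp V (p - k + m + 1)"
  unfolding dg_def
proof (rule VV.subspace_sum[OF wtsp_subspace])
  fix a
  show "vmode V (dpow a u) (2 * k - int a - m - 2) x \<in> wtsp V (p - k + m + 1)"
    using mode_wtsp[OF dpow_wtsp[OF assms(1), of a] assms(2), of "2 * k - int a - m - 2"]
    by (simp add: algebra_simps)
qed

lemma dg_lin: "u \<in> A \<Longrightarrow> lin_on (vscale V) (vscale V) A (dg k u m)"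
  using Y_lin_right[OF dpow_in] unfolding lin_on_def dg_def
  by (simp add: sum.distrib VV.scale_sum_right)

lemma dg_lin_left: "x \<in> A \<Longrightarrow> lin_on (vscale V) (vscale V) A (\<lambda>u. dg k u m x)"
  using dpow_lin unfolding lin_on_def dg_def
  by (simp add: Y_left_add Y_left_scale VV.subspace_scale[OF A_subspace] sum.distrib VV.scale_sum_right)

text \<open>The iterate formula of the contragredient module, transposed, so with operators in
  reversed order. \<open>dpow_mode\<close> expands the divided powers of \<open>u_n w\<close>. For
  fixed \<open>a\<close> and \<open>b\<close> the sum over \<open>d\<close> is the left side of the
  Borcherds identity with first parameter \<open>2k - a - n - 2\<close>, and its right side regroups
  into \<open>dg\<close>.\<close>

lemma dg_mode:
  assumes u: "u \<in> wtsp V k" and w: "w \<in> wtsp V l" and z: "z \<in> wtsp V p"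
  shows "\<exists>K>0. dg (k + l - n - 1) (vmode V u n w) m z
    = (\<Sum>i<K. vscale V ((-1) ^ i * ((of_int n :: complex) gchoose i))
        (dg k u (int i) (dg l w (n + m - int i) z)
          - vscale V ((-1) powi n) (dg l w (m + int i) (dg k u (n - int i) z))))"
proof -
  have in_A: "u \<in> A" "w \<in> A" "z \<in> A" using u w z wtsp_in by auto
  \<comment> \<open>Beyond these bounds the vectors involved have negative weight; the leading
    \<open>Suc\<close> in \<open>K\<close> keeps the term \<open>i = 0\<close> in range.\<close>
  define m1 where "m1 = Suc (nat k)"
  define m2 where "m2 = Suc (nat l)"
  define m3 where "m3 = nat (k + l - n + 1)"
  define K where "K = Suc (nat (p - l + n + int m2 + m + 2) + nat (p - k + n + int m1 + 2))"
  define h where "h a b d = vscale V ((of_int (2 * k - int a - n - 2) :: complex) gchoose d)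
      (vmode V (vmode V (dpow a u) (n + int d) (dpow b w))
        ((2 * k - int a - n - 2) + (2 * l - int b - n - m - 2) - int d) z)" for a b d
  have wt0: "vmode V (dpow a u) (n + int d) (dpow b w) = 0" if big: "a \<ge> m1 \<or> b \<ge> m2 \<or> d \<ge> m3" for a b d
  proof -
    consider "a \<ge> m1" | "b \<ge> m2" | "d \<ge> m3" using big by blast
    then show ?thesis
    proof cases
      case 1
      then have "k < int a" unfolding m1_def by linarith
      then show ?thesis using dpow_eq_0[OF u] in_A by (simp add: Y_left_0)
    next
      case 2
      then have "l < int b" unfolding m2_def by linarith
      then show ?thesis using dpow_eq_0[OF w] in_A by (simp add: Y_right_0)
    next
      case 3
      show ?thesis
        by (rule wtsp_neg[OF mode_wtsp[OF dpow_wtsp[OF u] dpow_wtsp[OF w]]]) (use 3 m3_def in linarith)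
    qed
  qed
  have "nat (k + l - n - 1) < m1 + m2 + m3" unfolding m1_def m2_def m3_def by linarith
  then have "dg (k + l - n - 1) (vmode V u n w) m z
      = (\<Sum>c<m1 + m2 + m3. vmode V (dpow c (vmode V u n w)) (2 * (k + l - n - 1) - int c - m - 2) z)"
    using mode_wtsp[OF u w] in_A by (intro dg_eq)
  also have "\<dots> = (\<Sum>c<m1 + m2 + m3. \<Sum>(a, b, d)\<in>triples c. h a b d)"
  proof (intro sum.cong refl)
    fix c
    have "vmode V (dpow c (vmode V u n w)) (2 * (k + l - n - 1) - int c - m - 2) z
      = (\<Sum>t\<in>triples c. vmode V (case t of (a, b, d) \<Rightarrow>
        vscale V ((of_int (2 * k - int a - n - 2) :: complex) gchoose d)
          (vmode V (dpow a u) (n + int d) (dpow b w))) (2 * (k + l - n - 1) - int c - m - 2) z)"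
      unfolding dpow_mode[OF u in_A(2)] using in_A A_subspace
      by (intro Y_left_sum) (auto intro!: VV.subspace_scale)
    also have "\<dots> = (\<Sum>(a, b, d)\<in>triples c. h a b d)"
    proof (intro sum.cong refl, clarify)
      fix a b d assume "(a, b, d) \<in> triples c"
      then have "2 * (k + l - n - 1) - int c - m - 2
          = (2 * k - int a - n - 2) + (2 * l - int b - n - m - 2) - int d"
        unfolding triples_def by auto
      then show "vmode V (vscale V ((of_int (2 * k - int a - n - 2) :: complex) gchoose d)
          (vmode V (dpow a u) (n + int d) (dpow b w))) (2 * (k + l - n - 1) - int c - m - 2) z = h a b d"
        unfolding h_def using in_A by (simp only: Y_left_scale dpow_in A_closed)
    qed
    finally show "vmode V (dpow c (vmode V u n w)) (2 * (k + l - n - 1) - int c - m - 2) z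
      = (\<Sum>(a, b, d)\<in>triples c. h a b d)" .
  qed
  also have "\<dots> = (\<Sum>a<m1. \<Sum>b<m2. \<Sum>d<m3. h a b d)"
    by (rule sum_triples_box) (simp add: h_def wt0 Y_left_0 in_A)
  also have "\<dots> = (\<Sum>a<m1. \<Sum>b<m2. \<Sum>i<K. vscale V ((-1) ^ i * ((of_int n :: complex) gchoose i))
      (vmode V (dpow a u) (2 * k - int a - int i - 2) (vmode V (dpow b w) (2 * l - int b - (n + m - int i) - 2) z)
        - vscale V ((-1) powi n) (vmode V (dpow b w) (2 * l - int b - (m + int i) - 2)
            (vmode V (dpow a u) (2 * k - int a - (n - int i) - 2) z))))"
  proof (rule sum.cong[OF refl], rule sum.cong[OF refl])
    fix a b assume a: "a \<in> {..<m1}" and b: "b \<in> {..<m2}"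
    let ?Q = "2 * k - int a - n - 2" and ?N = "2 * l - int b - n - m - 2"
    have "(\<Sum>d<m3. h a b d) = (\<Sum>i<K. vscale V ((-1) ^ i * ((of_int n :: complex) gchoose i))
      (vmode V (dpow a u) (n + ?Q - int i) (vmode V (dpow b w) (?N + int i) z)
        - vscale V ((-1) powi n) (vmode V (dpow b w) (n + ?N - int i) (vmode V (dpow a u) (?Q + int i) z))))"
      unfolding h_def
    proof (rule borcherds)
      show "vmode V (dpow a u) (n + int i) (dpow b w) = 0" if "i \<ge> m3" for i
        using wt0 that by blast
      show "vmode V (dpow b w) (?N + int i) z = 0" if "i \<ge> K" for i
        by (rule wtsp_neg[OF mode_wtsp[OF dpow_wtsp[OF w] z]]) (use that b K_def in auto)
      show "vmode V (dpow a u) (?Q + int i) z = 0" if "i \<ge> K" for i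
        by (rule wtsp_neg[OF mode_wtsp[OF dpow_wtsp[OF u] z]]) (use that a K_def in auto)
    qed (use in_A in auto)
    then show "(\<Sum>d<m3. h a b d) = (\<Sum>i<K. vscale V ((-1) ^ i * ((of_int n :: complex) gchoose i))
      (vmode V (dpow a u) (2 * k - int a - int i - 2) (vmode V (dpow b w) (2 * l - int b - (n + m - int i) - 2) z)
        - vscale V ((-1) powi n) (vmode V (dpow b w) (2 * l - int b - (m + int i) - 2)
            (vmode V (dpow a u) (2 * k - int a - (n - int i) - 2) z))))"
      by (simp add: algebra_simps)
  qed
  also have "\<dots> = (\<Sum>i<K. \<Sum>a<m1. \<Sum>b<m2. vscale V ((-1) ^ i * ((of_int n :: complex) gchoose i))
      (vmode V (dpow a u) (2 * k - int a - int i - 2) (vmode V (dpow b w) (2 * l - int b - (n + m - int i) - 2) z)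
        - vscale V ((-1) powi n) (vmode V (dpow b w) (2 * l - int b - (m + int i) - 2)
            (vmode V (dpow a u) (2 * k - int a - (n - int i) - 2) z))))"
    by (rule trans[OF sum.cong[OF refl sum.swap] sum.swap])
  also have "\<dots> = (\<Sum>i<K. vscale V ((-1) ^ i * ((of_int n :: complex) gchoose i))
        (dg k u (int i) (dg l w (n + m - int i) z)
          - vscale V ((-1) powi n) (dg l w (m + int i) (dg k u (n - int i) z))))"
  proof (intro sum.cong refl)
    fix i
    have e1: "dg k u (int i) (dg l w (n + m - int i) z) = (\<Sum>a<m1. \<Sum>b<m2.
        vmode V (dpow a u) (2 * k - int a - int i - 2) (vmode V (dpow b w) (2 * l - int b - (n + m - int i) - 2) z))"
      using in_A by (simp add: dg_def m1_def m2_def lessThan_Suc_atMost Y_right_sum del: sum.lessThan_Suc)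
    have e2: "dg l w (m + int i) (dg k u (n - int i) z) = (\<Sum>a<m1. \<Sum>b<m2.
        vmode V (dpow b w) (2 * l - int b - (m + int i) - 2) (vmode V (dpow a u) (2 * k - int a - (n - int i) - 2) z))"
      using in_A by (subst sum.swap)
        (simp add: dg_def m1_def m2_def lessThan_Suc_atMost Y_right_sum del: sum.lessThan_Suc)
    show "(\<Sum>a<m1. \<Sum>b<m2. vscale V ((-1) ^ i * ((of_int n :: complex) gchoose i))
      (vmode V (dpow a u) (2 * k - int a - int i - 2) (vmode V (dpow b w) (2 * l - int b - (n + m - int i) - 2) z)
        - vscale V ((-1) powi n) (vmode V (dpow b w) (2 * l - int b - (m + int i) - 2)
            (vmode V (dpow a u) (2 * k - int a - (n - int i) - 2) z))))
      = vscale V ((-1) ^ i * ((of_int n :: complex) gchoose i))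
        (dg k u (int i) (dg l w (n + m - int i) z)
          - vscale V ((-1) powi n) (dg l w (m + int i) (dg k u (n - int i) z)))"
      unfolding e1 e2 by (simp only: VV.scale_sum_right[symmetric] sum_subtractf)
  qed
  finally show ?thesis unfolding K_def by blast
qed

text \<open>\<open>L(1)\<close> contributes \<open>j - a\<close> times the summand of
  \<open>dg k u (j - 1)\<close> at \<open>a\<close> and \<open>a + 1\<close> times the one at
  \<open>a + 1\<close>; after an index shift the coefficients add up to \<open>j\<close>.
  Transposed, this is the commutator of \<open>L(-1)\<close> with modes in the contragredient
  module.\<close>

lemma Lop_1_dg:
  assumes u: "u \<in> wtsp V k" and x: "x \<in> A"
  shows "Lop V 1 (dg k u j x) = dg k u j (Lop V 1 x) + vscale V (of_int j) (dg k u (j - 1) x)"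
proof -
  have uA: "u \<in> A" using u wtsp_in by auto
  define K where "K = Suc (nat k)"
  define X where "X a = vmode V (dpow a u) (2 * k - int a - (j - 1) - 2) x" for a
  have XK: "X K = 0"
    unfolding X_def using u x by (subst dpow_eq_0) (auto simp: K_def Y_left_0)
  have "Lop V 1 (dg k u j x) = (\<Sum>a<K. Lop V 1 (vmode V (dpow a u) (2 * k - int a - j - 2) x))"
    unfolding dg_def K_def lessThan_Suc_atMost using uA x
    by (intro VV.lin_on_sum[OF A_subspace Lop_lin VV.vector_space_axioms]) auto
  also have "\<dots> = (\<Sum>a<K. vmode V (dpow a u) (2 * k - int a - j - 2) (Lop V 1 x)
      + vscale V (of_int j - of_nat a) (X a) + vscale V (of_nat (Suc a)) (X (Suc a)))"
  proof (intro sum.cong refl)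
    fix a
    have i: "2 * (k - int a) - (2 * k - int a - j - 2) - 2 = j - int a"
      "2 * k - int a - j - 2 + 1 = 2 * k - int a - (j - 1) - 2"
      "2 * k - int (Suc a) - (j - 1) - 2 = 2 * k - int a - j - 2" by simp_all
    have "vmode V (Lop V 1 (dpow a u)) (2 * k - int a - j - 2) x = vscale V (of_nat (Suc a)) (X (Suc a))"
      unfolding X_def i(3) using uA x by (simp add: Lop_1_dpow Y_left_scale del: of_nat_Suc)
    then show "Lop V 1 (vmode V (dpow a u) (2 * k - int a - j - 2) x)
      = vmode V (dpow a u) (2 * k - int a - j - 2) (Lop V 1 x)
      + vscale V (of_int j - of_nat a) (X a) + vscale V (of_nat (Suc a)) (X (Suc a))"
      using Lop_1_mode[OF dpow_wtsp[OF u, of a] x, of "2 * k - int a - j - 2"]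
      unfolding i X_def by simp
  qed
  also have "\<dots> = dg k u j (Lop V 1 x) + ((\<Sum>a<K. vscale V (of_int j - of_nat a) (X a))
      + (\<Sum>a<K. vscale V (of_nat (Suc a)) (X (Suc a))))"
    by (simp add: sum.distrib dg_def K_def lessThan_Suc_atMost add.assoc del: sum.lessThan_Suc of_nat_Suc)
  also have "(\<Sum>a<K. vscale V (of_nat (Suc a)) (X (Suc a))) = (\<Sum>a<Suc K. vscale V (of_nat a) (X a))"
    by (simp only: sum.lessThan_Suc_shift) simp
  also have "\<dots> = (\<Sum>a<K. vscale V (of_nat a) (X a))"
    using XK by simp
  also have "(\<Sum>a<K. vscale V (of_int j - of_nat a) (X a)) + (\<Sum>a<K. vscale V (of_nat a) (X a))
      = vscale V (of_int j) (\<Sum>a<K. X a)"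
    unfolding VV.scale_sum_right sum.distrib[symmetric] VV.scale_left_distrib[symmetric] by simp
  also have "(\<Sum>a<K. X a) = dg k u (j - 1) x"
    unfolding X_def K_def dg_def lessThan_Suc_atMost ..
  finally show ?thesis .
qed

end

lemma complex_vs: "vector_space (\<lambda>c z. c * z :: complex)"
  by unfold_locales (auto simp: algebra_simps)

text \<open>By nondegeneracy \<open>R\<close> embeds the span of \<open>B\<close> into the functions
  supported on \<open>B\<close>. Both have dimension \<open>card B\<close>, so the embedding is
  onto.\<close>

lemma (in vector_space) functional_represented:
  fixes \<psi> :: "'b \<Rightarrow> 'b \<Rightarrow> 'a"
  assumes fin: "finite B" "independent B"
    and lin: "\<And>c x y b. x \<in> span B \<Longrightarrow> y \<in> span B \<Longrightarrow> b \<in> B \<Longrightarrow> \<psi> (scale c x + y) b = c * \<psi> x b + \<psi> y b"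
    and nondeg: "\<And>x. x \<in> span B \<Longrightarrow> (\<And>b. b \<in> B \<Longrightarrow> \<psi> x b = 0) \<Longrightarrow> x = 0"
  shows "\<exists>x\<in>span B. \<forall>b\<in>B. \<psi> x b = F b"
proof -
  interpret FS: vector_space "\<lambda>(c::'a) (f::'b \<Rightarrow> 'a) x. c * f x"
    by unfold_locales (auto simp: fun_eq_iff algebra_simps)
  define R where "R x = (\<lambda>b. if b \<in> B then \<psi> x b else 0)" for x
  have \<psi>0: "\<psi> 0 b = 0" if "b \<in> B" for b
    using lin[OF span_zero span_zero that, of "-1"] by simp
  have \<psi>_sum: "\<psi> (\<Sum>x\<in>B. scale (c x) x) b = (\<Sum>x\<in>B. c x * \<psi> x b)" if b: "b \<in> B" for c b
  proof -
    have "\<psi> (\<Sum>x\<in>B'. scale (c x) x) b = (\<Sum>x\<in>B'. c x * \<psi> x b)" if "B' \<subseteq> B" for B'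
      using finite_subset[OF that fin(1)] that
    proof (induction B' rule: finite_induct)
      case (insert x B')
      have "(\<Sum>x\<in>B'. scale (c x) x) \<in> span B"
        using insert.prems by (intro span_sum span_scale span_base) auto
      then show ?case using insert b by (simp add: lin span_base)
    qed (simp add: \<psi>0 b)
    then show ?thesis by blast
  qed
  have R_sum: "(\<Sum>x\<in>B. (\<lambda>b. c x * R x b)) = R (\<Sum>x\<in>B. scale (c x) x)" for c
    by (rule ext) (auto simp: sum_fun_apply R_def \<psi>_sum)
  have zero: "c x = 0" if "(\<Sum>x\<in>B. (\<lambda>b. c x * R x b)) = 0" "x \<in> B" for c x
  proof -
    have "R (\<Sum>x\<in>B. scale (c x) x) = 0" using that(1) R_sum by simp
    then have "\<psi> (\<Sum>x\<in>B. scale (c x) x) b = 0" if "b \<in> B" for b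
      using that unfolding R_def fun_eq_iff by (metis zero_fun_apply)
    moreover have "(\<Sum>x\<in>B. scale (c x) x) \<in> span B"
      by (intro span_sum span_scale span_base)
    ultimately have "(\<Sum>x\<in>B. scale (c x) x) = 0" using nondeg by blast
    then show ?thesis using independentD[OF fin(2,1) order_refl] that(2) by blast
  qed
  have inj: "inj_on R B"
  proof
    fix x y assume xy: "x \<in> B" "y \<in> B" "R x = R y"
    show "x = y"
    proof (rule ccontr)
      assume "x \<noteq> y"
      let ?c = "\<lambda>z. if z = x then 1 else if z = y then -1 else (0::'a)"
      have "(\<Sum>z\<in>B. (\<lambda>b. ?c z * R z b)) = 0"
      proof
        fix b
        have "(\<Sum>z\<in>B. ?c z * R z b) = (\<Sum>z\<in>{x, y}. ?c z * R z b)"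
          using xy fin(1) by (intro sum.mono_neutral_right) auto
        then show "(\<Sum>z\<in>B. (\<lambda>b. ?c z * R z b)) b = 0 b"
          using \<open>x \<noteq> y\<close> xy(3) by (simp add: sum_fun_apply)
      qed
      from zero[OF this xy(1)] show False by simp
    qed
  qed
  have ind: "FS.independent (R ` B)"
  proof (rule FS.independent_if_scalars_zero)
    fix f v assume f: "(\<Sum>v\<in>R ` B. (\<lambda>x. f v * v x)) = 0" and "v \<in> R ` B"
    then obtain x where x: "x \<in> B" "v = R x" by blast
    have "(\<Sum>x\<in>B. (\<lambda>b. f (R x) * R x b)) = 0"
      using f by (simp add: sum.reindex[OF inj])
    from zero[OF this x(1)] show "f v = 0" using x(2) by simp
  qed (use fin in simp)
  define \<delta> where "\<delta> b = (\<lambda>x. if x = b then (1::'a) else 0)" for b :: 'b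
  have in_span: "(\<lambda>b. if b \<in> B then f b else 0) \<in> FS.span (\<delta> ` B)" for f
  proof -
    have "(\<lambda>b. if b \<in> B then f b else 0) = (\<Sum>b\<in>B. (\<lambda>x. f b * \<delta> b x))"
      using fin(1) by (auto simp: fun_eq_iff sum_fun_apply \<delta>_def if_distrib[of "\<lambda>z. _ * z"] sum.delta cong: if_cong)
    also have "\<dots> \<in> FS.span (\<delta> ` B)"
      by (intro FS.span_sum FS.span_scale FS.span_base) auto
    finally show ?thesis .
  qed
  have "(\<lambda>b. if b \<in> B then F b else 0) \<in> FS.span (R ` B)"
  proof (rule ccontr)
    let ?F = "\<lambda>b. if b \<in> B then F b else 0"
    assume out: "?F \<notin> FS.span (R ` B)"
    then have "?F \<notin> R ` B" using FS.span_base by blast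
    moreover have "FS.independent (insert ?F (R ` B))"
      using ind out by (simp add: FS.independent_insert)
    moreover have "insert ?F (R ` B) \<subseteq> FS.span (\<delta> ` B)"
      using in_span unfolding R_def by blast
    ultimately have "card (insert ?F (R ` B)) \<le> card (\<delta> ` B)"
      using FS.independent_span_bound[of "\<delta> ` B" "insert ?F (R ` B)"] fin(1) by blast
    then show False
      using \<open>?F \<notin> R ` B\<close> fin(1) card_image[OF inj] card_image_le[OF fin(1), of \<delta>] by simp
  qed
  then obtain f where "(\<lambda>b. if b \<in> B then F b else 0) = (\<Sum>v\<in>R ` B. (\<lambda>x. f v * v x))"
    using FS.span_finite[of "R ` B"] fin(1) by auto
  also have "\<dots> = R (\<Sum>x\<in>B. scale (f (R x)) x)"
    by (simp add: sum.reindex[OF inj] R_sum)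
  finally have eq: "(\<lambda>b. if b \<in> B then F b else 0) = R (\<Sum>x\<in>B. scale (f (R x)) x)" .
  have "\<psi> (\<Sum>x\<in>B. scale (f (R x)) x) b = F b" if "b \<in> B" for b
    using fun_cong[OF eq, of b] that by (simp add: R_def)
  moreover have "(\<Sum>x\<in>B. scale (f (R x)) x) \<in> span B"
    by (intro span_sum span_scale span_base)
  ultimately show ?thesis by blast
qed

section \<open>Weight components of a vector\<close>

context voa_algebra
begin

definition dec :: "'v \<Rightarrow> (int \<Rightarrow> 'v) \<Rightarrow> bool"
  where "dec v Z \<longleftrightarrow> (\<forall>k. Z k \<in> wtsp V k) \<and> (\<exists>J. finite J \<and> (\<forall>k. k \<notin> J \<longrightarrow> Z k = 0) \<and> v = (\<Sum>k\<in>J. Z k))"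

definition wcomp :: "'v \<Rightarrow> int \<Rightarrow> 'v"
  where "wcomp v = (SOME Z. dec v Z)"

lemma dec_exists: "v \<in> A \<Longrightarrow> \<exists>Z. dec v Z"
proof -
  assume "v \<in> A"
  then obtain J z where J: "finite J" "\<forall>k\<in>J. z k \<in> wtsp V k" "v = (\<Sum>k\<in>J. z k)"
    using wtsp_decomp by blast
  have "dec v (\<lambda>k. if k \<in> J then z k else 0)"
    unfolding dec_def using J wtsp_subspace by (auto simp: VV.subspace_0 intro!: exI[of _ J])
  then show ?thesis by blast
qed

lemma dec_unique:
  assumes "dec v Z" "dec v Z'"
  shows "Z = Z'"
proof
  fix k
  obtain J J' where J: "finite J" "\<forall>k. k \<notin> J \<longrightarrow> Z k = 0" "v = (\<Sum>k\<in>J. Z k)"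
    "finite J'" "\<forall>k. k \<notin> J' \<longrightarrow> Z' k = 0" "v = (\<Sum>k\<in>J'. Z' k)"
    using assms unfolding dec_def by blast
  have "(\<Sum>k\<in>J. Z k) = (\<Sum>k\<in>J \<union> J'. Z k)" "(\<Sum>k\<in>J'. Z' k) = (\<Sum>k\<in>J \<union> J'. Z' k)"
    using J by (intro sum.mono_neutral_left; auto)+
  then have s: "(\<Sum>k\<in>J \<union> J'. Z k - Z' k) = 0" using J by (simp add: sum_subtractf)
  show "Z k = Z' k"
  proof (cases "k \<in> J \<union> J'")
    case True
    have d: "Z i - Z' i \<in> wtsp V i" for i
      using assms wtsp_subspace unfolding dec_def by (auto intro: VV.subspace_diff)
    have "Z k - Z' k \<in> {0}"
    proof (rule VV.eigen_components[OF A_subspace Lop_lin[of 0], of "{0}" "J \<union> J'" "of_int"])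
      show "Z i - Z' i \<in> A" "Lop V 0 (Z i - Z' i) = vscale V (of_int i) (Z i - Z' i)" for i
        using wtsp_in[OF d] Lop_0_wtsp[OF d] .
    qed (use J True s VV.subspace_0[OF A_subspace] in \<open>auto simp: inj_on_def Lop_def Y_right_0\<close>)
    then show ?thesis by simp
  next
    case False
    then show ?thesis using J by auto
  qed
qed

lemma dec_wcomp: "v \<in> A \<Longrightarrow> dec v (wcomp v)"
  unfolding wcomp_def using dec_exists someI_ex by metis

lemma wcomp_eqI: "v \<in> A \<Longrightarrow> dec v Z \<Longrightarrow> wcomp v = Z"
  using dec_unique dec_wcomp by blast

lemma wcomp_wtsp: "v \<in> A \<Longrightarrow> wcomp v k \<in> wtsp V k"
  using dec_wcomp unfolding dec_def by blast

lemma wcomp_sum: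
  assumes "v \<in> A"
  shows "\<exists>J. finite J \<and> (\<forall>k. k \<notin> J \<longrightarrow> wcomp v k = 0) \<and> v = (\<Sum>k\<in>J. wcomp v k)"
  using dec_wcomp[OF assms] unfolding dec_def by blast

lemma wcomp_lin:
  assumes x: "x \<in> A" and y: "y \<in> A"
  shows "wcomp (vscale V c x + y) k = vscale V c (wcomp x k) + wcomp y k"
proof -
  obtain J where J: "finite J" "\<forall>k. k \<notin> J \<longrightarrow> wcomp x k = 0" "x = (\<Sum>k\<in>J. wcomp x k)"
    using wcomp_sum[OF x] by blast
  obtain J' where J': "finite J'" "\<forall>k. k \<notin> J' \<longrightarrow> wcomp y k = 0" "y = (\<Sum>k\<in>J'. wcomp y k)"
    using wcomp_sum[OF y] by blast
  have "(\<Sum>k\<in>J. wcomp x k) = (\<Sum>k\<in>J \<union> J'. wcomp x k)" "(\<Sum>k\<in>J'. wcomp y k) = (\<Sum>k\<in>J \<union> J'. wcomp y k)"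
    using J(1,2) J'(1,2) by (intro sum.mono_neutral_left; auto)+
  moreover have "(\<Sum>k\<in>J \<union> J'. vscale V c (wcomp x k) + wcomp y k)
      = vscale V c (\<Sum>k\<in>J \<union> J'. wcomp x k) + (\<Sum>k\<in>J \<union> J'. wcomp y k)"
    by (simp add: sum.distrib VV.scale_sum_right)
  ultimately have "vscale V c x + y = (\<Sum>k\<in>J \<union> J'. vscale V c (wcomp x k) + wcomp y k)"
    using J(3) J'(3) by metis
  then have "dec (vscale V c x + y) (\<lambda>k. vscale V c (wcomp x k) + wcomp y k)"
    unfolding dec_def using J J' wcomp_wtsp x y wtsp_subspace
    by (auto intro!: exI[of _ "J \<union> J'"] VV.subspace_add VV.subspace_scale)
  then show ?thesis
    using wcomp_eqI[of "vscale V c x + y"] x y A_subspace by (simp add: VV.subspace_add VV.subspace_scale)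
qed

lemma wcomp_hom: "v \<in> wtsp V k \<Longrightarrow> wcomp v j = (if j = k then v else 0)"
proof -
  assume v: "v \<in> wtsp V k"
  have "dec v (\<lambda>j. if j = k then v else 0)"
    unfolding dec_def using v VV.subspace_0[OF wtsp_subspace] by (auto intro!: exI[of _ "{k}"])
  then show ?thesis using wcomp_eqI[OF wtsp_in[OF v]] by simp
qed

lemma induct_hom [consumes 1, case_names hom add]:
  assumes "v \<in> A" and P: "\<And>k u. u \<in> wtsp V k \<Longrightarrow> P u" "\<And>u w. u \<in> A \<Longrightarrow> w \<in> A \<Longrightarrow> P u \<Longrightarrow> P w \<Longrightarrow> P (u + w)"
  shows "P v"
proof -
  obtain J where J: "finite J" "v = (\<Sum>k\<in>J. wcomp v k)" using wcomp_sum[OF assms(1)] by blast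
  have "P (\<Sum>k\<in>J. wcomp v k) \<and> (\<Sum>k\<in>J. wcomp v k) \<in> A"
    using J(1)
  proof (induction J rule: finite_induct)
    case empty
    have "0 \<in> wtsp V 0" using VV.subspace_0[OF wtsp_subspace] .
    then show ?case using P(1) A_subspace VV.subspace_0 by auto
  next
    case (insert k J)
    have "wcomp v k \<in> wtsp V k" using wcomp_wtsp[OF assms(1)] .
    then show ?case
      using insert P(1)[of "wcomp v k" k] P(2)[of "wcomp v k"] wtsp_in A_subspace
      by (simp add: VV.subspace_add)
  qed
  then show ?thesis using J(2) by simp
qed

end

section \<open>The invariant bilinear form\<close>

locale quasi_primary_voa = cft_voa V for V :: "'v::ab_group_add voa" +
  assumes simple: "simple V" and L1: "\<And>v. v \<in> wtsp V 1 \<Longrightarrow> Lop V 1 v = 0"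
begin

definition vc :: "'v \<Rightarrow> complex"
  where "vc v = (THE c. wcomp v 0 = vscale V c (vac V))"

lemma vc_eqI: "wcomp v 0 = vscale V c (vac V) \<Longrightarrow> vc v = c"
  unfolding vc_def using vac_nonzero[OF simple] by (intro the_equality) auto

lemma wcomp_vc: "v \<in> A \<Longrightarrow> wcomp v 0 = vscale V (vc v) (vac V)"
  using wtsp_0[OF wcomp_wtsp[of v 0]] vc_eqI by metis

lemma vc_lin: "x \<in> A \<Longrightarrow> y \<in> A \<Longrightarrow> vc (vscale V c x + y) = c * vc x + vc y"
  by (rule vc_eqI) (simp add: wcomp_lin wcomp_vc VV.scale_left_distrib)

lemma vc_lin_on: "lin_on (vscale V) (\<lambda>c z. c * z) A vc"
  unfolding lin_on_def using vc_lin by blast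

lemmas vc_0 = VV.lin_on_0[OF A_subspace vc_lin_on complex_vs]
  and vc_add = VV.lin_on_add[OF A_subspace vc_lin_on complex_vs]
  and vc_scale = VV.lin_on_scale[OF A_subspace vc_lin_on complex_vs]
  and vc_diff = VV.lin_on_diff[OF A_subspace vc_lin_on complex_vs]
  and vc_sum = VV.lin_on_sum[OF A_subspace vc_lin_on complex_vs]

lemma vc_vac: "vc (vac V) = 1"
  by (rule vc_eqI) (simp add: wcomp_hom[OF vac_wtsp])

lemma vc_wtsp: "v \<in> wtsp V k \<Longrightarrow> k \<noteq> 0 \<Longrightarrow> vc v = 0"
  by (rule vc_eqI) (simp add: wcomp_hom)

text \<open>Only weight 1 can reach the vacuum line under \<open>L(1)\<close>, and there
  \<open>L1\<close> applies. Invariant forms correspond to functionals on \<open>V_0\<close>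
  vanishing on \<open>L(1) V_1\<close>, and this is the vanishing required of
  \<open>vc\<close>.\<close>

lemma vc_Lop_1: "v \<in> A \<Longrightarrow> vc (Lop V 1 v) = 0"
proof (induction rule: induct_hom)
  case (hom k u)
  then show ?case
    using L1[of u] vc_wtsp[OF Lop_1_wtsp[OF hom]] by (cases "k = 1") (auto simp: vc_0)
next
  case (add u w)
  then show ?case
    using VV.lin_on_add[OF A_subspace Lop_lin VV.vector_space_axioms, of u w] by (simp add: vc_add)
qed

text \<open>\<open>vc\<close> is annihilated by the transpose of \<open>L(1)\<close>, hence is a vacuum-like vector of the
  contragredient module.\<close>
lemma vc_dg:
  assumes u: "u \<in> wtsp V k" and "j \<ge> 0" and "x \<in> A"
  shows "vc (dg k u j x) = 0"
proof -
  have uA: "u \<in> A" using u wtsp_in by auto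
  \<comment> \<open>For \<open>j >= k\<close> the vector \<open>dg k u j x\<close> has only positive
    weights. Below that, \<open>Lop_1_dg\<close> at \<open>j + 1\<close> expresses
    \<open>j + 1\<close> times the value through values already known to vanish.\<close>
  have "j \<ge> 0 \<longrightarrow> (\<forall>x\<in>A. vc (dg k u j x) = 0)"
  proof (induction rule: int_descent[of "max 0 k"])
    case (1 j)
    have "vc (dg k u j x) = 0" if "x \<in> A" for x
      using that
    proof (induction rule: induct_hom)
      case (hom p x)
      show ?case
      proof (cases "p < 0")
        case True
        then have "x = 0" using wtsp_neg hom by blast
        then show ?thesis
          using VV.lin_on_0[OF A_subspace dg_lin[OF uA] VV.vector_space_axioms] by (simp add: vc_0)
      next
        case False
        then show ?thesis using \<open>max 0 k \<le> j\<close> by (intro vc_wtsp[OF dg_wtsp[OF u hom]]) auto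
      qed
    next
      case (add x y)
      then show ?case
        using VV.lin_on_add[OF A_subspace dg_lin[OF uA] VV.vector_space_axioms, of x y] uA
        by (simp add: vc_add)
    qed
    then show ?case by blast
  next
    case (2 j)
    show ?case
    proof (intro impI ballI)
      fix x assume j: "j \<ge> 0" and x: "x \<in> A"
      have "0 = vc (dg k u (j + 1) (Lop V 1 x) + vscale V (of_int (j + 1)) (dg k u j x))"
        using vc_Lop_1[of "dg k u (j + 1) x"] Lop_1_dg[OF u x, of "j + 1"] uA x by simp
      also have "\<dots> = vc (dg k u (j + 1) (Lop V 1 x)) + of_int (j + 1) * vc (dg k u j x)"
        using uA x A_subspace by (simp add: vc_add vc_scale VV.subspace_scale)
      also have "vc (dg k u (j + 1) (Lop V 1 x)) = 0" using 2[of "j + 1"] j x by simp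
      finally have "of_int (j + 1) * vc (dg k u j x) = 0" by simp
      moreover have "(of_int (j + 1) :: complex) \<noteq> 0" using j by (simp only: of_int_eq_0_iff)
      ultimately show "vc (dg k u j x) = 0" by simp
    qed
  qed
  then show ?thesis using assms by blast
qed

text \<open>The value at \<open>x\<close> of the contragredient mode \<open>w_(-1)\<close> applied
  to \<open>vc\<close>, summed over the weights of \<open>w\<close>. It is 0 off \<open>A\<close>
  because \<open>contra_carrier\<close> demands it.\<close>

definition form :: "'v \<Rightarrow> 'v \<Rightarrow> complex"
  where "form w x = (if x \<in> A then
    (\<Sum>k | wcomp w k \<noteq> 0. (-1) powi k * vc (dg k (wcomp w k) (-1) x)) else 0)"

lemma form_eq:
  assumes "w \<in> A" "x \<in> A" "finite J" "\<And>k. k \<notin> J \<Longrightarrow> wcomp w k = 0"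
  shows "form w x = (\<Sum>k\<in>J. (-1) powi k * vc (dg k (wcomp w k) (-1) x))"
proof -
  have "dg k 0 (-1) x = 0" for k
    using VV.lin_on_0[OF A_subspace dg_lin_left[OF assms(2)] VV.vector_space_axioms] .
  then show ?thesis
    unfolding form_def using assms by (auto intro!: sum.mono_neutral_left simp: vc_0)
qed

lemma form_hom: "w \<in> wtsp V k \<Longrightarrow> x \<in> A \<Longrightarrow> form w x = (-1) powi k * vc (dg k w (-1) x)"
  using form_eq[of w x "{k}"] wtsp_in by (simp add: wcomp_hom)

lemma form_lin_left:
  assumes w: "w \<in> A" "w' \<in> A" and x: "x \<in> A"
  shows "form (vscale V c w + w') x = c * form w x + form w' x"
proof -
  obtain J J' where J: "finite J" "\<And>k. k \<notin> J \<Longrightarrow> wcomp w k = 0" "finite J'" "\<And>k. k \<notin> J' \<Longrightarrow> wcomp w' k = 0"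
    using wcomp_sum w by metis
  have in_A: "wcomp w k \<in> A" "wcomp w' k \<in> A" for k using wcomp_wtsp w wtsp_in by auto
  have s: "vscale V c w + w' \<in> A" using w A_subspace by (simp add: VV.subspace_add VV.subspace_scale)
  have "form (vscale V c w + w') x
    = (\<Sum>k\<in>J \<union> J'. (-1) powi k * vc (dg k (wcomp (vscale V c w + w') k) (-1) x))"
    using J w by (intro form_eq s x) (auto simp: wcomp_lin)
  also have "\<dots> = (\<Sum>k\<in>J \<union> J'. c * ((-1) powi k * vc (dg k (wcomp w k) (-1) x))
      + (-1) powi k * vc (dg k (wcomp w' k) (-1) x))"
  proof (intro sum.cong refl)
    fix k
    have "dg k (wcomp (vscale V c w + w') k) (-1) x
        = vscale V c (dg k (wcomp w k) (-1) x) + dg k (wcomp w' k) (-1) x"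
      using in_A[of k] dg_lin_left[OF x] wcomp_lin[OF w] unfolding lin_on_def by simp
    then have "vc (dg k (wcomp (vscale V c w + w') k) (-1) x)
        = c * vc (dg k (wcomp w k) (-1) x) + vc (dg k (wcomp w' k) (-1) x)"
      using in_A[of k] x by (simp add: vc_lin)
    then show "(-1) powi k * vc (dg k (wcomp (vscale V c w + w') k) (-1) x)
        = c * ((-1) powi k * vc (dg k (wcomp w k) (-1) x)) + (-1) powi k * vc (dg k (wcomp w' k) (-1) x)"
      by (simp add: algebra_simps)
  qed
  also have "\<dots> = c * form w x + form w' x"
    using form_eq[OF w(1) x, of "J \<union> J'"] form_eq[OF w(2) x, of "J \<union> J'"] J
    by (simp add: sum.distrib sum_distrib_left)
  finally show ?thesis .
qed

lemma form_lin_right: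
  assumes w: "w \<in> A" and x: "x \<in> A" "x' \<in> A"
  shows "form w (vscale V c x + x') = c * form w x + form w x'"
proof -
  have in_A: "wcomp w k \<in> A" for k using wcomp_wtsp w wtsp_in by auto
  have s: "vscale V c x + x' \<in> A" using x A_subspace by (simp add: VV.subspace_add VV.subspace_scale)
  have "(-1) powi k * vc (dg k (wcomp w k) (-1) (vscale V c x + x'))
      = c * ((-1) powi k * vc (dg k (wcomp w k) (-1) x)) + (-1) powi k * vc (dg k (wcomp w k) (-1) x')" for k
  proof -
    have "dg k (wcomp w k) (-1) (vscale V c x + x')
        = vscale V c (dg k (wcomp w k) (-1) x) + dg k (wcomp w k) (-1) x'"
      using in_A[of k] x dg_lin[of "wcomp w k" k "-1"] unfolding lin_on_def by blast
    then have "vc (dg k (wcomp w k) (-1) (vscale V c x + x'))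
        = c * vc (dg k (wcomp w k) (-1) x) + vc (dg k (wcomp w k) (-1) x')"
      using in_A[of k] x by (simp add: vc_lin)
    then show ?thesis by (simp add: algebra_simps)
  qed
  then show ?thesis
    unfolding form_def using x s by (simp add: sum.distrib sum_distrib_left)
qed

lemma form_lin_on: "w \<in> A \<Longrightarrow> lin_on (vscale V) (\<lambda>c z. c * z) A (form w)"
  unfolding lin_on_def using form_lin_right by blast

lemma form_lin_on_left: "x \<in> A \<Longrightarrow> lin_on (vscale V) (\<lambda>c z. c * z) A (\<lambda>w. form w x)"
  unfolding lin_on_def using form_lin_left by blast

lemmas form_right_0 = VV.lin_on_0[OF A_subspace form_lin_on complex_vs]
  and form_right_add = VV.lin_on_add[OF A_subspace form_lin_on complex_vs]
  and form_right_scale = VV.lin_on_scale[OF A_subspace form_lin_on complex_vs]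
  and form_right_sum = VV.lin_on_sum[OF A_subspace form_lin_on complex_vs]
  and form_left_0 = VV.lin_on_0[OF A_subspace form_lin_on_left complex_vs]
  and form_left_add = VV.lin_on_add[OF A_subspace form_lin_on_left complex_vs]
  and form_left_sum = VV.lin_on_sum[OF A_subspace form_lin_on_left complex_vs]

lemma form_orthogonal:
  assumes "w \<in> wtsp V k" "x \<in> wtsp V p" "p \<noteq> k"
  shows "form w x = 0"
proof -
  have "vc (dg k w (-1) x) = 0"
    using assms(3) by (intro vc_wtsp[OF dg_wtsp[OF assms(1,2), of "-1"]]) auto
  then show ?thesis using form_hom[OF assms(1)] assms(2) wtsp_in by simp
qed

text \<open>In \<open>dg_mode\<close> with \<open>m = -1\<close>, \<open>vc\<close> kills every
  outer \<open>dg\<close> with nonnegative mode, so only the second term at \<open>i = 0\<close>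
  survives. Its sign \<open>-(-1)^n\<close> combines with the sign attached to the weight
  \<open>k + l - n - 1\<close>.\<close>

lemma form_invariant_hom:
  assumes u: "u \<in> wtsp V k" and w: "w \<in> wtsp V l" and z: "z \<in> wtsp V p"
  shows "form (vmode V u n w) z = (-1) powi k * form w (dg k u n z)"
proof -
  have in_A: "u \<in> A" "w \<in> A" "z \<in> A" using u w z wtsp_in by auto
  obtain K where K: "K > 0" "dg (k + l - n - 1) (vmode V u n w) (-1) z
    = (\<Sum>i<K. vscale V ((-1) ^ i * ((of_int n :: complex) gchoose i))
        (dg k u (int i) (dg l w (n + -1 - int i) z)
          - vscale V ((-1) powi n) (dg l w (-1 + int i) (dg k u (n - int i) z))))"
    using dg_mode[OF u w z, of n "-1"] by blast
  have "vc (dg (k + l - n - 1) (vmode V u n w) (-1) z)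
    = (\<Sum>i<K. ((-1) ^ i * ((of_int n :: complex) gchoose i)) *
        (vc (dg k u (int i) (dg l w (n + -1 - int i) z))
          - (-1) powi n * vc (dg l w (-1 + int i) (dg k u (n - int i) z))))"
    unfolding K(2) using in_A A_subspace
    by (simp add: vc_sum vc_scale vc_diff VV.subspace_scale VV.subspace_diff)
  also have "\<dots> = (\<Sum>i\<in>{0}. ((-1) ^ i * ((of_int n :: complex) gchoose i)) *
        (vc (dg k u (int i) (dg l w (n + -1 - int i) z))
          - (-1) powi n * vc (dg l w (-1 + int i) (dg k u (n - int i) z))))"
    using K(1) in_A by (intro sum.mono_neutral_right) (auto simp: vc_dg[OF u] vc_dg[OF w])
  also have "\<dots> = - ((-1) powi n) * vc (dg l w (-1) (dg k u n z))"
    using vc_dg[OF u, of 0] in_A by (simp add: gbinomial_0)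
  finally have eq: "vc (dg (k + l - n - 1) (vmode V u n w) (-1) z) = - ((-1) powi n) * vc (dg l w (-1) (dg k u n z))" .
  have sgn: "(-1) powi (k + l - n - 1) * (- ((-1) powi n)) = (-1) powi k * ((-1) powi l :: complex)"
    by (simp add: power_int_add power_int_diff)
  have "form (vmode V u n w) z = (-1) powi (k + l - n - 1) * (- ((-1) powi n) * vc (dg l w (-1) (dg k u n z)))"
    using form_hom[OF mode_wtsp[OF u w] in_A(3)] eq by simp
  also have "\<dots> = (-1) powi k * ((-1) powi l * vc (dg l w (-1) (dg k u n z)))"
    using sgn by (simp only: mult.assoc[symmetric])
  also have "\<dots> = (-1) powi k * form w (dg k u n z)"
    using form_hom[OF w] in_A by simp
  finally show ?thesis .
qed

lemma form_invariant:
  assumes u: "u \<in> wtsp V k" and "w \<in> A" and "z \<in> A"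
  shows "form (vmode V u n w) z = (-1) powi k * form w (dg k u n z)"
proof -
  have uA: "u \<in> A" using u wtsp_in by auto
  show ?thesis
    using assms(2)
  proof (induction rule: induct_hom)
    case (hom l w)
    show ?case
      using assms(3)
    proof (induction rule: induct_hom)
      case (hom p z)
      then show ?case using form_invariant_hom[OF u \<open>w \<in> wtsp V l\<close>] by blast
    next
      case (add x y)
      then show ?case
        using VV.lin_on_add[OF A_subspace dg_lin[OF uA] VV.vector_space_axioms, of x y] uA
          wtsp_in[OF \<open>w \<in> wtsp V l\<close>]
        by (simp add: form_right_add distrib_left)
    qed
  next
    case (add x y)
    then show ?case using uA assms(3)
      by (simp add: form_left_add Y_right_add distrib_left)
  qed
qed

lemma form_contra_mode:
  assumes u: "u \<in> wtsp V k" and w: "w \<in> A"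
  shows "form (vmode V u n w) = contra_mode V k u n (form w)"
proof
  fix x
  have uA: "u \<in> A" using u wtsp_in by auto
  show "form (vmode V u n w) x = contra_mode V k u n (form w) x"
  proof (cases "x \<in> A")
    case True
    have dp: "(1 / fact j) * form w (vmode V ((Lop V 1 ^^ j) u) q x) = form w (vmode V (dpow j u) q x)" for j q
      unfolding dpow_def using uA True w by (simp add: Y_left_scale form_right_scale)
    have "Sum_any (\<lambda>j. (1 / fact j) * form w (vmode V ((Lop V 1 ^^ j) u) (2 * k - int j - n - 2) x))
      = (\<Sum>j<Suc (nat k). form w (vmode V (dpow j u) (2 * k - int j - n - 2) x))"
      unfolding dp
    proof (rule Sum_any_lessThan)
      fix j assume "Suc (nat k) \<le> j"
      then have "k < int j" by linarith
      then show "form w (vmode V (dpow j u) (2 * k - int j - n - 2) x) = 0"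
        using u True w by (simp add: dpow_eq_0 Y_left_0 form_right_0)
    qed
    also have "\<dots> = form w (dg k u n x)"
      unfolding dg_def lessThan_Suc_atMost using uA True w by (simp add: form_right_sum)
    finally show ?thesis
      using form_invariant[OF u w True] True unfolding contra_mode_def by simp
  next
    case False
    then show ?thesis unfolding form_def contra_mode_def by simp
  qed
qed

lemma form_vac: "form (vac V) (vac V) = 1"
proof -
  have "dg 0 (vac V) (-1) (vac V) = vac V"
    unfolding dg_def using creation(2)[OF vac_in] by simp
  then show ?thesis using form_hom[OF vac_wtsp] by (simp add: vc_vac)
qed

text \<open>By invariance the left radical is an ideal. It omits the vacuum, which pairs to 1 with
  itself, so simplicity makes it 0.\<close>

lemma form_nondegenerate:
  assumes "w \<in> A" "\<And>x. x \<in> A \<Longrightarrow> form w x = 0"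
  shows "w = 0"
proof -
  define I where "I = {w \<in> A. \<forall>x\<in>A. form w x = 0}"
  have Isub: "VV.subspace I"
    unfolding VV.subspace_def I_def using A_subspace
    by (auto simp: VV.subspace_0 VV.subspace_add VV.subspace_scale form_left_0 form_left_add
        VV.lin_on_scale[OF A_subspace form_lin_on_left complex_vs])
  have "vmode V u n w \<in> I" if "u \<in> A" "w \<in> I" for u n w
    using that(1)
  proof (induction rule: induct_hom)
    case (hom k u)
    then show ?case using form_invariant[OF hom] that(2) wtsp_in unfolding I_def by auto
  next
    case (add x y)
    then show ?case
      using VV.subspace_add[OF Isub add(3,4)] that(2) unfolding I_def by (simp add: Y_left_add add(1,2))
  qed
  then have "submodule V (adjoint V) I"
    unfolding submodule_def adjoint_simps using Isub I_def by auto
  moreover have "vac V \<notin> I" using form_vac vac_in unfolding I_def by (metis (mono_tags, lifting) mem_Collect_eq zero_neq_one)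
  then have "I \<noteq> A" using vac_in by blast
  ultimately have "I = {0}" using simple unfolding simple_def irreducible_def adjoint_simps by blast
  then show ?thesis using assms unfolding I_def by blast
qed

text \<open>Different weights are orthogonal, so nondegeneracy restricts to a single weight space,
  whose finite dimension then gives surjectivity onto its dual.\<close>

lemma form_surjective_wtsp:
  assumes F: "lin_on (vscale V) (\<lambda>c z. c * z) A F"
  shows "\<exists>w\<in>wtsp V k. \<forall>x\<in>wtsp V k. form w x = F x"
proof -
  have "fin_dim_sub (vscale V) (wtsp V k)" using is_voa unfolding voa_def Let_def by blast
  then obtain B0 where B0: "finite B0" "B0 \<subseteq> wtsp V k" "VV.span B0 = wtsp V k"
    unfolding fin_dim_sub_def by blast
  obtain B where B: "B \<subseteq> B0" "VV.independent B" "B0 \<subseteq> VV.span B"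
    using VV.maximal_independent_subset by metis
  have span: "VV.span B = wtsp V k"
    using B B0(3) VV.span_mono[OF B(1)] VV.span_minimal[OF B(3)] by auto
  have BA: "B \<subseteq> A" using B B0 wtsp_in by blast
  have "\<exists>w\<in>VV.span B. \<forall>b\<in>B. form w b = F b"
  proof (rule VV.functional_represented[OF finite_subset[OF B(1) B0(1)] B(2)])
    show "form (vscale V c x + y) b = c * form x b + form y b"
      if "x \<in> VV.span B" "y \<in> VV.span B" "b \<in> B" for c x y b
      using that span wtsp_in BA form_lin_left by blast
    fix x assume x: "x \<in> VV.span B" and 0: "\<And>b. b \<in> B \<Longrightarrow> form x b = 0"
    have xk: "x \<in> wtsp V k" using x span by simp
    have xA: "x \<in> A" using xk wtsp_in by blast
    have "VV.span B \<subseteq> {y \<in> A. form x y = 0}"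
      using 0 BA A_subspace xA unfolding VV.subspace_def
      by (intro VV.span_minimal) (auto simp: VV.subspace_def form_right_0 form_right_add form_right_scale)
    then have k: "form x y = 0" if "y \<in> wtsp V k" for y using that span by blast
    show "x = 0"
    proof (rule form_nondegenerate[OF xA])
      fix y assume "y \<in> A"
      then show "form x y = 0"
      proof (induction rule: induct_hom)
        case (hom p u)
        then show ?case using k form_orthogonal[OF xk hom] by (cases "p = k") auto
      next
        case (add u w)
        then show ?case using xA by (simp add: form_right_add)
      qed
    qed
  qed
  then obtain w where w: "w \<in> wtsp V k" "\<And>b. b \<in> B \<Longrightarrow> form w b = F b" using span by blast
  have wA: "w \<in> A" using w wtsp_in by blast
  have "VV.span B \<subseteq> {x \<in> A. form w x = F x}"
    using w BA A_subspace wA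
    by (intro VV.span_minimal)
      (auto simp: VV.subspace_def form_right_0 form_right_add form_right_scale
        VV.lin_on_0[OF A_subspace F complex_vs] VV.lin_on_add[OF A_subspace F complex_vs]
        VV.lin_on_scale[OF A_subspace F complex_vs])
  then show ?thesis using w(1) span by blast
qed

theorem self_contragredient: "self_contragredient V"
  unfolding self_contragredient_def
proof (intro exI conjI allI ballI)
  show "lin_on (vscale V) contra_scale A form"
    unfolding lin_on_def
  proof (intro ballI allI)
    fix x y c assume xy: "x \<in> A" "y \<in> A"
    show "form (vscale V c x + y) = contra_scale c (form x) + form y"
    proof
      show "form (vscale V c x + y) z = (contra_scale c (form x) + form y) z" for z
        using form_lin_left[OF xy, of z c] unfolding contra_scale_def
        by (cases "z \<in> A") (simp_all add: form_def)
    qed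
  qed
  show "form (vmode V u n w) = contra_mode V k u n (form w)" if "u \<in> wtsp V k" "w \<in> A" for k u n w
    using form_contra_mode[OF that] .
  show "bij_betw form A (contra_carrier V)"
    unfolding bij_betw_def
  proof
    show "inj_on form A"
    proof
      fix x y assume xy: "x \<in> A" "y \<in> A" "form x = form y"
      have "x - y = 0"
      proof (rule form_nondegenerate)
        show "x - y \<in> A" using xy A_subspace by (simp add: VV.subspace_diff)
        show "form (x - y) z = 0" if "z \<in> A" for z
          using VV.lin_on_diff[OF A_subspace form_lin_on_left[OF that] complex_vs xy(1,2)] xy(3) by simp
      qed
      then show "x = y" by simp
    qed
    show "form ` A = contra_carrier V"
    proof
      show "form ` A \<subseteq> contra_carrier V"
      proof
        fix f assume "f \<in> form ` A"
        then obtain w where w: "w \<in> A" "f = form w" by blast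
        obtain J where J: "finite J" "\<forall>k. k \<notin> J \<longrightarrow> wcomp w k = 0" "w = (\<Sum>k\<in>J. wcomp w k)"
          using wcomp_sum[OF w(1)] by blast
        have "p \<in> J" if p: "u \<in> wtsp V p" "form w u \<noteq> 0" for p u
        proof (rule ccontr)
          assume "p \<notin> J"
          have "wcomp w k \<in> A" for k using wcomp_wtsp[OF w(1)] wtsp_in by blast
          then have "form (\<Sum>k\<in>J. wcomp w k) u = (\<Sum>k\<in>J. form (wcomp w k) u)"
            using p(1) wtsp_in by (intro form_left_sum) auto
          also have "\<dots> = 0"
            using \<open>p \<notin> J\<close> by (intro sum.neutral ballI form_orthogonal[OF wcomp_wtsp[OF w(1)] p(1)]) auto
          finally show False using J(3) p(2) by simp
        qed
        then have "{k. \<exists>u\<in>wtsp V k. form w u \<noteq> 0} \<subseteq> J" by blast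
        then have "finite {k. \<exists>u\<in>wtsp V k. form w u \<noteq> 0}" using J(1) finite_subset by blast
        then show "f \<in> contra_carrier V"
          unfolding contra_carrier_def w(2) using form_lin_on[OF w(1)] by (simp add: form_def)
      qed
      show "contra_carrier V \<subseteq> form ` A"
      proof
        fix F assume "F \<in> contra_carrier V"
        then have F: "\<And>u. u \<notin> A \<Longrightarrow> F u = 0" "lin_on (vscale V) (\<lambda>c z. c * z) A F"
          and fin: "finite {k. \<exists>u\<in>wtsp V k. F u \<noteq> 0}"
          unfolding contra_carrier_def by auto
        \<comment> \<open>\<open>S\<close> is finite as \<open>F\<close> lies in the restricted
          dual; preimages are found weight by weight and added.\<close>
        define S where "S = {k. \<exists>u\<in>wtsp V k. F u \<noteq> 0}"
        obtain z where z: "\<And>k. z k \<in> wtsp V k" "\<And>k x. x \<in> wtsp V k \<Longrightarrow> form (z k) x = F x"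
          using form_surjective_wtsp[OF F(2)] by metis
        have zA: "z k \<in> A" for k using z wtsp_in by blast
        let ?w = "\<Sum>k\<in>S. z k"
        have wA: "?w \<in> A" using zA A_subspace by (intro VV.subspace_sum)
        have "form ?w x = F x" for x
        proof (cases "x \<in> A")
          case True
          then show ?thesis
          proof (induction rule: induct_hom)
            case (hom p u)
            have "form ?w u = (\<Sum>k\<in>S. form (z k) u)" using zA hom wtsp_in by (intro form_left_sum) auto
            also have "\<dots> = (\<Sum>k\<in>S. if k = p then F u else 0)"
              using z hom form_orthogonal[OF z(1) hom] by (intro sum.cong) auto
            also have "\<dots> = F u"
              using fin hom unfolding S_def[symmetric] by (auto simp: S_def)
            finally show ?case .
          next
            case (add u v)
            then show ?case
              using wA VV.lin_on_add[OF A_subspace F(2) complex_vs] by (simp add: form_right_add)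
          qed
        next
          case False
          then show ?thesis using F(1) by (simp add: form_def)
        qed
        then have "form ?w = F" by blast
        then show "F \<in> form ` A" using wA by blast
      qed
    qed
  qed
qed

end

text \<open>The image \<open>F\<close> of the vacuum is annihilated by all \<open>u_n\<close> with
  \<open>n >= 0\<close>. For \<open>omg V\<close> and \<open>n = 1\<close> this confines
  \<open>F\<close> to weight 0, so injectivity forces \<open>F (vac V)\<close> to be nonzero. For
  \<open>v\<close> and \<open>n = 0\<close>, evaluated at the vacuum, it gives
  \<open>F (L(1) v) = 0\<close>.\<close>

lemma (in cft_voa) Lop_1_weight_one:
  assumes simple: "simple V" and sc: "self_contragredient V" and v: "v \<in> wtsp V 1"
  shows "Lop V 1 v = 0"
proof -
  have fvs: "vector_space (contra_scale :: complex \<Rightarrow> ('a \<Rightarrow> complex) \<Rightarrow> _)"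
    by unfold_locales (auto simp: contra_scale_def fun_eq_iff algebra_simps)
  obtain \<phi> where \<phi>: "bij_betw \<phi> A (contra_carrier V)" "lin_on (vscale V) contra_scale A \<phi>"
    "\<And>k u n w. u \<in> wtsp V k \<Longrightarrow> w \<in> A \<Longrightarrow> \<phi> (vmode V u n w) = contra_mode V k u n (\<phi> w)"
    using sc unfolding self_contragredient_def by blast
  have \<phi>0: "\<phi> 0 = 0" using VV.lin_on_0[OF A_subspace \<phi>(2) fvs] .
  define F where "F = \<phi> (vac V)"
  have "F \<in> contra_carrier V" using \<phi>(1) unfolding F_def bij_betw_def by auto
  then have F: "\<And>u. u \<notin> A \<Longrightarrow> F u = 0" and Flin: "lin_on (vscale V) (\<lambda>c z. c * z) A F"
    unfolding contra_carrier_def by auto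
  have F0: "F 0 = 0" using VV.lin_on_0[OF A_subspace Flin complex_vs] .
  have zero: "contra_mode V k u n F w = 0" if "u \<in> wtsp V k" "n \<ge> 0" for k u n w
  proof -
    have "vmode V u n (vac V) = 0" using creation(1) that wtsp_in by blast
    then have "contra_mode V k u n F = 0" using \<phi>(3)[OF that(1) vac_in, of n] \<phi>0 F_def by metis
    then show ?thesis by simp
  qed
  have F_wtsp: "F w = 0" if w: "w \<in> wtsp V k" "k \<noteq> 0" for w k
  proof -
    have wA: "w \<in> A" using w wtsp_in by blast
    \<comment> \<open>Only \<open>j = 0\<close> is left, where the mode is
      \<open>4 - 1 - 2 = 1\<close>, that is \<open>L(0)\<close>.\<close>
    have pow: "(Lop V 1 ^^ j) (omg V) = 0" if "j \<ge> 1" for j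
      using that by (induction j rule: dec_induct) (auto simp: Lop_1_omg Lop_0)
    have "Sum_any (\<lambda>j. (1 / fact j) * F (vmode V ((Lop V 1 ^^ j) (omg V)) (2 * 2 - int j - 1 - 2) w))
      = (\<Sum>j<1. (1 / fact j) * F (vmode V ((Lop V 1 ^^ j) (omg V)) (2 * 2 - int j - 1 - 2) w))"
      by (rule Sum_any_lessThan) (simp add: pow Y_left_0 wA F0)
    then have "F (Lop V 0 w) = 0"
      using zero[OF omg_wtsp, of 1 w] wA unfolding contra_mode_def by (simp add: Lop_def)
    then have "of_int k * F w = 0"
      using VV.lin_on_scale[OF A_subspace Flin complex_vs wA] Lop_0_wtsp[OF w(1)] by simp
    then show ?thesis using w(2) by simp
  qed
  have F_vac: "F (vac V) \<noteq> 0"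
  proof
    assume 0: "F (vac V) = 0"
    have "F w = 0" if "w \<in> A" for w
      using that
    proof (induction rule: induct_hom)
      case (hom k u)
      show ?case
      proof (cases "k = 0")
        case True
        then obtain c where "u = vscale V c (vac V)" using wtsp_0 hom by blast
        then show ?thesis using VV.lin_on_scale[OF A_subspace Flin complex_vs vac_in] 0 by simp
      next
        case False
        then show ?thesis using F_wtsp hom by blast
      qed
    next
      case (add u w)
      then show ?case using VV.lin_on_add[OF A_subspace Flin complex_vs] by simp
    qed
    then have "F = 0" using F by (auto simp: fun_eq_iff)
    then have "\<phi> (vac V) = \<phi> 0" using \<phi>0 F_def by simp
    then have "vac V = 0"
      using \<phi>(1) vac_in A_subspace VV.subspace_0 unfolding bij_betw_def inj_on_def by blast
    then show False using vac_nonzero[OF simple] by blast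
  qed
  have vA: "v \<in> A" using v wtsp_in by blast
  have pow: "(Lop V 1 ^^ j) v = 0" if "j \<ge> 2" for j
    by (rule wtsp_neg[OF Lop_pow_wtsp[OF v, of j]]) (use that in auto)
  \<comment> \<open>The modes are \<open>-j\<close>: \<open>v_0\<close> annihilates the vacuum, and
    \<open>(L(1) v)_(-1)\<close> creates \<open>L(1) v\<close> from it.\<close>
  have "Sum_any (\<lambda>j. (1 / fact j) * F (vmode V ((Lop V 1 ^^ j) v) (2 * 1 - int j - 0 - 2) (vac V)))
    = (\<Sum>j<2. (1 / fact j) * F (vmode V ((Lop V 1 ^^ j) v) (2 * 1 - int j - 0 - 2) (vac V)))"
    by (rule Sum_any_lessThan) (simp add: pow Y_left_0 F0)
  also have "\<dots> = F (Lop V 1 v)"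
    using vA creation by (simp add: numeral_2_eq_2 F0)
  finally have "F (Lop V 1 v) = 0"
    using zero[OF v, of 0 "vac V"] unfolding contra_mode_def by simp
  moreover obtain c where c: "Lop V 1 v = vscale V c (vac V)"
    using wtsp_0[of "Lop V 1 v"] Lop_1_wtsp[OF v] by auto
  ultimately have "c * F (vac V) = 0"
    using VV.lin_on_scale[OF A_subspace Flin complex_vs vac_in] by simp
  then show ?thesis using c F_vac by simp
qed

theorem mainTheorem5:
  fixes V :: "'v::ab_group_add voa" and G :: "('v \<Rightarrow> 'v) set"
  assumes "voa V" and "simple V" and "cft_type V"
    and "finite_aut_group V G"
    and "strongly_rational TYPE('w::ab_group_add) (fixed_sub V G)"
    and "strongly_rational TYPE('v) (fixed_sub V G)"
  shows "strongly_rational TYPE('w) V"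
proof -
  interpret cft_voa V using assms(1,3) by unfold_locales
  interpret AG: voa_group_module V "adjoint V" G
    using assms(1,2,4) weak_adjoint by unfold_locales
  let ?U = "fixed_sub V G"
  have U: "voa ?U" "simple ?U" "cft_type ?U" "self_contragredient ?U" "C2_cofinite ?U"
    "rational TYPE('w) ?U"
    using assms(5) unfolding strongly_rational_def by auto
  have U_simps: "vscale ?U = vscale V" "vmode ?U = vmode V" "omg ?U = omg V" "vac ?U = vac V"
    unfolding fixed_sub_def by simp_all
  interpret U: cft_voa ?U using U by unfold_locales
  have U_in: "u \<in> A" if "u \<in> vcarrier ?U" for u
    using AG.U_subset[OF that] .
  \<comment> \<open>\<open>L(1) v\<close> is a multiple of the vacuum, hence fixed by
    \<open>G\<close>. So the orbit sum of \<open>v\<close> is sent to \<open>card G\<close> times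
    \<open>L(1) v\<close>, without cancellation, and the result for \<open>U\<close> applies to that
    sum.\<close>
  have L1: "Lop V 1 v = 0" if v: "v \<in> wtsp V 1" for v
  proof -
    have vA: "v \<in> A" using v wtsp_in by blast
    obtain c where c: "Lop V 1 v = vscale V c (vac V)"
      using wtsp_0[of "Lop V 1 v"] Lop_1_wtsp[OF v] by auto
    let ?e = "\<Sum>g\<in>G. g v"
    have gv: "g v \<in> wtsp V 1" if "g \<in> G" for g
      using v that vA AG.aut_mode[OF that omg_in vA, of 1] AG.aut_scale[OF that vA, of 1]
      unfolding wtsp_def Lop_def by simp
    have "?e \<in> wtsp V 1" using gv by (intro VV.subspace_sum[OF wtsp_subspace]) auto
    then have "?e \<in> wtsp ?U 1"
      using AG.orbit_sum_fixed[OF vA] unfolding wtsp_def Lop_def U_simps by simp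
    then have "Lop V 1 ?e = 0"
      using U.Lop_1_weight_one[OF U(2,4)] unfolding Lop_def U_simps by blast
    moreover have "Lop V 1 ?e = (\<Sum>g\<in>G. Lop V 1 (g v))"
      using gv wtsp_in by (intro VV.lin_on_sum[OF A_subspace Lop_lin VV.vector_space_axioms]) auto
    moreover have "Lop V 1 (g v) = vscale V c (vac V)" if g: "g \<in> G" for g
    proof -
      have "Lop V 1 (g v) = g (Lop V 1 v)"
        unfolding Lop_def using AG.aut_mode[OF g omg_in vA] g by simp
      also have "\<dots> = vscale V c (vac V)" unfolding c using AG.aut_scale[OF g vac_in] g by simp
      finally show ?thesis .
    qed
    ultimately have "vscale V (of_nat (card G)) (vscale V c (vac V)) = 0"
      by (simp add: VV.sum_constant_scale)
    moreover have "card G \<noteq> 0" using AG.id_G AG.finite_G card_0_eq by blast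
    ultimately show ?thesis using c by simp
  qed
  interpret quasi_primary_voa V using assms(2) L1 by unfold_locales
  interpret sub_voa V ?U
  proof
    show "wtsp ?U k = {0}" if "k < 0" for k using U(3) that unfolding cft_type_def by blast
  qed (use U U_simps U_in in auto)
  \<comment> \<open>Simplicity is irreducibility of the adjoint module, so the length bound yields
    finitely many generators of \<open>V\<close> over \<open>U\<close>.\<close>
  have "C2_cofinite V"
  proof -
    have "irreducible V (adjoint V)" using assms(2) unfolding simple_def .
    then obtain B where B: "finite B" "B \<subseteq> A"
      "\<And>S. submodule ?U (adjoint V) S \<Longrightarrow> B \<subseteq> S \<Longrightarrow> S = A"
      using AG.irreducible_finitely_generated unfolding adjoint_simps by blast
    show ?thesis
      by (rule C2_cofinite_extension[OF U(5) B(1,2)])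
        (auto simp: submodule_def adjoint_simps intro!: B(3))
  qed
  then show ?thesis
    unfolding strongly_rational_def
    using assms(1-3) self_contragredient rational_from_fixed_points[OF assms(1,2,4) U(6)] by blast
qed

end
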